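(* Let $\Lambda$ be the flat distributive law of the double presheaf 2-monad $\mathbb{P}\mathbb{P}^{\dag}$ over the presheaf 2-monad $\mathbb{P}$ given by $\Lambda_X=\overleftarrow{((\mathsf{y}_X)_{\text{!`}\,!})_*}=\mathsf{y}_{\mathsf{P}\mathsf{P}^{\dag}X}\cdot((\mathsf{y}_X)_{\text{!`}})^!:\mathsf{P}\mathsf{P}^{\dag}\mathsf{P}X\to\mathsf{P}\mathsf{P}\mathsf{P}^{\dag}X$. Then there is an isomorphism of 2-categories $$(\Lambda,\mathcal{Q})\text{-}\mathbf{Alg}\cong\mathcal{Q}\text{-}\mathbf{Int}$$ between lax $\Lambda$-algebras over $\mathcal{Q}$ and $\mathcal{Q}$-interior spaces.
   Context: Basic conventions. $\mathcal{Q}$ is a small quantaloid: a small category whose hom-sets are complete lattices (order $\preceq$) and whose composition preserves arbitrary suprema in each variable; $\mathcal{Q}_0$ is its object set. For $u:r\to s$, $v:s\to t$, $w:r\to t$ in $\mathcal{Q}$, the arrows $v\searrow w:r\to s$ and $w\swarrow u:s\to t$ are defined by $u\preceq v\searrow w\iff v\circ u\preceq w\iff v\preceq w\swarrow u$. For sets $X,Y$ equipped with type maps $|\text{-}|$ to $\mathcal{Q}_0$, a $\mathcal{Q}$-relation $\phi:X\nrightarrow Y$ assigns to each $(x,y)$ a morphism $\phi(x,y):|x|\to|y|$ of $\mathcal{Q}$; these are ordered pointwise by $\preceq$ and composed by $(\psi\circ\phi)(x,z)=\bigvee_y\psi(y,z)\circ\phi(x,y)$. A $\mathcal{Q}$-category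 is a set $X$ over $\mathcal{Q}_0$ with a $\mathcal{Q}$-relation $1_X^*:X\nrightarrow X$ (its hom) such that $1_{|x|}\preceq 1_X^*(x,x)$ and $1_X^*\circ 1_X^*\preceq 1_X^*$; it is preordered by $x\leq x'\iff |x|=|x'|$ and $1_{|x|}\preceq 1_X^*(x,x')$. A $\mathcal{Q}$-functor $f:X\to Y$ is a type-preserving map with $1_X^*(x,x')\preceq 1_Y^*(fx,fx')$; $f\leq g$ is pointwise. This gives the locally preordered 2-category $\mathcal{Q}\text{-}\mathbf{Cat}$. A 2-functor on it is a functor that is monotone on homs; a 2-monad $(T,m,e)$ is a monad whose functor $T$ is a 2-functor (multiplication $m:TT\to T$, unit $e:1\to T$). A distributor $\phi:X\nrightarrow Y$ is a $\mathcal{Q}$-relation with $1_Y^*\circ\phi\circ 1_X^*\preceq\phi$. For a $\mathcal{Q}$-functor $f:X\to Y$: $f_*:X\nrightarrow Y$, $f_*(x,y)=1_Y^*(fx,y)$, and $f^*:Y\nrightarrow X$, $f^*(y,x)=1_Y^*(y,fx)$. Let $\{s\}$ be the one-object $\mathcal{Q}$-category of type $s\in\mathcal{Q}_0$ with hom $1_s$. $\mathsf{P}X$ is the $\mathcal{Q}$-category of distributors $\sigma:X\nrightarrow\{s\}$ ($|\sigma|=s$) with $1_{\mathsf{P}X}^*(\sigma,\sigma')=\bigwedge_x\sigma'(x)\swarrow\sigma(x)$; $\mathsf{P}^{\dag}X$ is the $\mathcal{Q}$-category of distributors $\tau:\{s\}\nrightarrow X$ ($|\tau|=s$) with $1_{\mathsf{P}^{\dag}X}^*(\tau,\tau')=\bigwedge_x\tau'(x)\searrow\tau(x)$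 (so $\tau\leq\tau'$ in $\mathsf{P}^{\dag}X$ iff $\tau'\preceq\tau$). Yoneda embeddings: $\mathsf{y}_X:X\to\mathsf{P}X$, $x\mapsto 1_X^*(-,x)$; $\mathsf{y}^{\dag}_X:X\to\mathsf{P}^{\dag}X$, $x\mapsto 1_X^*(x,-)$. For $f:X\to Y$: $f_!:\mathsf{P}X\to\mathsf{P}Y$, $\sigma\mapsto\sigma\circ f^*$; $f^!:\mathsf{P}Y\to\mathsf{P}X$, $\sigma\mapsto\sigma\circ f_*$; $f_{\text{!`}}:\mathsf{P}^{\dag}X\to\mathsf{P}^{\dag}Y$, $\tau\mapsto f_*\circ\tau$; $f^{\text{!`}}:\mathsf{P}^{\dag}Y\to\mathsf{P}^{\dag}X$, $\tau\mapsto f^*\circ\tau$; iterated decorations are applied from left to right, e.g. $f_{\text{!`}\,!}=(f_{\text{!`}})_!$. For a distributor $\phi:X\nrightarrow Y$, $\overleftarrow{\phi}:Y\to\mathsf{P}X$ is $y\mapsto\phi(-,y)$. The presheaf 2-monad $\mathbb{P}=(\mathsf{P},\mathsf{s},\mathsf{y})$ sends $f$ to $f_!$, with unit $\mathsf{y}$ and multiplication $\mathsf{s}_X=\mathsf{y}_X^!:\mathsf{P}\mathsf{P}X\to\mathsf{P}X$. The double presheaf 2-monad $\mathbb{P}\mathbb{P}^{\dag}$ has underlying 2-functor $X\mapsto\mathsf{P}\mathsf{P}^{\dag}X$, $f\mapsto f_{\text{!`}\,!}$, unit $\mathfrak{y}_X=\mathsf{y}_{\mathsf{P}^{\dag}X}\cdot\mathsf{y}^{\dag}_X:X\to\mathsf{P}\mathsf{P}^{\dag}X$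 and multiplication $\mathfrak{s}_X=((\mathsf{y}_{\mathsf{P}^{\dag}X})_{\text{!`}}\cdot\mathsf{y}^{\dag}_{\mathsf{P}^{\dag}X})^!:\mathsf{P}\mathsf{P}^{\dag}\mathsf{P}\mathsf{P}^{\dag}X\to\mathsf{P}\mathsf{P}^{\dag}X$. Distributive laws ("distributive law" means lax distributive law). For a 2-monad $\mathbb{T}=(T,m,e)$ on $\mathcal{Q}\text{-}\mathbf{Cat}$, a distributive law $\lambda:T\mathsf{P}\to\mathsf{P}T$ of $\mathbb{T}$ over $\mathbb{P}$ is a family of $\mathcal{Q}$-functors $\lambda_X:T\mathsf{P}X\to\mathsf{P}TX$ such that for all $\mathcal{Q}$-functors $f:X\to Y$: (a) $(Tf)_!\cdot\lambda_X\leq\lambda_Y\cdot T(f_!)$; (b) $\mathsf{y}_{TX}\leq\lambda_X\cdot T\mathsf{y}_X$; (c) $\mathsf{s}_{TX}\cdot(\lambda_X)_!\cdot\lambda_{\mathsf{P}X}\leq\lambda_X\cdot T\mathsf{s}_X$; (d) $(e_X)_!\leq\lambda_X\cdot e_{\mathsf{P}X}$; (e) $(m_X)_!\cdot\lambda_{TX}\cdot T\lambda_X\leq\lambda_X\cdot m_{\mathsf{P}X}$. It is flat if (b) is an equality for all $X$. Lax algebras. For a distributive law $\lambda$ of $\mathbb{T}$ over $\mathbb{P}$, a lax $\lambda$-algebra $(X,p)$ over $\mathcal{Q}$ is a $\mathcal{Q}$-category $X$ with a $\mathcal{Q}$-functor $p:TX\to\mathsf{P}X$ such that $\mathsf{y}_X\leq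 p\cdot e_X$ and $\mathsf{s}_X\cdot p_!\cdot\lambda_X\cdot Tp\leq p\cdot m_X$. A lax $\lambda$-homomorphism $f:(X,p)\to(Y,q)$ is a $\mathcal{Q}$-functor $f:X\to Y$ with $f_!\cdot p\leq q\cdot Tf$. With the local order of $\mathcal{Q}\text{-}\mathbf{Cat}$ these form the 2-category $(\lambda,\mathcal{Q})\text{-}\mathbf{Alg}$. (Here $\mathbb{T}=\mathbb{P}\mathbb{P}^{\dag}$, $\lambda=\Lambda$.) $\mathcal{Q}$-interior spaces. A $\mathcal{Q}$-interior space $(X,c)$ is a $\mathcal{Q}$-category $X$ with a $\mathcal{Q}$-closure operation $c$ on $\mathsf{P}^{\dag}X$, i.e. a $\mathcal{Q}$-functor $c:\mathsf{P}^{\dag}X\to\mathsf{P}^{\dag}X$ with $1_{\mathsf{P}^{\dag}X}\leq c$ and $c\cdot c=c$. A continuous $\mathcal{Q}$-functor $f:(X,c)\to(Y,d)$ is a $\mathcal{Q}$-functor $f:X\to Y$ with $c\cdot f^{\text{!`}}\leq f^{\text{!`}}\cdot d:\mathsf{P}^{\dag}Y\to\mathsf{P}^{\dag}X$. With the local order of $\mathcal{Q}\text{-}\mathbf{Cat}$ these form the 2-category $\mathcal{Q}\text{-}\mathbf{Int}$. *)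

theory Defs
  imports "HOL-Algebra.Complete_Lattice" "HOL-Library.FuncSet"
begin

section \<open>Small quantaloids\<close>

text \<open>
  The hom-sets are complete lattices in the sense of HOL-Algebra, indexed by their domain and
  codomain; they need not be disjoint, so composition and identities carry their objects along:
  for \<open>u : r \<rightarrow> s\<close> and \<open>v : s \<rightarrow> t\<close>, the composite \<open>v \<circ> u\<close> is \<open>Cmp Q r s t v u\<close>.
\<close>

record ('o, 'a) quantaloid =
  Ob :: "'o set"
  Hom :: "'o \<Rightarrow> 'o \<Rightarrow> 'a gorder"
  Cmp :: "'o \<Rightarrow> 'o \<Rightarrow> 'o \<Rightarrow> 'a \<Rightarrow> 'a \<Rightarrow> 'a"
  Idn :: "'o \<Rightarrow> 'a"

locale quantaloid =
  fixes Q :: "('o, 'a) quantaloid"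
  assumes hom_complete_lattice:
      "\<lbrakk>r \<in> Ob Q; s \<in> Ob Q\<rbrakk> \<Longrightarrow> complete_lattice (Hom Q r s)"
    and cmp_closed:
      "\<lbrakk>r \<in> Ob Q; s \<in> Ob Q; t \<in> Ob Q; u \<in> carrier (Hom Q r s); v \<in> carrier (Hom Q s t)\<rbrakk>
        \<Longrightarrow> Cmp Q r s t v u \<in> carrier (Hom Q r t)"
    and idn_closed: "r \<in> Ob Q \<Longrightarrow> Idn Q r \<in> carrier (Hom Q r r)"
    and cmp_assoc:
      "\<lbrakk>q \<in> Ob Q; r \<in> Ob Q; s \<in> Ob Q; t \<in> Ob Q;
        u \<in> carrier (Hom Q q r); v \<in> carrier (Hom Q r s); w \<in> carrier (Hom Q s t)\<rbrakk>
        \<Longrightarrow> Cmp Q q s t w (Cmp Q q r s v u) = Cmp Q q r t (Cmp Q r s t w v) u"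
    and cmp_idn_left:
      "\<lbrakk>r \<in> Ob Q; s \<in> Ob Q; u \<in> carrier (Hom Q r s)\<rbrakk> \<Longrightarrow> Cmp Q r s s (Idn Q s) u = u"
    and cmp_idn_right:
      "\<lbrakk>r \<in> Ob Q; s \<in> Ob Q; u \<in> carrier (Hom Q r s)\<rbrakk> \<Longrightarrow> Cmp Q r r s u (Idn Q r) = u"
    and cmp_sup_left:
      "\<lbrakk>r \<in> Ob Q; s \<in> Ob Q; t \<in> Ob Q; u \<in> carrier (Hom Q r s); V \<subseteq> carrier (Hom Q s t)\<rbrakk>
        \<Longrightarrow> Cmp Q r s t (\<Squnion>\<^bsub>Hom Q s t\<^esub> V) u = \<Squnion>\<^bsub>Hom Q r t\<^esub> ((\<lambda>v. Cmp Q r s t v u) ` V)"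
    and cmp_sup_right:
      "\<lbrakk>r \<in> Ob Q; s \<in> Ob Q; t \<in> Ob Q; U \<subseteq> carrier (Hom Q r s); v \<in> carrier (Hom Q s t)\<rbrakk>
        \<Longrightarrow> Cmp Q r s t v (\<Squnion>\<^bsub>Hom Q r s\<^esub> U) = \<Squnion>\<^bsub>Hom Q r t\<^esub> ((\<lambda>u. Cmp Q r s t v u) ` U)"

text \<open>
  Residuals, for \<open>u : r \<rightarrow> s\<close>, \<open>v : s \<rightarrow> t\<close>, \<open>w : r \<rightarrow> t\<close>:
  \<open>res_right Q r s t v w\<close> is \<open>v \<searrow> w : r \<rightarrow> s\<close> and
  \<open>res_left Q r s t w u\<close> is \<open>w \<swarrow> u : s \<rightarrow> t\<close>.
\<close>

definition res_right ::
    "('o, 'a) quantaloid \<Rightarrow> 'o \<Rightarrow> 'o \<Rightarrow> 'o \<Rightarrow> 'a \<Rightarrow> 'a \<Rightarrow> 'a" where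
  "res_right Q r s t v w =
    (THE z. z \<in> carrier (Hom Q r s) \<and>
      (\<forall>u \<in> carrier (Hom Q r s). u \<sqsubseteq>\<^bsub>Hom Q r s\<^esub> z \<longleftrightarrow> Cmp Q r s t v u \<sqsubseteq>\<^bsub>Hom Q r t\<^esub> w))"

definition res_left ::
    "('o, 'a) quantaloid \<Rightarrow> 'o \<Rightarrow> 'o \<Rightarrow> 'o \<Rightarrow> 'a \<Rightarrow> 'a \<Rightarrow> 'a" where
  "res_left Q r s t w u =
    (THE z. z \<in> carrier (Hom Q s t) \<and>
      (\<forall>v \<in> carrier (Hom Q s t). v \<sqsubseteq>\<^bsub>Hom Q s t\<^esub> z \<longleftrightarrow> Cmp Q r s t v u \<sqsubseteq>\<^bsub>Hom Q r t\<^esub> w))"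


section \<open>Relations, categories, functors and distributors over a quantaloid\<close>

text \<open>
  The underlying set of a category is the \<open>carrier\<close>, a subset of a type \<open>'x\<close>. Type maps, homs,
  relations and functors are all extensional (\<open>undefined\<close> off the carriers), so that HOL equality
  is the intended equality of these data.
\<close>

record ('o, 'a, 'x) qcat = "'x partial_object" +
  ty :: "'x \<Rightarrow> 'o"
  hm :: "'x \<Rightarrow> 'x \<Rightarrow> 'a"

definition qrel ::
    "('o, 'a) quantaloid \<Rightarrow> ('o, 'a, 'x) qcat \<Rightarrow> ('o, 'a, 'y) qcat \<Rightarrow> ('x \<Rightarrow> 'y \<Rightarrow> 'a) set" where
  "qrel Q X Y = (\<Pi>\<^sub>E x \<in> carrier X. \<Pi>\<^sub>E y \<in> carrier Y. carrier (Hom Q (ty X x) (ty Y y)))"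

definition qrel_le ::
    "('o, 'a) quantaloid \<Rightarrow> ('o, 'a, 'x) qcat \<Rightarrow> ('o, 'a, 'y) qcat \<Rightarrow>
      ('x \<Rightarrow> 'y \<Rightarrow> 'a) \<Rightarrow> ('x \<Rightarrow> 'y \<Rightarrow> 'a) \<Rightarrow> bool" where
  "qrel_le Q X Y \<phi> \<psi> \<longleftrightarrow>
    (\<forall>x \<in> carrier X. \<forall>y \<in> carrier Y. \<phi> x y \<sqsubseteq>\<^bsub>Hom Q (ty X x) (ty Y y)\<^esub> \<psi> x y)"

text \<open>\<open>qrel_comp Q X Y Z \<psi> \<phi>\<close> is \<open>\<psi> \<circ> \<phi>\<close> for \<open>\<phi>\<close> from \<open>X\<close> to \<open>Y\<close> and \<open>\<psi>\<close> from \<open>Y\<close> to \<open>Z\<close>.\<close>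

definition qrel_comp ::
    "('o, 'a) quantaloid \<Rightarrow> ('o, 'a, 'x) qcat \<Rightarrow> ('o, 'a, 'y) qcat \<Rightarrow> ('o, 'a, 'z) qcat \<Rightarrow>
      ('y \<Rightarrow> 'z \<Rightarrow> 'a) \<Rightarrow> ('x \<Rightarrow> 'y \<Rightarrow> 'a) \<Rightarrow> 'x \<Rightarrow> 'z \<Rightarrow> 'a" where
  "qrel_comp Q X Y Z \<psi> \<phi> =
    (\<lambda>x \<in> carrier X. \<lambda>z \<in> carrier Z.
      \<Squnion>\<^bsub>Hom Q (ty X x) (ty Z z)\<^esub>
        ((\<lambda>y. Cmp Q (ty X x) (ty Y y) (ty Z z) (\<psi> y z) (\<phi> x y)) ` carrier Y))"

definition qcategory :: "('o, 'a) quantaloid \<Rightarrow> ('o, 'a, 'x) qcat \<Rightarrow> bool" where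
  "qcategory Q X \<longleftrightarrow>
    ty X \<in> carrier X \<rightarrow>\<^sub>E Ob Q \<and>
    hm X \<in> qrel Q X X \<and>
    (\<forall>x \<in> carrier X. Idn Q (ty X x) \<sqsubseteq>\<^bsub>Hom Q (ty X x) (ty X x)\<^esub> hm X x x) \<and>
    qrel_le Q X X (qrel_comp Q X X X (hm X) (hm X)) (hm X)"

definition qle :: "('o, 'a) quantaloid \<Rightarrow> ('o, 'a, 'x) qcat \<Rightarrow> 'x \<Rightarrow> 'x \<Rightarrow> bool" where
  "qle Q X x x' \<longleftrightarrow>
    ty X x = ty X x' \<and> Idn Q (ty X x) \<sqsubseteq>\<^bsub>Hom Q (ty X x) (ty X x')\<^esub> hm X x x'"

definition qfunctors ::
    "('o, 'a) quantaloid \<Rightarrow> ('o, 'a, 'x) qcat \<Rightarrow> ('o, 'a, 'y) qcat \<Rightarrow> ('x \<Rightarrow> 'y) set" where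
  "qfunctors Q X Y =
    {f \<in> carrier X \<rightarrow>\<^sub>E carrier Y.
      (\<forall>x \<in> carrier X. ty Y (f x) = ty X x) \<and>
      (\<forall>x \<in> carrier X. \<forall>x' \<in> carrier X.
        hm X x x' \<sqsubseteq>\<^bsub>Hom Q (ty X x) (ty X x')\<^esub> hm Y (f x) (f x'))}"

definition fun_le ::
    "('o, 'a) quantaloid \<Rightarrow> ('o, 'a, 'x) qcat \<Rightarrow> ('o, 'a, 'y) qcat \<Rightarrow>
      ('x \<Rightarrow> 'y) \<Rightarrow> ('x \<Rightarrow> 'y) \<Rightarrow> bool" where
  "fun_le Q X Y f g \<longleftrightarrow> (\<forall>x \<in> carrier X. qle Q Y (f x) (g x))"

definition distributors ::
    "('o, 'a) quantaloid \<Rightarrow> ('o, 'a, 'x) qcat \<Rightarrow> ('o, 'a, 'y) qcat \<Rightarrow> ('x \<Rightarrow> 'y \<Rightarrow> 'a) set" where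
  "distributors Q X Y =
    {\<phi> \<in> qrel Q X Y.
      qrel_le Q X Y (qrel_comp Q X Y Y (hm Y) (qrel_comp Q X X Y \<phi> (hm X))) \<phi>}"

text \<open>\<open>graph X Y f\<close> and \<open>cograph X Y f\<close> are \<open>f\<^sub>*\<close> (from \<open>X\<close> to \<open>Y\<close>) and \<open>f\<^sup>*\<close> (from \<open>Y\<close> to \<open>X\<close>).\<close>

definition graph ::
    "('o, 'a, 'x) qcat \<Rightarrow> ('o, 'a, 'y) qcat \<Rightarrow> ('x \<Rightarrow> 'y) \<Rightarrow> 'x \<Rightarrow> 'y \<Rightarrow> 'a" where
  "graph X Y f = (\<lambda>x \<in> carrier X. \<lambda>y \<in> carrier Y. hm Y (f x) y)"

definition cograph ::
    "('o, 'a, 'x) qcat \<Rightarrow> ('o, 'a, 'y) qcat \<Rightarrow> ('x \<Rightarrow> 'y) \<Rightarrow> 'y \<Rightarrow> 'x \<Rightarrow> 'a" where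
  "cograph X Y f = (\<lambda>y \<in> carrier Y. \<lambda>x \<in> carrier X. hm Y y (f x))"


section \<open>Presheaves and copresheaves\<close>

definition point :: "('o, 'a) quantaloid \<Rightarrow> 'o \<Rightarrow> ('o, 'a, unit) qcat" where
  "point Q s = \<lparr>carrier = {()}, ty = (\<lambda>_. s), hm = (\<lambda>_ _. Idn Q s)\<rparr>"

text \<open>A (co)presheaf is paired with its type, since the hom-sets are not assumed disjoint.\<close>

type_synonym ('o, 'a, 'x) psh = "'o \<times> ('x \<Rightarrow> unit \<Rightarrow> 'a)"
type_synonym ('o, 'a, 'x) copsh = "'o \<times> (unit \<Rightarrow> 'x \<Rightarrow> 'a)"

definition PSh ::
    "('o, 'a) quantaloid \<Rightarrow> ('o, 'a, 'x) qcat \<Rightarrow> ('o, 'a, ('o, 'a, 'x) psh) qcat" where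
  "PSh Q X = (let C = (SIGMA s : Ob Q. distributors Q X (point Q s)) in
    \<lparr>carrier = C,
     ty = (\<lambda>\<sigma> \<in> C. fst \<sigma>),
     hm = (\<lambda>\<sigma> \<in> C. \<lambda>\<sigma>' \<in> C.
       \<Sqinter>\<^bsub>Hom Q (fst \<sigma>) (fst \<sigma>')\<^esub>
         ((\<lambda>x. res_left Q (ty X x) (fst \<sigma>) (fst \<sigma>') (snd \<sigma>' x ()) (snd \<sigma> x ())) ` carrier X))\<rparr>)"

definition CoPSh ::
    "('o, 'a) quantaloid \<Rightarrow> ('o, 'a, 'x) qcat \<Rightarrow> ('o, 'a, ('o, 'a, 'x) copsh) qcat" where
  "CoPSh Q X = (let C = (SIGMA s : Ob Q. distributors Q (point Q s) X) in
    \<lparr>carrier = C,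
     ty = (\<lambda>\<tau> \<in> C. fst \<tau>),
     hm = (\<lambda>\<tau> \<in> C. \<lambda>\<tau>' \<in> C.
       \<Sqinter>\<^bsub>Hom Q (fst \<tau>) (fst \<tau>')\<^esub>
         ((\<lambda>x. res_right Q (fst \<tau>) (fst \<tau>') (ty X x) (snd \<tau>' () x) (snd \<tau> () x)) ` carrier X))\<rparr>)"

text \<open>
  \<open>curry_dist X Y \<phi>\<close> is the functor \<open>Y \<rightarrow> PSh Q X\<close>, \<open>y \<mapsto> \<phi>(-, y)\<close> (an overleftarrow on \<open>\<phi>\<close> in
  the usual notation) for a distributor \<open>\<phi>\<close> from \<open>X\<close> to \<open>Y\<close>.
\<close>

definition curry_dist ::
    "('o, 'a, 'x) qcat \<Rightarrow> ('o, 'a, 'y) qcat \<Rightarrow> ('x \<Rightarrow> 'y \<Rightarrow> 'a) \<Rightarrow> 'y \<Rightarrow> ('o, 'a, 'x) psh" where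
  "curry_dist X Y \<phi> = (\<lambda>y \<in> carrier Y. (ty Y y, \<lambda>x \<in> carrier X. \<lambda>_. \<phi> x y))"

definition yon :: "('o, 'a, 'x) qcat \<Rightarrow> 'x \<Rightarrow> ('o, 'a, 'x) psh" where
  "yon X = (\<lambda>x \<in> carrier X. (ty X x, \<lambda>x' \<in> carrier X. \<lambda>_. hm X x' x))"

definition coyon :: "('o, 'a, 'x) qcat \<Rightarrow> 'x \<Rightarrow> ('o, 'a, 'x) copsh" where
  "coyon X = (\<lambda>x \<in> carrier X. (ty X x, \<lambda>_. \<lambda>x' \<in> carrier X. hm X x x'))"

text \<open>
  For \<open>f : X \<rightarrow> Y\<close>: \<open>psh_push\<close> is \<open>f\<^sub>!\<close>, \<open>psh_pull\<close> is \<open>f\<^sup>!\<close>, and \<open>copsh_push\<close>, \<open>copsh_pull\<close> are their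
  analogues (lower and upper inverted exclamation mark) for copresheaves.
\<close>

definition psh_push ::
    "('o, 'a) quantaloid \<Rightarrow> ('o, 'a, 'x) qcat \<Rightarrow> ('o, 'a, 'y) qcat \<Rightarrow> ('x \<Rightarrow> 'y) \<Rightarrow>
      ('o, 'a, 'x) psh \<Rightarrow> ('o, 'a, 'y) psh" where
  "psh_push Q X Y f =
    (\<lambda>\<sigma> \<in> carrier (PSh Q X).
      (fst \<sigma>, qrel_comp Q Y X (point Q (fst \<sigma>)) (snd \<sigma>) (cograph X Y f)))"

definition psh_pull ::
    "('o, 'a) quantaloid \<Rightarrow> ('o, 'a, 'x) qcat \<Rightarrow> ('o, 'a, 'y) qcat \<Rightarrow> ('x \<Rightarrow> 'y) \<Rightarrow>
      ('o, 'a, 'y) psh \<Rightarrow> ('o, 'a, 'x) psh" where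
  "psh_pull Q X Y f =
    (\<lambda>\<sigma> \<in> carrier (PSh Q Y).
      (fst \<sigma>, qrel_comp Q X Y (point Q (fst \<sigma>)) (snd \<sigma>) (graph X Y f)))"

definition copsh_push ::
    "('o, 'a) quantaloid \<Rightarrow> ('o, 'a, 'x) qcat \<Rightarrow> ('o, 'a, 'y) qcat \<Rightarrow> ('x \<Rightarrow> 'y) \<Rightarrow>
      ('o, 'a, 'x) copsh \<Rightarrow> ('o, 'a, 'y) copsh" where
  "copsh_push Q X Y f =
    (\<lambda>\<tau> \<in> carrier (CoPSh Q X).
      (fst \<tau>, qrel_comp Q (point Q (fst \<tau>)) X Y (graph X Y f) (snd \<tau>)))"

definition copsh_pull ::
    "('o, 'a) quantaloid \<Rightarrow> ('o, 'a, 'x) qcat \<Rightarrow> ('o, 'a, 'y) qcat \<Rightarrow> ('x \<Rightarrow> 'y) \<Rightarrow>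
      ('o, 'a, 'y) copsh \<Rightarrow> ('o, 'a, 'x) copsh" where
  "copsh_pull Q X Y f =
    (\<lambda>\<tau> \<in> carrier (CoPSh Q Y).
      (fst \<tau>, qrel_comp Q (point Q (fst \<tau>)) Y X (cograph X Y f) (snd \<tau>)))"

definition psh_mult ::
    "('o, 'a) quantaloid \<Rightarrow> ('o, 'a, 'x) qcat \<Rightarrow>
      ('o, 'a, ('o, 'a, 'x) psh) psh \<Rightarrow> ('o, 'a, 'x) psh" where
  "psh_mult Q X = psh_pull Q X (PSh Q X) (yon X)"


section \<open>The double presheaf 2-monad\<close>

type_synonym ('o, 'a, 'x) dpsh = "('o, 'a, ('o, 'a, 'x) copsh) psh"

definition DP ::
    "('o, 'a) quantaloid \<Rightarrow> ('o, 'a, 'x) qcat \<Rightarrow> ('o, 'a, ('o, 'a, 'x) dpsh) qcat" where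
  "DP Q X = PSh Q (CoPSh Q X)"

definition dp_map ::
    "('o, 'a) quantaloid \<Rightarrow> ('o, 'a, 'x) qcat \<Rightarrow> ('o, 'a, 'y) qcat \<Rightarrow> ('x \<Rightarrow> 'y) \<Rightarrow>
      ('o, 'a, 'x) dpsh \<Rightarrow> ('o, 'a, 'y) dpsh" where
  "dp_map Q X Y f = psh_push Q (CoPSh Q X) (CoPSh Q Y) (copsh_push Q X Y f)"

definition dp_unit ::
    "('o, 'a) quantaloid \<Rightarrow> ('o, 'a, 'x) qcat \<Rightarrow> 'x \<Rightarrow> ('o, 'a, 'x) dpsh" where
  "dp_unit Q X = compose (carrier X) (yon (CoPSh Q X)) (coyon X)"

definition dp_mult ::
    "('o, 'a) quantaloid \<Rightarrow> ('o, 'a, 'x) qcat \<Rightarrow>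
      ('o, 'a, ('o, 'a, 'x) dpsh) dpsh \<Rightarrow> ('o, 'a, 'x) dpsh" where
  "dp_mult Q X =
    psh_pull Q (CoPSh Q X) (CoPSh Q (DP Q X))
      (compose (carrier (CoPSh Q X))
        (copsh_push Q (CoPSh Q X) (DP Q X) (yon (CoPSh Q X)))
        (coyon (CoPSh Q X)))"


section \<open>Distributive laws over the presheaf 2-monad\<close>

text \<open>
  A family \<open>\<lambda>\<^sub>X : T P X \<rightarrow> P T X\<close>, with \<open>T\<close> the double presheaf 2-monad. HOL families are indexed
  by categories carried by one type, while the axioms also mention the components at \<open>P X\<close> and
  \<open>T X\<close>, which are carried by other types; hence the three arguments \<open>lam\<close>, \<open>lamP\<close>, \<open>lamT\<close> below,
  to be instantiated by the same polymorphic constant.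
\<close>

type_synonym ('o, 'a, 'x) law =
  "('o, 'a, 'x) qcat \<Rightarrow> ('o, 'a, ('o, 'a, 'x) psh) dpsh \<Rightarrow> ('o, 'a, ('o, 'a, 'x) dpsh) psh"

definition distributive_law ::
    "('o, 'a) quantaloid \<Rightarrow> ('o, 'a, 'x) law \<Rightarrow> ('o, 'a, ('o, 'a, 'x) psh) law \<Rightarrow>
      ('o, 'a, ('o, 'a, 'x) dpsh) law \<Rightarrow> bool" where
  "distributive_law Q lam lamP lamT \<longleftrightarrow>
    (\<forall>X. qcategory Q X \<longrightarrow> lam X \<in> qfunctors Q (DP Q (PSh Q X)) (PSh Q (DP Q X))) \<and>
    (\<forall>X Y f. qcategory Q X \<longrightarrow> qcategory Q Y \<longrightarrow> f \<in> qfunctors Q X Y \<longrightarrow>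
      fun_le Q (DP Q (PSh Q X)) (PSh Q (DP Q Y))
        (compose (carrier (DP Q (PSh Q X)))
          (psh_push Q (DP Q X) (DP Q Y) (dp_map Q X Y f)) (lam X))
        (compose (carrier (DP Q (PSh Q X)))
          (lam Y) (dp_map Q (PSh Q X) (PSh Q Y) (psh_push Q X Y f)))) \<and>
    (\<forall>X. qcategory Q X \<longrightarrow>
      fun_le Q (DP Q X) (PSh Q (DP Q X))
        (yon (DP Q X))
        (compose (carrier (DP Q X)) (lam X) (dp_map Q X (PSh Q X) (yon X)))) \<and>
    (\<forall>X. qcategory Q X \<longrightarrow>
      fun_le Q (DP Q (PSh Q (PSh Q X))) (PSh Q (DP Q X))
        (compose (carrier (DP Q (PSh Q (PSh Q X))))
          (psh_mult Q (DP Q X))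
          (compose (carrier (DP Q (PSh Q (PSh Q X))))
            (psh_push Q (DP Q (PSh Q X)) (PSh Q (DP Q X)) (lam X))
            (lamP (PSh Q X))))
        (compose (carrier (DP Q (PSh Q (PSh Q X))))
          (lam X) (dp_map Q (PSh Q (PSh Q X)) (PSh Q X) (psh_mult Q X)))) \<and>
    (\<forall>X. qcategory Q X \<longrightarrow>
      fun_le Q (PSh Q X) (PSh Q (DP Q X))
        (psh_push Q X (DP Q X) (dp_unit Q X))
        (compose (carrier (PSh Q X)) (lam X) (dp_unit Q (PSh Q X)))) \<and>
    (\<forall>X. qcategory Q X \<longrightarrow>
      fun_le Q (DP Q (DP Q (PSh Q X))) (PSh Q (DP Q X))
        (compose (carrier (DP Q (DP Q (PSh Q X))))
          (psh_push Q (DP Q (DP Q X)) (DP Q X) (dp_mult Q X))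
          (compose (carrier (DP Q (DP Q (PSh Q X))))
            (lamT (DP Q X))
            (dp_map Q (DP Q (PSh Q X)) (PSh Q (DP Q X)) (lam X))))
        (compose (carrier (DP Q (DP Q (PSh Q X))))
          (lam X) (dp_mult Q (PSh Q X))))"

definition flat_distributive_law ::
    "('o, 'a) quantaloid \<Rightarrow> ('o, 'a, 'x) law \<Rightarrow> ('o, 'a, ('o, 'a, 'x) psh) law \<Rightarrow>
      ('o, 'a, ('o, 'a, 'x) dpsh) law \<Rightarrow> bool" where
  "flat_distributive_law Q lam lamP lamT \<longleftrightarrow>
    distributive_law Q lam lamP lamT \<and>
    (\<forall>X. qcategory Q X \<longrightarrow>
      yon (DP Q X) = compose (carrier (DP Q X)) (lam X) (dp_map Q X (PSh Q X) (yon X)))"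

definition Lambda :: "('o, 'a) quantaloid \<Rightarrow> ('o, 'a, 'x) law" where
  "Lambda Q X =
    curry_dist (DP Q X) (DP Q (PSh Q X))
      (graph (DP Q X) (DP Q (PSh Q X)) (dp_map Q X (PSh Q X) (yon X)))"


section \<open>Locally preordered 2-categories\<close>

record ('b, 'm) twocat =
  Obj :: "'b set"
  Mor :: "'b \<Rightarrow> 'b \<Rightarrow> 'm set"
  mle :: "'b \<Rightarrow> 'b \<Rightarrow> 'm \<Rightarrow> 'm \<Rightarrow> bool"
  mcmp :: "'b \<Rightarrow> 'b \<Rightarrow> 'b \<Rightarrow> 'm \<Rightarrow> 'm \<Rightarrow> 'm"
  mid :: "'b \<Rightarrow> 'm"

definition twocategory :: "('b, 'm) twocat \<Rightarrow> bool" where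
  "twocategory C \<longleftrightarrow>
    (\<forall>A \<in> Obj C. mid C A \<in> Mor C A A) \<and>
    (\<forall>A \<in> Obj C. \<forall>B \<in> Obj C. \<forall>D \<in> Obj C. \<forall>f \<in> Mor C A B. \<forall>g \<in> Mor C B D.
      mcmp C A B D g f \<in> Mor C A D) \<and>
    (\<forall>A \<in> Obj C. \<forall>B \<in> Obj C. \<forall>f \<in> Mor C A B.
      mcmp C A A B f (mid C A) = f \<and> mcmp C A B B (mid C B) f = f) \<and>
    (\<forall>A \<in> Obj C. \<forall>B \<in> Obj C. \<forall>D \<in> Obj C. \<forall>E \<in> Obj C.
      \<forall>f \<in> Mor C A B. \<forall>g \<in> Mor C B D. \<forall>h \<in> Mor C D E.
      mcmp C A D E h (mcmp C A B D g f) = mcmp C A B E (mcmp C B D E h g) f) \<and>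
    (\<forall>A \<in> Obj C. \<forall>B \<in> Obj C. \<forall>f \<in> Mor C A B. mle C A B f f) \<and>
    (\<forall>A \<in> Obj C. \<forall>B \<in> Obj C. \<forall>f \<in> Mor C A B. \<forall>g \<in> Mor C A B. \<forall>h \<in> Mor C A B.
      mle C A B f g \<longrightarrow> mle C A B g h \<longrightarrow> mle C A B f h) \<and>
    (\<forall>A \<in> Obj C. \<forall>B \<in> Obj C. \<forall>D \<in> Obj C.
      \<forall>f \<in> Mor C A B. \<forall>f' \<in> Mor C A B. \<forall>g \<in> Mor C B D. \<forall>g' \<in> Mor C B D.
      mle C A B f f' \<longrightarrow> mle C B D g g' \<longrightarrow> mle C A D (mcmp C A B D g f) (mcmp C A B D g' f'))"

definition twofunctor ::
    "('b, 'm) twocat \<Rightarrow> ('c, 'n) twocat \<Rightarrow> ('b \<Rightarrow> 'c) \<Rightarrow> ('b \<Rightarrow> 'b \<Rightarrow> 'm \<Rightarrow> 'n) \<Rightarrow> bool" where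
  "twofunctor C D F0 F1 \<longleftrightarrow>
    (\<forall>A \<in> Obj C. F0 A \<in> Obj D) \<and>
    (\<forall>A \<in> Obj C. \<forall>B \<in> Obj C. \<forall>f \<in> Mor C A B. F1 A B f \<in> Mor D (F0 A) (F0 B)) \<and>
    (\<forall>A \<in> Obj C. F1 A A (mid C A) = mid D (F0 A)) \<and>
    (\<forall>A \<in> Obj C. \<forall>B \<in> Obj C. \<forall>E \<in> Obj C. \<forall>f \<in> Mor C A B. \<forall>g \<in> Mor C B E.
      F1 A E (mcmp C A B E g f) = mcmp D (F0 A) (F0 B) (F0 E) (F1 B E g) (F1 A B f)) \<and>
    (\<forall>A \<in> Obj C. \<forall>B \<in> Obj C. \<forall>f \<in> Mor C A B. \<forall>g \<in> Mor C A B.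
      mle C A B f g \<longrightarrow> mle D (F0 A) (F0 B) (F1 A B f) (F1 A B g))"

definition isomorphic_twocats :: "('b, 'm) twocat \<Rightarrow> ('c, 'n) twocat \<Rightarrow> bool" where
  "isomorphic_twocats C D \<longleftrightarrow>
    twocategory C \<and> twocategory D \<and>
    (\<exists>F0 F1 G0 G1. twofunctor C D F0 F1 \<and> twofunctor D C G0 G1 \<and>
      (\<forall>A \<in> Obj C. G0 (F0 A) = A) \<and>
      (\<forall>B \<in> Obj D. F0 (G0 B) = B) \<and>
      (\<forall>A \<in> Obj C. \<forall>A' \<in> Obj C. \<forall>f \<in> Mor C A A'. G1 (F0 A) (F0 A') (F1 A A' f) = f) \<and>
      (\<forall>B \<in> Obj D. \<forall>B' \<in> Obj D. \<forall>g \<in> Mor D B B'. F1 (G0 B) (G0 B') (G1 B B' g) = g))"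


section \<open>Lax algebras and interior spaces\<close>

text \<open>
  \<open>QAlg\<close> and \<open>QInt\<close> comprise the objects whose underlying category is carried by a subset of \<open>'x\<close>;
  the arbitrary type \<open>'x\<close> plays the role of the universe of sets.
\<close>

type_synonym ('o, 'a, 'x) alg =
  "('o, 'a, 'x) qcat \<times> (('o, 'a, 'x) dpsh \<Rightarrow> ('o, 'a, 'x) psh)"

definition lax_algebra ::
    "('o, 'a) quantaloid \<Rightarrow> ('o, 'a, 'x) law \<Rightarrow> ('o, 'a, 'x) alg \<Rightarrow> bool" where
  "lax_algebra Q lam = (\<lambda>(X, p).
    qcategory Q X \<and>
    p \<in> qfunctors Q (DP Q X) (PSh Q X) \<and>
    fun_le Q X (PSh Q X) (yon X) (compose (carrier X) p (dp_unit Q X)) \<and>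
    fun_le Q (DP Q (DP Q X)) (PSh Q X)
      (compose (carrier (DP Q (DP Q X)))
        (psh_mult Q X)
        (compose (carrier (DP Q (DP Q X)))
          (psh_push Q (DP Q X) (PSh Q X) p)
          (compose (carrier (DP Q (DP Q X)))
            (lam X)
            (dp_map Q (DP Q X) (PSh Q X) p))))
      (compose (carrier (DP Q (DP Q X))) p (dp_mult Q X)))"

definition lax_homs ::
    "('o, 'a) quantaloid \<Rightarrow> ('o, 'a, 'x) alg \<Rightarrow> ('o, 'a, 'x) alg \<Rightarrow> ('x \<Rightarrow> 'x) set" where
  "lax_homs Q = (\<lambda>(X, p) (Y, q).
    {f \<in> qfunctors Q X Y.
      fun_le Q (DP Q X) (PSh Q Y)
        (compose (carrier (DP Q X)) (psh_push Q X Y f) p)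
        (compose (carrier (DP Q X)) q (dp_map Q X Y f))})"

definition QAlg ::
    "('o, 'a) quantaloid \<Rightarrow> ('o, 'a, 'x) law \<Rightarrow> (('o, 'a, 'x) alg, 'x \<Rightarrow> 'x) twocat" where
  "QAlg Q lam =
    \<lparr>Obj = {A. lax_algebra Q lam A},
     Mor = lax_homs Q,
     mle = (\<lambda>A B. fun_le Q (fst A) (fst B)),
     mcmp = (\<lambda>A B D g f. compose (carrier (fst A)) g f),
     mid = (\<lambda>A. \<lambda>x \<in> carrier (fst A). x)\<rparr>"

type_synonym ('o, 'a, 'x) intsp =
  "('o, 'a, 'x) qcat \<times> (('o, 'a, 'x) copsh \<Rightarrow> ('o, 'a, 'x) copsh)"

definition closure_operation ::
    "('o, 'a) quantaloid \<Rightarrow> ('o, 'a, 'x) qcat \<Rightarrow> ('x \<Rightarrow> 'x) \<Rightarrow> bool" where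
  "closure_operation Q X c \<longleftrightarrow>
    c \<in> qfunctors Q X X \<and>
    fun_le Q X X (\<lambda>x \<in> carrier X. x) c \<and>
    compose (carrier X) c c = c"

definition interior_space :: "('o, 'a) quantaloid \<Rightarrow> ('o, 'a, 'x) intsp \<Rightarrow> bool" where
  "interior_space Q = (\<lambda>(X, c). qcategory Q X \<and> closure_operation Q (CoPSh Q X) c)"

definition continuous_qfunctors ::
    "('o, 'a) quantaloid \<Rightarrow> ('o, 'a, 'x) intsp \<Rightarrow> ('o, 'a, 'x) intsp \<Rightarrow> ('x \<Rightarrow> 'x) set" where
  "continuous_qfunctors Q = (\<lambda>(X, c) (Y, d).
    {f \<in> qfunctors Q X Y.
      fun_le Q (CoPSh Q Y) (CoPSh Q X)
        (compose (carrier (CoPSh Q Y)) c (copsh_pull Q X Y f))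
        (compose (carrier (CoPSh Q Y)) (copsh_pull Q X Y f) d)})"

definition QInt :: "('o, 'a) quantaloid \<Rightarrow> (('o, 'a, 'x) intsp, 'x \<Rightarrow> 'x) twocat" where
  "QInt Q =
    \<lparr>Obj = {A. interior_space Q A},
     Mor = continuous_qfunctors Q,
     mle = (\<lambda>A B. fun_le Q (fst A) (fst B)),
     mcmp = (\<lambda>A B D g f. compose (carrier (fst A)) g f),
     mid = (\<lambda>A. \<lambda>x \<in> carrier (fst A). x)\<rparr>"

end

theory Submission
  imports Defs
begin

text \<open>
  Write \<open>T\<close> for the double presheaf 2-monad, with unit \<open>e\<close> and multiplication \<open>m\<close>, write \<open>y\<close> for the
  Yoneda embeddings and \<open>M\<^sub>X\<close> for \<open>((y\<^sub>X)\<^sub>\<exclamdown>)\<^sup>!\<close>.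

  The functor \<open>M\<^sub>X\<close> is right adjoint to \<open>T y\<^sub>X\<close>, and \<open>M\<^sub>X \<cdot> T y\<^sub>X = 1\<close> because \<open>y\<^sub>X\<close> is fully faithful.
  The adjunction turns the distributor that defines \<open>\<Lambda>\<^sub>X\<close> into the representable form
  \<open>\<Lambda>\<^sub>X = y \<cdot> M\<^sub>X\<close>. Since images and the multiplication of the presheaf monad act on representable
  presheaves by evaluation, every axiom of a distributive law becomes an inequality between
  composites of \<open>M\<close>, \<open>T f\<close>, \<open>e\<close> and \<open>m\<close>, and these follow by transposition along \<open>T y\<close> and \<open>M\<close>
  from the naturality of \<open>y\<close>, \<open>e\<close> and \<open>m\<close> and from the unit law of the presheaf monad. Flatness is
  \<open>M\<^sub>X \<cdot> T y\<^sub>X = 1\<close>.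

  For the isomorphism, the guide is the case of the two-element quantale: an interior operation on
  the up-sets of a preordered set. There the structure map of the corresponding lax algebra sends a
  family \<open>\<sigma>\<close> of up-sets to the set of its limits, the points all of whose neighbourhoods belong to
  \<open>\<sigma>\<close>. So it should have the form \<open>p \<sigma> = 1(\<nu> -, \<sigma>)\<close>, where \<open>\<nu> : X \<rightarrow> T X\<close> assigns to a point its
  neighbourhoods, and \<open>\<nu>\<close> is the transpose of the interior operation \<open>c\<close>: the value of \<open>\<nu> x\<close> at \<open>U\<close>
  is that of \<open>c U\<close> at \<open>x\<close>. This picture is right over every quantaloid, for three reasons.

  First, every lax algebra is a nerve \<open>1(\<nu> -, \<sigma>)\<close>. Let \<open>\<nu> x\<close> be the infimum of all \<open>\<sigma>\<close>, weighted by
  the degree \<open>(p \<sigma>)(x)\<close> to which they converge to \<open>x\<close>. Then \<open>p \<sigma> \<le> 1(\<nu> -, \<sigma>)\<close> for formal reasons,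
  and the converse amounts to the convergence of \<open>\<nu> x\<close> to \<open>x\<close>. This follows from the associativity
  axiom at the principal element generated by all \<open>\<sigma>\<close> that converge to \<open>x\<close>, together with the unit
  axiom (\<open>yon_below_nbhd\<close>, \<open>lax_algebra_is_nerve\<close>).

  Second, the nerve of \<open>\<nu>\<close> is a lax algebra iff \<open>\<nu> \<le> e\<close> and \<open>\<nu> \<le> m \<cdot> T \<nu> \<cdot> \<nu>\<close>
  (\<open>lax_algebra_nerve_iff\<close>). Under transposition these inequalities become \<open>1 \<le> c\<close> and \<open>c \<cdot> c \<le> c\<close>
  (\<open>closure_operation_iff\<close>).

  Third, a functor \<open>f\<close> is a lax homomorphism from the nerve of \<open>\<nu>\<close> to that of \<open>\<mu>\<close> iff
  \<open>\<mu> \<cdot> f \<le> T f \<cdot> \<nu>\<close>, which is continuity in transposed form (\<open>lax_hom_iff_continuous\<close>). The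
  isomorphism is therefore the identity on morphisms.
\<close>

section \<open>Calculus in the hom-lattices\<close>

context quantaloid
begin

abbreviation "hom r s \<equiv> carrier (Hom Q r s)"

text \<open>
  Bundling the typing of both arrows into the order makes transitivity and monotonicity of
  composition unconditional, so that inequalities can be chained without side conditions.
\<close>

definition leq :: "'a \<Rightarrow> 'o \<Rightarrow> 'o \<Rightarrow> 'a \<Rightarrow> bool"
    (\<open>(_/ \<preceq>[_,_]/ _)\<close> [51, 0, 0, 51] 50) where
  "u \<preceq>[r,s] v \<longleftrightarrow> r \<in> Ob Q \<and> s \<in> Ob Q \<and> u \<in> hom r s \<and> v \<in> hom r s \<and> u \<sqsubseteq>\<^bsub>Hom Q r s\<^esub> v"

lemma leqD: "u \<preceq>[r,s] v \<Longrightarrow> u \<sqsubseteq>\<^bsub>Hom Q r s\<^esub> v"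
  by (simp add: leq_def)

lemma leqI:
  "\<lbrakk>r \<in> Ob Q; s \<in> Ob Q; u \<in> hom r s; v \<in> hom r s; u \<sqsubseteq>\<^bsub>Hom Q r s\<^esub> v\<rbrakk> \<Longrightarrow> u \<preceq>[r,s] v"
  by (simp add: leq_def)

lemma leq_carriers:
  assumes "u \<preceq>[r,s] v"
  shows "r \<in> Ob Q" "s \<in> Ob Q" "u \<in> hom r s" "v \<in> hom r s"
  using assms by (auto simp: leq_def)

lemma leq_refl:
  assumes "r \<in> Ob Q" "s \<in> Ob Q" "u \<in> hom r s"
  shows "u \<preceq>[r,s] u"
proof -
  interpret L: complete_lattice "Hom Q r s" using assms hom_complete_lattice by blast
  show ?thesis using assms by (simp add: leq_def)
qed

lemma leq_trans [trans]:
  assumes "u \<preceq>[r,s] v" "v \<preceq>[r,s] w"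
  shows "u \<preceq>[r,s] w"
proof -
  interpret L: complete_lattice "Hom Q r s" using assms hom_complete_lattice by (auto simp: leq_def)
  show ?thesis using assms L.le_trans by (auto simp: leq_def)
qed

text \<open>
  The general substitution rules would resolve mixed calculations by higher-order unification on
  large terms; these instances, and those for the preorder of a category, match directly.
\<close>

lemma eq_leq_trans [trans]: "\<lbrakk>u = v; v \<preceq>[r,s] w\<rbrakk> \<Longrightarrow> u \<preceq>[r,s] w"
  by simp

lemma leq_eq_trans [trans]: "\<lbrakk>u \<preceq>[r,s] v; v = w\<rbrakk> \<Longrightarrow> u \<preceq>[r,s] w"
  by simp

lemma leq_antisym:
  assumes "u \<preceq>[r,s] v" "v \<preceq>[r,s] u"
  shows "u = v"
proof -
  interpret L: complete_lattice "Hom Q r s" using assms hom_complete_lattice by (auto simp: leq_def)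
  show ?thesis using assms L.le_antisym by (auto simp: leq_def)
qed

lemma eq_by_lower:
  assumes "r \<in> Ob Q" "s \<in> Ob Q" "u \<in> hom r s" "v \<in> hom r s"
    and "\<And>w. w \<in> hom r s \<Longrightarrow> w \<preceq>[r,s] u \<longleftrightarrow> w \<preceq>[r,s] v"
  shows "u = v"
  using assms leq_antisym leq_refl by blast

lemma eq_by_upper:
  assumes "r \<in> Ob Q" "s \<in> Ob Q" "u \<in> hom r s" "v \<in> hom r s"
    and "\<And>w. w \<in> hom r s \<Longrightarrow> u \<preceq>[r,s] w \<longleftrightarrow> v \<preceq>[r,s] w"
  shows "u = v"
  using assms leq_antisym leq_refl by blast

lemma sup_closed:
  assumes "r \<in> Ob Q" "s \<in> Ob Q" "A \<subseteq> hom r s"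
  shows "\<Squnion>\<^bsub>Hom Q r s\<^esub> A \<in> hom r s"
proof -
  interpret L: complete_lattice "Hom Q r s" using assms hom_complete_lattice by blast
  show ?thesis using assms by simp
qed

lemma inf_closed:
  assumes "r \<in> Ob Q" "s \<in> Ob Q" "A \<subseteq> hom r s"
  shows "\<Sqinter>\<^bsub>Hom Q r s\<^esub> A \<in> hom r s"
proof -
  interpret L: complete_lattice "Hom Q r s" using assms hom_complete_lattice by blast
  show ?thesis using assms by simp
qed

lemma sup_leq_iff:
  assumes "r \<in> Ob Q" "s \<in> Ob Q" "A \<subseteq> hom r s" "w \<in> hom r s"
  shows "\<Squnion>\<^bsub>Hom Q r s\<^esub> A \<preceq>[r,s] w \<longleftrightarrow> (\<forall>a \<in> A. a \<preceq>[r,s] w)"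
proof -
  interpret L: complete_lattice "Hom Q r s" using assms hom_complete_lattice by blast
  have "a \<preceq>[r,s] \<Squnion>\<^bsub>Hom Q r s\<^esub> A" if "a \<in> A" for a
    using assms that L.sup_upper by (auto simp: leq_def)
  moreover have "\<Squnion>\<^bsub>Hom Q r s\<^esub> A \<preceq>[r,s] w" if "\<forall>a \<in> A. a \<preceq>[r,s] w"
    using assms that L.sup_least[of A w] by (auto simp: leq_def)
  ultimately show ?thesis using leq_trans by blast
qed

lemma leq_inf_iff:
  assumes "r \<in> Ob Q" "s \<in> Ob Q" "A \<subseteq> hom r s" "w \<in> hom r s"
  shows "w \<preceq>[r,s] \<Sqinter>\<^bsub>Hom Q r s\<^esub> A \<longleftrightarrow> (\<forall>a \<in> A. w \<preceq>[r,s] a)"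
proof -
  interpret L: complete_lattice "Hom Q r s" using assms hom_complete_lattice by blast
  have "\<Sqinter>\<^bsub>Hom Q r s\<^esub> A \<preceq>[r,s] a" if "a \<in> A" for a
    using assms that L.inf_lower by (auto simp: leq_def)
  moreover have "w \<preceq>[r,s] \<Sqinter>\<^bsub>Hom Q r s\<^esub> A" if "\<forall>a \<in> A. w \<preceq>[r,s] a"
    using assms that L.inf_greatest[of A w] by (auto simp: leq_def)
  ultimately show ?thesis using leq_trans by blast
qed

lemma sup_of_chain:
  assumes "u \<preceq>[r,s] v"
  shows "\<Squnion>\<^bsub>Hom Q r s\<^esub> {u, v} = v"
proof (rule eq_by_upper[of r s])
  show "\<Squnion>\<^bsub>Hom Q r s\<^esub> {u, v} \<in> hom r s" using assms by (intro sup_closed) (auto simp: leq_def)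
  fix w assume w: "w \<in> hom r s"
  have "\<Squnion>\<^bsub>Hom Q r s\<^esub> {u, v} \<preceq>[r,s] w \<longleftrightarrow> (\<forall>a \<in> {u, v}. a \<preceq>[r,s] w)"
    by (rule sup_leq_iff) (use w assms in \<open>auto simp: leq_def\<close>)
  then show "\<Squnion>\<^bsub>Hom Q r s\<^esub> {u, v} \<preceq>[r,s] w \<longleftrightarrow> v \<preceq>[r,s] w"
    using leq_trans[OF assms] by auto
qed (use assms in \<open>auto simp: leq_def\<close>)

text \<open>
  Preservation of binary suprema implies monotonicity: if \<open>u \<preceq> u'\<close> then \<open>u'\<close> is the supremum of
  \<open>{u, u'}\<close>, and the image of \<open>u'\<close> is the supremum of the images.
\<close>

lemma cmp_mono:
  assumes u: "u \<preceq>[r,s] u'" and v: "v \<preceq>[s,t] v'"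
  shows "Cmp Q r s t v u \<preceq>[r,t] Cmp Q r s t v' u'"
proof -
  have ob: "r \<in> Ob Q" "s \<in> Ob Q" "t \<in> Ob Q" "u \<in> hom r s" "u' \<in> hom r s" "v \<in> hom s t" "v' \<in> hom s t"
    using u v by (auto simp: leq_def)
  have eq1: "\<Squnion>\<^bsub>Hom Q r t\<^esub> {Cmp Q r s t v u, Cmp Q r s t v u'} = Cmp Q r s t v u'"
    using cmp_sup_right[of r s t "{u, u'}" v, OF ob(1-3) _ ob(6)] ob(4,5)
    by (simp add: sup_of_chain[OF u])
  have eq2: "\<Squnion>\<^bsub>Hom Q r t\<^esub> {Cmp Q r s t v u', Cmp Q r s t v' u'} = Cmp Q r s t v' u'"
    using cmp_sup_left[of r s t u' "{v, v'}", OF ob(1-3,5)] ob(6,7)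
    by (simp add: sup_of_chain[OF v])
  have le: "a \<preceq>[r,t] b" if "\<Squnion>\<^bsub>Hom Q r t\<^esub> {a, b} = b" "a \<in> hom r t" "b \<in> hom r t" for a b
    using sup_leq_iff[of r t "{a, b}" b, OF ob(1,3)] leq_refl[OF ob(1,3) that(3)]
    by (simp add: that)
  have "Cmp Q r s t v u \<preceq>[r,t] Cmp Q r s t v u'"
    by (rule le[OF eq1]) (use ob in \<open>simp_all add: cmp_closed\<close>)
  also have "\<dots> \<preceq>[r,t] Cmp Q r s t v' u'"
    by (rule le[OF eq2]) (use ob in \<open>simp_all add: cmp_closed\<close>)
  finally show ?thesis .
qed

lemma sup_cmp_leq_iff:
  assumes "r \<in> Ob Q" "s \<in> Ob Q" "t \<in> Ob Q" "U \<subseteq> hom r s" "v \<in> hom s t" "w \<in> hom r t"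
  shows "Cmp Q r s t v (\<Squnion>\<^bsub>Hom Q r s\<^esub> U) \<preceq>[r,t] w \<longleftrightarrow> (\<forall>u \<in> U. Cmp Q r s t v u \<preceq>[r,t] w)"
proof -
  have "(\<lambda>u. Cmp Q r s t v u) ` U \<subseteq> hom r t" using assms cmp_closed by auto
  then show ?thesis using assms cmp_sup_right[of r s t U v] by (simp add: sup_leq_iff)
qed

lemma cmp_sup_leq_iff:
  assumes "r \<in> Ob Q" "s \<in> Ob Q" "t \<in> Ob Q" "V \<subseteq> hom s t" "u \<in> hom r s" "w \<in> hom r t"
  shows "Cmp Q r s t (\<Squnion>\<^bsub>Hom Q s t\<^esub> V) u \<preceq>[r,t] w \<longleftrightarrow> (\<forall>v \<in> V. Cmp Q r s t v u \<preceq>[r,t] w)"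
proof -
  have "(\<lambda>v. Cmp Q r s t v u) ` V \<subseteq> hom r t" using assms cmp_closed by auto
  then show ?thesis using assms cmp_sup_left[of r s t u V] by (simp add: sup_leq_iff)
qed

text \<open>
  The supremum of all \<open>u\<close> with \<open>v \<circ> u \<preceq> w\<close> has the property that defines the residual, because
  composition with \<open>v\<close> preserves it; antisymmetry makes it the only such arrow. The same
  holds for the residual on the other side.
\<close>

lemma res_right_props:
  assumes ob: "r \<in> Ob Q" "s \<in> Ob Q" "t \<in> Ob Q" and v: "v \<in> hom s t" and w: "w \<in> hom r t"
  shows "res_right Q r s t v w \<in> hom r s \<and>
    (\<forall>u \<in> hom r s. u \<preceq>[r,s] res_right Q r s t v w \<longleftrightarrow> Cmp Q r s t v u \<preceq>[r,t] w)"
proof -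
  let ?P = "\<lambda>z. z \<in> hom r s \<and> (\<forall>u \<in> hom r s. u \<preceq>[r,s] z \<longleftrightarrow> Cmp Q r s t v u \<preceq>[r,t] w)"
  let ?U = "{u \<in> hom r s. Cmp Q r s t v u \<preceq>[r,t] w}"
  let ?z = "\<Squnion>\<^bsub>Hom Q r s\<^esub> ?U"
  have z: "?z \<in> hom r s" using ob by (intro sup_closed) auto
  have zw: "Cmp Q r s t v ?z \<preceq>[r,t] w" using assms by (subst sup_cmp_leq_iff) auto
  have "Cmp Q r s t v u \<preceq>[r,t] w" if "u \<preceq>[r,s] ?z" for u
    using cmp_mono[OF that leq_refl[OF ob(2,3) v]] zw leq_trans by blast
  moreover have "u \<preceq>[r,s] ?z" if "u \<in> hom r s" "Cmp Q r s t v u \<preceq>[r,t] w" for u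
    using that sup_leq_iff[of r s ?U ?z] ob z leq_refl by auto
  ultimately have P: "?P ?z" using z by blast
  have u: "y = ?z" if "?P y" for y
    using that P ob by (intro eq_by_lower[of r s]) auto
  have eq: "res_right Q r s t v w = (THE z. ?P z)"
    unfolding res_right_def
    by (rule arg_cong[where f = The], rule ext)
       (use ob v w in \<open>auto simp: leq_def cmp_closed\<close>)
  show ?thesis unfolding eq by (rule theI[of ?P, OF P u])
qed

lemma res_left_props:
  assumes ob: "r \<in> Ob Q" "s \<in> Ob Q" "t \<in> Ob Q" and u: "u \<in> hom r s" and w: "w \<in> hom r t"
  shows "res_left Q r s t w u \<in> hom s t \<and>
    (\<forall>v \<in> hom s t. v \<preceq>[s,t] res_left Q r s t w u \<longleftrightarrow> Cmp Q r s t v u \<preceq>[r,t] w)"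
proof -
  let ?P = "\<lambda>z. z \<in> hom s t \<and> (\<forall>v \<in> hom s t. v \<preceq>[s,t] z \<longleftrightarrow> Cmp Q r s t v u \<preceq>[r,t] w)"
  let ?V = "{v \<in> hom s t. Cmp Q r s t v u \<preceq>[r,t] w}"
  let ?z = "\<Squnion>\<^bsub>Hom Q s t\<^esub> ?V"
  have z: "?z \<in> hom s t" using ob by (intro sup_closed) auto
  have zw: "Cmp Q r s t ?z u \<preceq>[r,t] w" using assms by (subst cmp_sup_leq_iff) auto
  have "Cmp Q r s t v u \<preceq>[r,t] w" if "v \<preceq>[s,t] ?z" for v
    using cmp_mono[OF leq_refl[OF ob(1,2) u] that] zw leq_trans by blast
  moreover have "v \<preceq>[s,t] ?z" if "v \<in> hom s t" "Cmp Q r s t v u \<preceq>[r,t] w" for v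
    using that sup_leq_iff[of s t ?V ?z] ob z leq_refl by auto
  ultimately have P: "?P ?z" using z by blast
  have u: "y = ?z" if "?P y" for y
    using that P ob by (intro eq_by_lower[of s t]) auto
  have eq: "res_left Q r s t w u = (THE z. ?P z)"
    unfolding res_left_def
    by (rule arg_cong[where f = The], rule ext)
       (use ob assms(4) w in \<open>auto simp: leq_def cmp_closed\<close>)
  show ?thesis unfolding eq by (rule theI[of ?P, OF P u])
qed

lemmas res_right_closed = res_right_props[THEN conjunct1]
lemmas leq_res_right_iff = res_right_props[THEN conjunct2, rule_format]
lemmas res_left_closed = res_left_props[THEN conjunct1]
lemmas leq_res_left_iff = res_left_props[THEN conjunct2, rule_format]

lemma idn_cmp_mono_left:
  assumes "Idn Q s \<preceq>[s,s] v" "u \<in> hom r s" "r \<in> Ob Q"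
  shows "u \<preceq>[r,s] Cmp Q r s s v u"
  using cmp_mono[OF leq_refl[of r s u] assms(1)] assms by (auto simp: cmp_idn_left dest: leq_carriers)

lemma idn_cmp_mono_right:
  assumes "Idn Q r \<preceq>[r,r] u" "v \<in> hom r s" "s \<in> Ob Q"
  shows "v \<preceq>[r,s] Cmp Q r r s v u"
  using cmp_mono[OF assms(1) leq_refl[of r s v]] assms by (auto simp: cmp_idn_right dest: leq_carriers)

section \<open>Categories, functors and adjunctions\<close>

lemma qrel_comp_closed:
  assumes "x \<in> carrier X" "z \<in> carrier Z" "ty X x \<in> Ob Q" "ty Z z \<in> Ob Q"
    and "\<And>y. y \<in> carrier Y \<Longrightarrow> ty Y y \<in> Ob Q"
    and "\<And>y. y \<in> carrier Y \<Longrightarrow> \<phi> x y \<in> hom (ty X x) (ty Y y)"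
    and "\<And>y. y \<in> carrier Y \<Longrightarrow> \<psi> y z \<in> hom (ty Y y) (ty Z z)"
  shows "qrel_comp Q X Y Z \<psi> \<phi> x z \<in> hom (ty X x) (ty Z z)"
  using assms by (auto simp: qrel_comp_def intro!: sup_closed cmp_closed)

lemma qrel_comp_leq_iff:
  assumes "x \<in> carrier X" "z \<in> carrier Z" "ty X x \<in> Ob Q" "ty Z z \<in> Ob Q"
    and "\<And>y. y \<in> carrier Y \<Longrightarrow> ty Y y \<in> Ob Q"
    and "\<And>y. y \<in> carrier Y \<Longrightarrow> \<phi> x y \<in> hom (ty X x) (ty Y y)"
    and "\<And>y. y \<in> carrier Y \<Longrightarrow> \<psi> y z \<in> hom (ty Y y) (ty Z z)"
    and "w \<in> hom (ty X x) (ty Z z)"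
  shows "qrel_comp Q X Y Z \<psi> \<phi> x z \<preceq>[ty X x, ty Z z] w \<longleftrightarrow>
    (\<forall>y \<in> carrier Y. Cmp Q (ty X x) (ty Y y) (ty Z z) (\<psi> y z) (\<phi> x y) \<preceq>[ty X x, ty Z z] w)"
proof -
  have "(\<lambda>y. Cmp Q (ty X x) (ty Y y) (ty Z z) (\<psi> y z) (\<phi> x y)) ` carrier Y \<subseteq> hom (ty X x) (ty Z z)"
    using assms by (auto intro!: cmp_closed)
  then show ?thesis using assms by (simp add: qrel_comp_def sup_leq_iff)
qed


lemma qcategoryI:
  assumes t: "ty X \<in> carrier X \<rightarrow>\<^sub>E Ob Q"
    and e: "hm X \<in> extensional (carrier X)"
    and e': "\<And>x. x \<in> carrier X \<Longrightarrow> hm X x \<in> extensional (carrier X)"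
    and h: "\<And>x y. \<lbrakk>x \<in> carrier X; y \<in> carrier X\<rbrakk> \<Longrightarrow> hm X x y \<in> hom (ty X x) (ty X y)"
    and r: "\<And>x. x \<in> carrier X \<Longrightarrow> Idn Q (ty X x) \<preceq>[ty X x, ty X x] hm X x x"
    and c: "\<And>x y z. \<lbrakk>x \<in> carrier X; y \<in> carrier X; z \<in> carrier X\<rbrakk> \<Longrightarrow>
      Cmp Q (ty X x) (ty X y) (ty X z) (hm X y z) (hm X x y) \<preceq>[ty X x, ty X z] hm X x z"
  shows "qcategory Q X"
proof -
  have tt: "ty X x \<in> Ob Q" if "x \<in> carrier X" for x using t that by auto
  have "qrel_comp Q X X X (hm X) (hm X) x z \<preceq>[ty X x, ty X z] hm X x z"
    if "x \<in> carrier X" "z \<in> carrier X" for x z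
    using that by (subst qrel_comp_leq_iff) (use c[OF that(1) _ that(2)] in \<open>simp_all add: tt h\<close>)
  then have "qrel_le Q X X (qrel_comp Q X X X (hm X) (hm X)) (hm X)"
    unfolding qrel_le_def using leqD by (intro ballI) metis
  moreover have "hm X \<in> qrel Q X X"
    unfolding qrel_def PiE_iff by (intro conjI ballI e e' h)
  ultimately show ?thesis
    unfolding qcategory_def by (intro conjI ballI t leqD[OF r])
qed

lemma ty_closed [simp]: "\<lbrakk>qcategory Q X; x \<in> carrier X\<rbrakk> \<Longrightarrow> ty X x \<in> Ob Q"
  by (auto simp: qcategory_def)

lemma hm_closed [simp]:
  "\<lbrakk>qcategory Q X; x \<in> carrier X; y \<in> carrier X\<rbrakk> \<Longrightarrow> hm X x y \<in> hom (ty X x) (ty X y)"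
  by (auto simp: qcategory_def qrel_def PiE_iff)

lemma hm_refl:
  "\<lbrakk>qcategory Q X; x \<in> carrier X\<rbrakk> \<Longrightarrow> Idn Q (ty X x) \<preceq>[ty X x, ty X x] hm X x x"
  by (rule leqI) (simp_all add: idn_closed, simp add: qcategory_def)

lemma hm_trans:
  assumes "qcategory Q X" "x \<in> carrier X" "y \<in> carrier X" "z \<in> carrier X"
  shows "Cmp Q (ty X x) (ty X y) (ty X z) (hm X y z) (hm X x y) \<preceq>[ty X x, ty X z] hm X x z"
proof -
  have "qrel_comp Q X X X (hm X) (hm X) x z \<preceq>[ty X x, ty X z] hm X x z"
  proof (rule leqI)
    show "qrel_comp Q X X X (hm X) (hm X) x z \<sqsubseteq>\<^bsub>Hom Q (ty X x) (ty X z)\<^esub> hm X x z"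
      using assms unfolding qcategory_def qrel_le_def by blast
  qed (use assms in \<open>simp_all add: qrel_comp_closed\<close>)
  then show ?thesis using assms by (subst (asm) qrel_comp_leq_iff) simp_all
qed

text \<open>
  As for the arrows of the quantaloid, the underlying preorder of a category is bundled with the
  membership of both elements.
\<close>

definition below :: "'x \<Rightarrow> ('o, 'a, 'x) qcat \<Rightarrow> 'x \<Rightarrow> bool"
    (\<open>(_/ \<lesssim>[_]/ _)\<close> [51, 0, 51] 50) where
  "a \<lesssim>[X] b \<longleftrightarrow> qcategory Q X \<and> a \<in> carrier X \<and> b \<in> carrier X \<and> qle Q X a b"

lemma belowI:
  assumes "qcategory Q X" "a \<in> carrier X" "b \<in> carrier X" "ty X a = ty X b"
    and "Idn Q (ty X a) \<preceq>[ty X a, ty X b] hm X a b"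
  shows "a \<lesssim>[X] b"
  using assms by (simp add: below_def qle_def leqD)

lemma belowD:
  assumes "a \<lesssim>[X] b"
  shows "qcategory Q X" "a \<in> carrier X" "b \<in> carrier X" "ty X a = ty X b"
    and "Idn Q (ty X a) \<preceq>[ty X a, ty X a] hm X a b"
proof -
  show "Idn Q (ty X a) \<preceq>[ty X a, ty X a] hm X a b"
    using assms hm_closed[of X a b] ty_closed[of X a]
    by (intro leqI) (auto simp: below_def qle_def idn_closed)
qed (use assms in \<open>auto simp: below_def qle_def\<close>)

lemma below_refl: "\<lbrakk>qcategory Q X; a \<in> carrier X\<rbrakk> \<Longrightarrow> a \<lesssim>[X] a"
  by (simp add: belowI hm_refl)

lemma below_hm_right:
  assumes ab: "a \<lesssim>[X] b" and z: "z \<in> carrier X"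
  shows "hm X z a \<preceq>[ty X z, ty X a] hm X z b"
proof -
  note d = belowD[OF ab]
  have "hm X z a \<preceq>[ty X z, ty X a] Cmp Q (ty X z) (ty X a) (ty X a) (hm X a b) (hm X z a)"
    using d z hm_closed[of X z a] by (intro idn_cmp_mono_left) auto
  also have "\<dots> \<preceq>[ty X z, ty X a] hm X z b" using hm_trans[of X z a b] d z by simp
  finally show ?thesis .
qed

lemma below_hm_left:
  assumes ab: "a \<lesssim>[X] b" and z: "z \<in> carrier X"
  shows "hm X b z \<preceq>[ty X b, ty X z] hm X a z"
proof -
  note d = belowD[OF ab]
  have "hm X b z \<preceq>[ty X b, ty X z] Cmp Q (ty X a) (ty X b) (ty X z) (hm X b z) (hm X a b)"
    using d z idn_cmp_mono_right[of "ty X a" "hm X a b" "hm X b z" "ty X z"] hm_closed[of X b z] by auto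
  also have "\<dots> \<preceq>[ty X b, ty X z] hm X a z" using hm_trans[of X a b z] d z by simp
  finally show ?thesis .
qed

lemma below_trans [trans]: "\<lbrakk>a \<lesssim>[X] b; b \<lesssim>[X] c\<rbrakk> \<Longrightarrow> a \<lesssim>[X] c"
  using below_hm_right[of b X c a] belowD[of a X b] belowD[of b X c] leq_trans[of "Idn Q (ty X a)"]
  by (intro belowI) auto

lemma eq_below_trans [trans]: "\<lbrakk>a = b; b \<lesssim>[X] c\<rbrakk> \<Longrightarrow> a \<lesssim>[X] c"
  by simp

lemma below_eq_trans [trans]: "\<lbrakk>a \<lesssim>[X] b; b = c\<rbrakk> \<Longrightarrow> a \<lesssim>[X] c"
  by simp

lemma fun_le_iff:
  assumes "qcategory Q Y"
    and "\<And>x. x \<in> carrier X \<Longrightarrow> f x \<in> carrier Y" "\<And>x. x \<in> carrier X \<Longrightarrow> g x \<in> carrier Y"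
  shows "fun_le Q X Y f g \<longleftrightarrow> (\<forall>x \<in> carrier X. f x \<lesssim>[Y] g x)"
  using assms by (auto simp: fun_le_def below_def)


lemma fun_leI:
  assumes "\<And>x. x \<in> carrier X \<Longrightarrow> f x \<lesssim>[Y] g x"
  shows "fun_le Q X Y f g"
  using assms by (simp add: fun_le_def below_def)

lemma fun_leD:
  assumes "fun_le Q X Y f g" "qcategory Q Y" "x \<in> carrier X" "f x \<in> carrier Y" "g x \<in> carrier Y"
  shows "f x \<lesssim>[Y] g x"
  using assms by (simp add: fun_le_def below_def)

lemma qfunctorI:
  assumes "f \<in> carrier X \<rightarrow>\<^sub>E carrier Y"
    and "\<And>x. x \<in> carrier X \<Longrightarrow> ty Y (f x) = ty X x"
    and "\<And>x x'. \<lbrakk>x \<in> carrier X; x' \<in> carrier X\<rbrakk> \<Longrightarrow>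
      hm X x x' \<preceq>[ty X x, ty X x'] hm Y (f x) (f x')"
  shows "f \<in> qfunctors Q X Y"
  using assms by (auto simp: qfunctors_def leqD)

lemma functor_closed [simp]: "\<lbrakk>f \<in> qfunctors Q X Y; x \<in> carrier X\<rbrakk> \<Longrightarrow> f x \<in> carrier Y"
  by (auto simp: qfunctors_def)

lemma functor_ty [simp]: "\<lbrakk>f \<in> qfunctors Q X Y; x \<in> carrier X\<rbrakk> \<Longrightarrow> ty Y (f x) = ty X x"
  by (auto simp: qfunctors_def)

lemma functor_ext: "f \<in> qfunctors Q X Y \<Longrightarrow> f \<in> extensional (carrier X)"
  unfolding qfunctors_def PiE_def by blast

lemma functor_hm:
  assumes "qcategory Q X" "qcategory Q Y" "f \<in> qfunctors Q X Y" "x \<in> carrier X" "x' \<in> carrier X"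
  shows "hm X x x' \<preceq>[ty X x, ty X x'] hm Y (f x) (f x')"
proof (rule leqI)
  show "hm Y (f x) (f x') \<in> hom (ty X x) (ty X x')"
    using hm_closed[of Y "f x" "f x'"] assms by simp
  show "hm X x x' \<sqsubseteq>\<^bsub>Hom Q (ty X x) (ty X x')\<^esub> hm Y (f x) (f x')"
    using assms unfolding qfunctors_def by blast
qed (use assms in simp_all)

lemma functor_below:
  assumes "qcategory Q Y" "f \<in> qfunctors Q X Y" "a \<lesssim>[X] b"
  shows "f a \<lesssim>[Y] f b"
proof -
  note d = belowD[OF assms(3)]
  have "Idn Q (ty X a) \<preceq>[ty X a, ty X a] hm Y (f a) (f b)"
    using leq_trans[OF d(5)] functor_hm[of X Y f a b] assms d by simp
  then show ?thesis using assms d by (intro belowI) simp_all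
qed

lemma functor_compose:
  assumes "qcategory Q X" "qcategory Q Y" "qcategory Q Z" "f \<in> qfunctors Q X Y" "g \<in> qfunctors Q Y Z"
  shows "compose (carrier X) g f \<in> qfunctors Q X Z"
proof (rule qfunctorI)
  fix x x' assume x: "x \<in> carrier X" "x' \<in> carrier X"
  have "hm X x x' \<preceq>[ty X x, ty X x'] hm Y (f x) (f x')"
    using assms x by (intro functor_hm)
  also have "\<dots> \<preceq>[ty X x, ty X x'] hm Z (g (f x)) (g (f x'))"
    using functor_hm[of Y Z g "f x" "f x'"] assms x by simp
  finally show "hm X x x' \<preceq>[ty X x, ty X x'] hm Z (compose (carrier X) g f x) (compose (carrier X) g f x')"
    using x by (simp add: compose_def)
qed (use assms in \<open>simp_all add: compose_def\<close>)

lemma functor_id: "qcategory Q X \<Longrightarrow> (\<lambda>x \<in> carrier X. x) \<in> qfunctors Q X X"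
  by (rule qfunctorI) (auto intro: leq_refl)

lemma functor_eqI:
  "\<lbrakk>f \<in> qfunctors Q X Y; g \<in> qfunctors Q X Y; \<And>x. x \<in> carrier X \<Longrightarrow> f x = g x\<rbrakk> \<Longrightarrow> f = g"
  by (rule extensionalityI[of _ "carrier X"]) (simp_all add: functor_ext)


definition qadj :: "('o, 'a, 'x) qcat \<Rightarrow> ('o, 'a, 'y) qcat \<Rightarrow> ('x \<Rightarrow> 'y) \<Rightarrow> ('y \<Rightarrow> 'x) \<Rightarrow> bool" where
  "qadj X Y f g \<longleftrightarrow> f \<in> qfunctors Q X Y \<and> g \<in> qfunctors Q Y X \<and>
    (\<forall>x \<in> carrier X. \<forall>y \<in> carrier Y. hm Y (f x) y = hm X x (g y))"

text \<open>
  Functoriality comes from the unit and the counit: an arrow \<open>1(x, x')\<close> lies below \<open>1(x, g (f x'))\<close>,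
  which is \<open>1(f x, f x')\<close>, and dually.
\<close>

lemma qadjI:
  assumes "qcategory Q X" "qcategory Q Y"
    and f: "f \<in> carrier X \<rightarrow>\<^sub>E carrier Y" "\<And>x. x \<in> carrier X \<Longrightarrow> ty Y (f x) = ty X x"
    and g: "g \<in> carrier Y \<rightarrow>\<^sub>E carrier X" "\<And>y. y \<in> carrier Y \<Longrightarrow> ty X (g y) = ty Y y"
    and h: "\<And>x y. \<lbrakk>x \<in> carrier X; y \<in> carrier Y\<rbrakk> \<Longrightarrow> hm Y (f x) y = hm X x (g y)"
  shows "qadj X Y f g"
proof -
  have fc: "x \<in> carrier X \<Longrightarrow> f x \<in> carrier Y" and gc: "y \<in> carrier Y \<Longrightarrow> g y \<in> carrier X" for x y
    using f g by auto
  have unit: "x \<lesssim>[X] g (f x)" if "x \<in> carrier X" for x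
    using hm_refl[of Y "f x"] h[of x "f x"] fc gc that assms by (intro belowI) auto
  have counit: "f (g y) \<lesssim>[Y] y" if "y \<in> carrier Y" for y
    using hm_refl[of X "g y"] h[of "g y" y] fc gc that assms by (intro belowI) auto
  have "f \<in> qfunctors Q X Y"
  proof (rule qfunctorI)
    fix x x' assume x: "x \<in> carrier X" "x' \<in> carrier X"
    show "hm X x x' \<preceq>[ty X x, ty X x'] hm Y (f x) (f x')"
      using below_hm_right[OF unit[OF x(2)] x(1)] h[of x "f x'"] fc x by simp
  qed (use f in auto)
  moreover have "g \<in> qfunctors Q Y X"
  proof (rule qfunctorI)
    fix y y' assume y: "y \<in> carrier Y" "y' \<in> carrier Y"
    show "hm Y y y' \<preceq>[ty Y y, ty Y y'] hm X (g y) (g y')"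
      using below_hm_left[OF counit[OF y(1)] y(2)] h[of "g y" y'] gc y by simp
  qed (use g in auto)
  ultimately show ?thesis using h by (simp add: qadj_def)
qed

lemma qadjD:
  assumes "qadj X Y f g"
  shows "f \<in> qfunctors Q X Y" "g \<in> qfunctors Q Y X"
    and "\<And>x y. \<lbrakk>x \<in> carrier X; y \<in> carrier Y\<rbrakk> \<Longrightarrow> hm Y (f x) y = hm X x (g y)"
  using assms by (auto simp: qadj_def)

lemma qadj_below_iff:
  assumes "qcategory Q X" "qcategory Q Y" "qadj X Y f g" "x \<in> carrier X" "y \<in> carrier Y"
  shows "f x \<lesssim>[Y] y \<longleftrightarrow> x \<lesssim>[X] g y"
  using assms qadjD[OF assms(3)] by (simp add: below_def qle_def)

lemma qadj_unit:
  assumes "qcategory Q X" "qcategory Q Y" "qadj X Y f g" "x \<in> carrier X"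
  shows "x \<lesssim>[X] g (f x)"
  using assms qadjD[OF assms(3)] below_refl[of Y "f x"]
  by (subst qadj_below_iff[symmetric]) auto

lemma qadj_counit:
  assumes "qcategory Q X" "qcategory Q Y" "qadj X Y f g" "y \<in> carrier Y"
  shows "f (g y) \<lesssim>[Y] y"
  using assms qadjD[OF assms(3)] below_refl[of X "g y"]
  by (subst qadj_below_iff) auto


section \<open>Presheaves, pointwise\<close>

abbreviation val :: "('o, 'a, 'x) psh \<Rightarrow> 'x \<Rightarrow> 'a" where "val \<sigma> x \<equiv> snd \<sigma> x ()"
abbreviation coval :: "('o, 'a, 'x) copsh \<Rightarrow> 'x \<Rightarrow> 'a" where "coval \<tau> x \<equiv> snd \<tau> () x"

lemma point_sel [simp]:
  "carrier (point Q s) = {()}" "ty (point Q s) i = s" "hm (point Q s) i j = Idn Q s"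
  by (simp_all add: point_def)

text \<open>
  A distributor into a point only has to absorb the hom of its domain, because the hom of the point
  is an identity arrow. Dually for copresheaves.
\<close>

lemma presheaf_iff:
  assumes X: "qcategory Q X" and s: "s \<in> Ob Q"
  shows "\<phi> \<in> distributors Q X (point Q s) \<longleftrightarrow>
    \<phi> \<in> extensional (carrier X) \<and> (\<forall>x \<in> carrier X. \<phi> x () \<in> hom (ty X x) s) \<and>
    (\<forall>x \<in> carrier X. \<forall>x' \<in> carrier X.
      Cmp Q (ty X x') (ty X x) s (\<phi> x ()) (hm X x' x) \<preceq>[ty X x', s] \<phi> x' ())" (is "?L \<longleftrightarrow> ?R")
proof -
  have q: "\<phi> \<in> qrel Q X (point Q s) \<longleftrightarrow>
      \<phi> \<in> extensional (carrier X) \<and> (\<forall>x \<in> carrier X. \<phi> x () \<in> hom (ty X x) s)"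
    by (auto simp: qrel_def PiE_iff extensional_def)
  let ?c = "qrel_comp Q X X (point Q s) \<phi> (hm X)"
  let ?d = "qrel_comp Q X (point Q s) (point Q s) (hm (point Q s)) ?c"
  have "qrel_le Q X (point Q s) ?d \<phi> \<longleftrightarrow>
    (\<forall>x \<in> carrier X. \<forall>x' \<in> carrier X.
      Cmp Q (ty X x') (ty X x) s (\<phi> x ()) (hm X x' x) \<preceq>[ty X x', s] \<phi> x' ())"
    if \<phi>: "\<forall>x \<in> carrier X. \<phi> x () \<in> hom (ty X x) s"
  proof -
    have c: "?c x () \<in> hom (ty X x) s" if "x \<in> carrier X" for x
      using qrel_comp_closed[of x X "()" "point Q s" X "hm X" \<phi>] that X s \<phi> by auto
    have d: "?d x () \<in> hom (ty X x) s" if "x \<in> carrier X" for x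
      using qrel_comp_closed[of x X "()" "point Q s" "point Q s" ?c "hm (point Q s)"] that X s c
      by (auto simp: idn_closed)
    have "?d x () \<sqsubseteq>\<^bsub>Hom Q (ty X x) s\<^esub> \<phi> x () \<longleftrightarrow> (\<forall>x' \<in> carrier X.
        Cmp Q (ty X x) (ty X x') s (\<phi> x' ()) (hm X x x') \<preceq>[ty X x, s] \<phi> x ())"
      if x: "x \<in> carrier X" for x
    proof -
      have "?d x () \<sqsubseteq>\<^bsub>Hom Q (ty X x) s\<^esub> \<phi> x () \<longleftrightarrow> ?d x () \<preceq>[ty X x, s] \<phi> x ()"
        using d[OF x] x X s \<phi> by (auto simp: leq_def)
      also have "\<dots> \<longleftrightarrow> ?c x () \<preceq>[ty X x, s] \<phi> x ()"
        using qrel_comp_leq_iff[of x X "()" "point Q s" "point Q s" ?c "hm (point Q s)" "\<phi> x ()"]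
          c[OF x] x X s \<phi> by (simp add: idn_closed cmp_idn_left)
      also have "\<dots> \<longleftrightarrow> (\<forall>x' \<in> carrier X.
        Cmp Q (ty X x) (ty X x') s (\<phi> x' ()) (hm X x x') \<preceq>[ty X x, s] \<phi> x ())"
        using qrel_comp_leq_iff[of x X "()" "point Q s" X "hm X" \<phi> "\<phi> x ()"] x X s \<phi> by simp
      finally show ?thesis .
    qed
    then show ?thesis by (auto simp: qrel_le_def)
  qed
  then show ?thesis by (auto simp: distributors_def q)
qed

lemma copresheaf_iff:
  assumes X: "qcategory Q X" and s: "s \<in> Ob Q"
  shows "\<phi> \<in> distributors Q (point Q s) X \<longleftrightarrow>
    \<phi> () \<in> extensional (carrier X) \<and> (\<forall>x \<in> carrier X. \<phi> () x \<in> hom s (ty X x)) \<and>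
    (\<forall>x \<in> carrier X. \<forall>x' \<in> carrier X.
      Cmp Q s (ty X x) (ty X x') (hm X x x') (\<phi> () x) \<preceq>[s, ty X x'] \<phi> () x')" (is "?L \<longleftrightarrow> ?R")
proof -
  have q: "\<phi> \<in> qrel Q (point Q s) X \<longleftrightarrow>
      \<phi> () \<in> extensional (carrier X) \<and> (\<forall>x \<in> carrier X. \<phi> () x \<in> hom s (ty X x))"
    by (auto simp: qrel_def PiE_iff extensional_def)
  let ?p = "point Q s"
  let ?c = "qrel_comp Q ?p ?p X \<phi> (hm ?p)"
  let ?d = "qrel_comp Q ?p X X (hm X) ?c"
  have "qrel_le Q ?p X ?d \<phi> \<longleftrightarrow>
    (\<forall>x \<in> carrier X. \<forall>x' \<in> carrier X.
      Cmp Q s (ty X x) (ty X x') (hm X x x') (\<phi> () x) \<preceq>[s, ty X x'] \<phi> () x')"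
    if \<phi>: "\<forall>x \<in> carrier X. \<phi> () x \<in> hom s (ty X x)"
  proof -
    have c: "?c () x = \<phi> () x" if "x \<in> carrier X" for x
    proof (rule eq_by_upper[of s "ty X x"])
      show "?c () x \<in> hom s (ty X x)"
        using qrel_comp_closed[of "()" ?p x X ?p "hm ?p" \<phi>] that X s \<phi> by (auto simp: idn_closed)
      fix w assume "w \<in> hom s (ty X x)"
      then show "?c () x \<preceq>[s,ty X x] w \<longleftrightarrow> \<phi> () x \<preceq>[s,ty X x] w"
        using qrel_comp_leq_iff[of "()" ?p x X ?p "hm ?p" \<phi> w] that X s \<phi>
        by (simp add: idn_closed cmp_idn_right)
    qed (use that X s \<phi> in auto)
    have d: "?d () x \<in> hom s (ty X x)" if "x \<in> carrier X" for x
      using qrel_comp_closed[of "()" ?p x X X ?c "hm X"] that X s c \<phi> by auto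
    have "?d () x \<sqsubseteq>\<^bsub>Hom Q s (ty X x)\<^esub> \<phi> () x \<longleftrightarrow> (\<forall>x' \<in> carrier X.
        Cmp Q s (ty X x') (ty X x) (hm X x' x) (\<phi> () x') \<preceq>[s, ty X x] \<phi> () x)"
      if x: "x \<in> carrier X" for x
    proof -
      have "?d () x \<sqsubseteq>\<^bsub>Hom Q s (ty X x)\<^esub> \<phi> () x \<longleftrightarrow> ?d () x \<preceq>[s, ty X x] \<phi> () x"
        using d[OF x] x X s \<phi> by (auto simp: leq_def)
      also have "\<dots> \<longleftrightarrow> (\<forall>x' \<in> carrier X.
        Cmp Q s (ty X x') (ty X x) (hm X x' x) (\<phi> () x') \<preceq>[s, ty X x] \<phi> () x)"
        using qrel_comp_leq_iff[of "()" ?p x X X ?c "hm X" "\<phi> () x"] c x X s \<phi> by simp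
      finally show ?thesis .
    qed
    then show ?thesis by (auto simp: qrel_le_def)
  qed
  then show ?thesis by (auto simp: distributors_def q)
qed

lemma psh_carrier_iff:
  assumes "qcategory Q X"
  shows "\<sigma> \<in> carrier (PSh Q X) \<longleftrightarrow> fst \<sigma> \<in> Ob Q \<and>
    snd \<sigma> \<in> extensional (carrier X) \<and> (\<forall>x \<in> carrier X. val \<sigma> x \<in> hom (ty X x) (fst \<sigma>)) \<and>
    (\<forall>x \<in> carrier X. \<forall>x' \<in> carrier X.
      Cmp Q (ty X x') (ty X x) (fst \<sigma>) (val \<sigma> x) (hm X x' x) \<preceq>[ty X x', fst \<sigma>] val \<sigma> x')"
  using assms by (cases \<sigma>) (auto simp: PSh_def Let_def presheaf_iff)

lemma copsh_carrier_iff: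
  assumes "qcategory Q X"
  shows "\<tau> \<in> carrier (CoPSh Q X) \<longleftrightarrow> fst \<tau> \<in> Ob Q \<and>
    snd \<tau> () \<in> extensional (carrier X) \<and> (\<forall>x \<in> carrier X. coval \<tau> x \<in> hom (fst \<tau>) (ty X x)) \<and>
    (\<forall>x \<in> carrier X. \<forall>x' \<in> carrier X.
      Cmp Q (fst \<tau>) (ty X x) (ty X x') (hm X x x') (coval \<tau> x) \<preceq>[fst \<tau>, ty X x'] coval \<tau> x')"
  using assms by (cases \<tau>) (auto simp: CoPSh_def Let_def copresheaf_iff)

lemma psh_ty [simp]: "\<sigma> \<in> carrier (PSh Q X) \<Longrightarrow> ty (PSh Q X) \<sigma> = fst \<sigma>"
  by (simp add: PSh_def Let_def)

lemma copsh_ty [simp]: "\<tau> \<in> carrier (CoPSh Q X) \<Longrightarrow> ty (CoPSh Q X) \<tau> = fst \<tau>"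
  by (simp add: CoPSh_def Let_def)

lemma psh_type [simp]: "\<sigma> \<in> carrier (PSh Q X) \<Longrightarrow> fst \<sigma> \<in> Ob Q"
  by (auto simp: PSh_def Let_def)

lemma copsh_type [simp]: "\<tau> \<in> carrier (CoPSh Q X) \<Longrightarrow> fst \<tau> \<in> Ob Q"
  by (auto simp: CoPSh_def Let_def)

lemma val_closed [simp]:
  "\<lbrakk>qcategory Q X; \<sigma> \<in> carrier (PSh Q X); x \<in> carrier X\<rbrakk> \<Longrightarrow> val \<sigma> x \<in> hom (ty X x) (fst \<sigma>)"
  by (simp add: psh_carrier_iff)

lemma coval_closed [simp]:
  "\<lbrakk>qcategory Q X; \<tau> \<in> carrier (CoPSh Q X); x \<in> carrier X\<rbrakk> \<Longrightarrow> coval \<tau> x \<in> hom (fst \<tau>) (ty X x)"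
  by (simp add: copsh_carrier_iff)

lemma val_action:
  "\<lbrakk>qcategory Q X; \<sigma> \<in> carrier (PSh Q X); x \<in> carrier X; x' \<in> carrier X\<rbrakk> \<Longrightarrow>
    Cmp Q (ty X x') (ty X x) (fst \<sigma>) (val \<sigma> x) (hm X x' x) \<preceq>[ty X x', fst \<sigma>] val \<sigma> x'"
  by (simp add: psh_carrier_iff)

lemma coval_action:
  "\<lbrakk>qcategory Q X; \<tau> \<in> carrier (CoPSh Q X); x \<in> carrier X; x' \<in> carrier X\<rbrakk> \<Longrightarrow>
    Cmp Q (fst \<tau>) (ty X x) (ty X x') (hm X x x') (coval \<tau> x) \<preceq>[fst \<tau>, ty X x'] coval \<tau> x'"
  by (simp add: copsh_carrier_iff)

lemma psh_eqI:
  assumes "qcategory Q X" "\<sigma> \<in> carrier (PSh Q X)" "\<sigma>' \<in> carrier (PSh Q X)"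
    and "fst \<sigma> = fst \<sigma>'" "\<And>x. x \<in> carrier X \<Longrightarrow> val \<sigma> x = val \<sigma>' x"
  shows "\<sigma> = \<sigma>'"
proof (rule prod_eqI)
  show "snd \<sigma> = snd \<sigma>'"
    using assms by (intro extensionalityI[of _ "carrier X"] ext) (auto simp: psh_carrier_iff)
qed (use assms in auto)

lemma copsh_eqI:
  assumes "qcategory Q X" "\<tau> \<in> carrier (CoPSh Q X)" "\<tau>' \<in> carrier (CoPSh Q X)"
    and "fst \<tau> = fst \<tau>'" "\<And>x. x \<in> carrier X \<Longrightarrow> coval \<tau> x = coval \<tau>' x"
  shows "\<tau> = \<tau>'"
proof (rule prod_eqI)
  have "snd \<tau> () = snd \<tau>' ()"
    using assms by (intro extensionalityI[of _ "carrier X"]) (auto simp: copsh_carrier_iff)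
  then show "snd \<tau> = snd \<tau>'" by (intro ext) simp
qed (use assms in auto)

lemma psh_hm:
  "\<lbrakk>\<sigma> \<in> carrier (PSh Q X); \<sigma>' \<in> carrier (PSh Q X)\<rbrakk> \<Longrightarrow>
    hm (PSh Q X) \<sigma> \<sigma>' = \<Sqinter>\<^bsub>Hom Q (fst \<sigma>) (fst \<sigma>')\<^esub>
      ((\<lambda>x. res_left Q (ty X x) (fst \<sigma>) (fst \<sigma>') (val \<sigma>' x) (val \<sigma> x)) ` carrier X)"
  by (simp add: PSh_def Let_def)

lemma copsh_hm:
  "\<lbrakk>\<tau> \<in> carrier (CoPSh Q X); \<tau>' \<in> carrier (CoPSh Q X)\<rbrakk> \<Longrightarrow>
    hm (CoPSh Q X) \<tau> \<tau>' = \<Sqinter>\<^bsub>Hom Q (fst \<tau>) (fst \<tau>')\<^esub>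
      ((\<lambda>x. res_right Q (fst \<tau>) (fst \<tau>') (ty X x) (coval \<tau>' x) (coval \<tau> x)) ` carrier X)"
  by (simp add: CoPSh_def Let_def)

lemma psh_hm_closed:
  assumes "qcategory Q X" "\<sigma> \<in> carrier (PSh Q X)" "\<sigma>' \<in> carrier (PSh Q X)"
  shows "hm (PSh Q X) \<sigma> \<sigma>' \<in> hom (fst \<sigma>) (fst \<sigma>')"
  using assms by (auto simp: psh_hm intro!: inf_closed res_left_closed)

lemma copsh_hm_closed:
  assumes "qcategory Q X" "\<tau> \<in> carrier (CoPSh Q X)" "\<tau>' \<in> carrier (CoPSh Q X)"
  shows "hm (CoPSh Q X) \<tau> \<tau>' \<in> hom (fst \<tau>) (fst \<tau>')"
  using assms by (auto simp: copsh_hm intro!: inf_closed res_right_closed)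

text \<open>
  The infimum of residuals is characterised by the arrows below it, and this universal property
  replaces the formula from here on.
\<close>

lemma leq_psh_hm_iff:
  assumes "qcategory Q X" "\<sigma> \<in> carrier (PSh Q X)" "\<sigma>' \<in> carrier (PSh Q X)"
    and "w \<in> hom (fst \<sigma>) (fst \<sigma>')"
  shows "w \<preceq>[fst \<sigma>, fst \<sigma>'] hm (PSh Q X) \<sigma> \<sigma>' \<longleftrightarrow>
    (\<forall>x \<in> carrier X. Cmp Q (ty X x) (fst \<sigma>) (fst \<sigma>') w (val \<sigma> x) \<preceq>[ty X x, fst \<sigma>'] val \<sigma>' x)"
proof -
  have "(\<lambda>x. res_left Q (ty X x) (fst \<sigma>) (fst \<sigma>') (val \<sigma>' x) (val \<sigma> x)) ` carrier X
      \<subseteq> hom (fst \<sigma>) (fst \<sigma>')"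
    using assms by (auto intro!: res_left_closed)
  then show ?thesis using assms by (simp add: psh_hm leq_inf_iff leq_res_left_iff)
qed

lemma leq_copsh_hm_iff:
  assumes "qcategory Q X" "\<tau> \<in> carrier (CoPSh Q X)" "\<tau>' \<in> carrier (CoPSh Q X)"
    and "w \<in> hom (fst \<tau>) (fst \<tau>')"
  shows "w \<preceq>[fst \<tau>, fst \<tau>'] hm (CoPSh Q X) \<tau> \<tau>' \<longleftrightarrow>
    (\<forall>x \<in> carrier X. Cmp Q (fst \<tau>) (fst \<tau>') (ty X x) (coval \<tau>' x) w \<preceq>[fst \<tau>, ty X x] coval \<tau> x)"
proof -
  have "(\<lambda>x. res_right Q (fst \<tau>) (fst \<tau>') (ty X x) (coval \<tau>' x) (coval \<tau> x)) ` carrier X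
      \<subseteq> hom (fst \<tau>) (fst \<tau>')"
    using assms by (auto intro!: res_right_closed)
  then show ?thesis using assms by (simp add: copsh_hm leq_inf_iff leq_res_right_iff)
qed

lemma psh_hm_action:
  assumes "qcategory Q X" "\<sigma> \<in> carrier (PSh Q X)" "\<sigma>' \<in> carrier (PSh Q X)" "x \<in> carrier X"
  shows "Cmp Q (ty X x) (fst \<sigma>) (fst \<sigma>') (hm (PSh Q X) \<sigma> \<sigma>') (val \<sigma> x) \<preceq>[ty X x, fst \<sigma>'] val \<sigma>' x"
  using leq_psh_hm_iff[of X \<sigma> \<sigma>' "hm (PSh Q X) \<sigma> \<sigma>'"] assms psh_hm_closed[of X \<sigma> \<sigma>']
  by (simp add: leq_refl)

lemma copsh_hm_action:
  assumes "qcategory Q X" "\<tau> \<in> carrier (CoPSh Q X)" "\<tau>' \<in> carrier (CoPSh Q X)" "x \<in> carrier X"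
  shows "Cmp Q (fst \<tau>) (fst \<tau>') (ty X x) (coval \<tau>' x) (hm (CoPSh Q X) \<tau> \<tau>') \<preceq>[fst \<tau>, ty X x] coval \<tau> x"
  using leq_copsh_hm_iff[of X \<tau> \<tau>' "hm (CoPSh Q X) \<tau> \<tau>'"] assms copsh_hm_closed[of X \<tau> \<tau>']
  by (simp add: leq_refl)

lemma psh_qcategory [simp]:
  assumes X: "qcategory Q X"
  shows "qcategory Q (PSh Q X)"
proof (rule qcategoryI)
  fix \<sigma> assume s: "\<sigma> \<in> carrier (PSh Q X)"
  then show "Idn Q (ty (PSh Q X) \<sigma>) \<preceq>[ty (PSh Q X) \<sigma>, ty (PSh Q X) \<sigma>] hm (PSh Q X) \<sigma> \<sigma>"
    using X by (simp add: leq_psh_hm_iff idn_closed cmp_idn_left leq_refl)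
next
  fix a b c assume s: "a \<in> carrier (PSh Q X)" "b \<in> carrier (PSh Q X)" "c \<in> carrier (PSh Q X)"
  let ?h = "hm (PSh Q X)"
  have h: "?h a b \<in> hom (fst a) (fst b)" "?h b c \<in> hom (fst b) (fst c)"
    using s X by (auto intro: psh_hm_closed)
  have "Cmp Q (ty X x) (fst a) (fst c) (Cmp Q (fst a) (fst b) (fst c) (?h b c) (?h a b)) (val a x)
      \<preceq>[ty X x, fst c] val c x" if x: "x \<in> carrier X" for x
  proof -
    have "Cmp Q (ty X x) (fst b) (fst c) (?h b c) (Cmp Q (ty X x) (fst a) (fst b) (?h a b) (val a x))
      \<preceq>[ty X x, fst c] Cmp Q (ty X x) (fst b) (fst c) (?h b c) (val b x)"
      using s x X h by (intro cmp_mono psh_hm_action leq_refl) auto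
    also have "\<dots> \<preceq>[ty X x, fst c] val c x" using s x X by (intro psh_hm_action)
    finally show ?thesis using cmp_assoc[of "ty X x" "fst a" "fst b" "fst c"] s x X h by simp
  qed
  then show "Cmp Q (ty (PSh Q X) a) (ty (PSh Q X) b) (ty (PSh Q X) c) (?h b c) (?h a b)
      \<preceq>[ty (PSh Q X) a, ty (PSh Q X) c] ?h a c"
    using s X h by (simp add: leq_psh_hm_iff cmp_closed)
next
  show "ty (PSh Q X) \<in> carrier (PSh Q X) \<rightarrow>\<^sub>E Ob Q"
    by (auto simp: PSh_def Let_def PiE_iff)
next
  show "hm (PSh Q X) \<in> extensional (carrier (PSh Q X))"
    by (simp add: PSh_def Let_def)
  show "hm (PSh Q X) \<sigma> \<in> extensional (carrier (PSh Q X))" if "\<sigma> \<in> carrier (PSh Q X)" for \<sigma>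
    using that by (simp add: PSh_def Let_def)
qed (use X in \<open>auto intro: psh_hm_closed\<close>)

lemma copsh_qcategory [simp]:
  assumes X: "qcategory Q X"
  shows "qcategory Q (CoPSh Q X)"
proof (rule qcategoryI)
  fix \<tau> assume s: "\<tau> \<in> carrier (CoPSh Q X)"
  then show "Idn Q (ty (CoPSh Q X) \<tau>) \<preceq>[ty (CoPSh Q X) \<tau>, ty (CoPSh Q X) \<tau>] hm (CoPSh Q X) \<tau> \<tau>"
    using X by (simp add: leq_copsh_hm_iff idn_closed cmp_idn_right leq_refl)
next
  fix a b c assume s: "a \<in> carrier (CoPSh Q X)" "b \<in> carrier (CoPSh Q X)" "c \<in> carrier (CoPSh Q X)"
  let ?h = "hm (CoPSh Q X)"
  have h: "?h a b \<in> hom (fst a) (fst b)" "?h b c \<in> hom (fst b) (fst c)"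
    using s X by (auto intro: copsh_hm_closed)
  have "Cmp Q (fst a) (fst c) (ty X x) (coval c x) (Cmp Q (fst a) (fst b) (fst c) (?h b c) (?h a b))
      \<preceq>[fst a, ty X x] coval a x" if x: "x \<in> carrier X" for x
  proof -
    have "Cmp Q (fst a) (fst b) (ty X x) (Cmp Q (fst b) (fst c) (ty X x) (coval c x) (?h b c)) (?h a b)
      \<preceq>[fst a, ty X x] Cmp Q (fst a) (fst b) (ty X x) (coval b x) (?h a b)"
      using s x X h by (intro cmp_mono copsh_hm_action leq_refl) auto
    also have "\<dots> \<preceq>[fst a, ty X x] coval a x" using s x X by (intro copsh_hm_action)
    finally show ?thesis using cmp_assoc[of "fst a" "fst b" "fst c" "ty X x"] s x X h by simp
  qed
  then show "Cmp Q (ty (CoPSh Q X) a) (ty (CoPSh Q X) b) (ty (CoPSh Q X) c) (?h b c) (?h a b)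
      \<preceq>[ty (CoPSh Q X) a, ty (CoPSh Q X) c] ?h a c"
    using s X h by (simp add: leq_copsh_hm_iff cmp_closed)
next
  show "ty (CoPSh Q X) \<in> carrier (CoPSh Q X) \<rightarrow>\<^sub>E Ob Q"
    by (auto simp: CoPSh_def Let_def PiE_iff)
next
  show "hm (CoPSh Q X) \<in> extensional (carrier (CoPSh Q X))"
    by (simp add: CoPSh_def Let_def)
  show "hm (CoPSh Q X) \<tau> \<in> extensional (carrier (CoPSh Q X))" if "\<tau> \<in> carrier (CoPSh Q X)" for \<tau>
    using that by (simp add: CoPSh_def Let_def)
qed (use X in \<open>auto intro: copsh_hm_closed\<close>)

lemma psh_below_iff:
  assumes X: "qcategory Q X" and s: "\<sigma> \<in> carrier (PSh Q X)" "\<sigma>' \<in> carrier (PSh Q X)"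
  shows "\<sigma> \<lesssim>[PSh Q X] \<sigma>' \<longleftrightarrow> fst \<sigma> = fst \<sigma>' \<and>
    (\<forall>x \<in> carrier X. val \<sigma> x \<preceq>[ty X x, fst \<sigma>] val \<sigma>' x)"
proof (cases "fst \<sigma> = fst \<sigma>'")
  case True
  have "\<sigma> \<lesssim>[PSh Q X] \<sigma>' \<longleftrightarrow> Idn Q (fst \<sigma>) \<preceq>[fst \<sigma>, fst \<sigma>'] hm (PSh Q X) \<sigma> \<sigma>'"
    using assms True belowD(5)[of \<sigma> "PSh Q X" \<sigma>'] by (auto intro!: belowI)
  also have "\<dots> \<longleftrightarrow> (\<forall>x \<in> carrier X. val \<sigma> x \<preceq>[ty X x, fst \<sigma>] val \<sigma>' x)"
    using assms True val_closed[OF X s(1)] psh_type[OF s(1)]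
    by (subst leq_psh_hm_iff) (auto simp: idn_closed cmp_idn_left)
  finally show ?thesis using True by simp
qed (use assms in \<open>auto dest: belowD(4)\<close>)

lemma copsh_below_iff:
  assumes X: "qcategory Q X" and t: "\<tau> \<in> carrier (CoPSh Q X)" "\<tau>' \<in> carrier (CoPSh Q X)"
  shows "\<tau> \<lesssim>[CoPSh Q X] \<tau>' \<longleftrightarrow> fst \<tau> = fst \<tau>' \<and>
    (\<forall>x \<in> carrier X. coval \<tau>' x \<preceq>[fst \<tau>, ty X x] coval \<tau> x)"
proof (cases "fst \<tau> = fst \<tau>'")
  case True
  have "\<tau> \<lesssim>[CoPSh Q X] \<tau>' \<longleftrightarrow> Idn Q (fst \<tau>) \<preceq>[fst \<tau>, fst \<tau>'] hm (CoPSh Q X) \<tau> \<tau>'"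
    using assms True belowD(5)[of \<tau> "CoPSh Q X" \<tau>'] by (auto intro!: belowI)
  also have "\<dots> \<longleftrightarrow> (\<forall>x \<in> carrier X. coval \<tau>' x \<preceq>[fst \<tau>, ty X x] coval \<tau> x)"
    using assms True coval_closed[OF X t(2)] copsh_type[OF t(2)]
    by (subst leq_copsh_hm_iff) (auto simp: idn_closed cmp_idn_right)
  finally show ?thesis using True by simp
qed (use assms in \<open>auto dest: belowD(4)\<close>)

lemma psh_antisym:
  assumes X: "qcategory Q X" and le: "\<sigma> \<lesssim>[PSh Q X] \<sigma>'" "\<sigma>' \<lesssim>[PSh Q X] \<sigma>"
  shows "\<sigma> = \<sigma>'"
proof (rule psh_eqI[OF X])
  show s: "\<sigma> \<in> carrier (PSh Q X)" "\<sigma>' \<in> carrier (PSh Q X)" using le by (auto dest: belowD)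
  show "fst \<sigma> = fst \<sigma>'" using le s X by (simp add: psh_below_iff)
  show "val \<sigma> x = val \<sigma>' x" if "x \<in> carrier X" for x
    using le s X that by (intro leq_antisym[of _ "ty X x" "fst \<sigma>"]) (auto simp: psh_below_iff)
qed

lemma copsh_antisym:
  assumes X: "qcategory Q X" and le: "\<tau> \<lesssim>[CoPSh Q X] \<tau>'" "\<tau>' \<lesssim>[CoPSh Q X] \<tau>"
  shows "\<tau> = \<tau>'"
proof (rule copsh_eqI[OF X])
  show s: "\<tau> \<in> carrier (CoPSh Q X)" "\<tau>' \<in> carrier (CoPSh Q X)" using le by (auto dest: belowD)
  show "fst \<tau> = fst \<tau>'" using le s X by (simp add: copsh_below_iff)
  show "coval \<tau> x = coval \<tau>' x" if "x \<in> carrier X" for x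
    using le s X that by (intro leq_antisym[of _ "fst \<tau>" "ty X x"]) (auto simp: copsh_below_iff)
qed

section \<open>The Yoneda lemmas\<close>

lemma pshI:
  assumes "qcategory Q X" "s \<in> Ob Q" "\<And>x. x \<in> carrier X \<Longrightarrow> F x \<in> hom (ty X x) s"
    and "\<And>x x'. \<lbrakk>x \<in> carrier X; x' \<in> carrier X\<rbrakk> \<Longrightarrow>
      Cmp Q (ty X x') (ty X x) s (F x) (hm X x' x) \<preceq>[ty X x', s] F x'"
  shows "(s, \<lambda>x \<in> carrier X. \<lambda>_. F x) \<in> carrier (PSh Q X)"
  using assms by (simp add: psh_carrier_iff)

lemma copshI:
  assumes "qcategory Q X" "s \<in> Ob Q" "\<And>x. x \<in> carrier X \<Longrightarrow> F x \<in> hom s (ty X x)"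
    and "\<And>x x'. \<lbrakk>x \<in> carrier X; x' \<in> carrier X\<rbrakk> \<Longrightarrow>
      Cmp Q s (ty X x) (ty X x') (hm X x x') (F x) \<preceq>[s, ty X x'] F x'"
  shows "(s, \<lambda>_. \<lambda>x \<in> carrier X. F x) \<in> carrier (CoPSh Q X)"
  using assms by (simp add: copsh_carrier_iff)

text \<open>
  The preorders of \<open>PSh\<close> and \<open>CoPSh\<close> are antisymmetric, so their elements are determined by their
  homs. Equations between images, which are suprema, are thereby reduced to equations between
  inverse images, which are computed by evaluation.
\<close>

lemma psh_eq_by_hm:
  assumes X: "qcategory Q X" and s: "\<sigma> \<in> carrier (PSh Q X)" "\<sigma>' \<in> carrier (PSh Q X)" "fst \<sigma> = fst \<sigma>'"
    and h: "\<And>\<rho>. \<rho> \<in> carrier (PSh Q X) \<Longrightarrow> hm (PSh Q X) \<sigma> \<rho> = hm (PSh Q X) \<sigma>' \<rho>"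
  shows "\<sigma> = \<sigma>'"
proof (rule psh_antisym[OF X])
  show "\<sigma> \<lesssim>[PSh Q X] \<sigma>'"
    using X s h[of \<sigma>'] hm_refl[of "PSh Q X" \<sigma>'] by (intro belowI) simp_all
  show "\<sigma>' \<lesssim>[PSh Q X] \<sigma>"
    using X s h[of \<sigma>] hm_refl[of "PSh Q X" \<sigma>] by (intro belowI) simp_all
qed

lemma copsh_eq_by_hm:
  assumes X: "qcategory Q X" and s: "\<tau> \<in> carrier (CoPSh Q X)" "\<tau>' \<in> carrier (CoPSh Q X)" "fst \<tau> = fst \<tau>'"
    and h: "\<And>\<rho>. \<rho> \<in> carrier (CoPSh Q X) \<Longrightarrow> hm (CoPSh Q X) \<rho> \<tau> = hm (CoPSh Q X) \<rho> \<tau>'"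
  shows "\<tau> = \<tau>'"
proof (rule copsh_antisym[OF X])
  show "\<tau> \<lesssim>[CoPSh Q X] \<tau>'"
    using X s h[of \<tau>] hm_refl[of "CoPSh Q X" \<tau>] by (intro belowI) simp_all
  show "\<tau>' \<lesssim>[CoPSh Q X] \<tau>"
    using X s h[of \<tau>'] hm_refl[of "CoPSh Q X" \<tau>'] by (intro belowI) simp_all
qed

lemma yon_sel [simp]:
  assumes "x \<in> carrier X"
  shows "fst (yon X x) = ty X x" "x' \<in> carrier X \<Longrightarrow> val (yon X x) x' = hm X x' x"
  using assms by (simp_all add: yon_def)

lemma coyon_sel [simp]:
  assumes "x \<in> carrier X"
  shows "fst (coyon X x) = ty X x" "x' \<in> carrier X \<Longrightarrow> coval (coyon X x) x' = hm X x x'"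
  using assms by (simp_all add: coyon_def)

lemma yon_closed [simp]: "\<lbrakk>qcategory Q X; x \<in> carrier X\<rbrakk> \<Longrightarrow> yon X x \<in> carrier (PSh Q X)"
  unfolding yon_def by simp (intro pshI, simp_all add: hm_trans)

lemma coyon_closed [simp]: "\<lbrakk>qcategory Q X; x \<in> carrier X\<rbrakk> \<Longrightarrow> coyon X x \<in> carrier (CoPSh Q X)"
  unfolding coyon_def by simp (intro copshI, simp_all add: hm_trans)

lemma yoneda:
  assumes X: "qcategory Q X" and x: "x \<in> carrier X" and s: "\<sigma> \<in> carrier (PSh Q X)"
  shows "hm (PSh Q X) (yon X x) \<sigma> = val \<sigma> x"
proof (rule leq_antisym)
  let ?h = "hm (PSh Q X) (yon X x) \<sigma>"
  have h: "?h \<in> hom (ty X x) (fst \<sigma>)" using psh_hm_closed[of X "yon X x" \<sigma>] assms by simp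
  have "?h \<preceq>[ty X x, fst \<sigma>] Cmp Q (ty X x) (ty X x) (fst \<sigma>) ?h (hm X x x)"
    using assms h by (intro idn_cmp_mono_right hm_refl) simp_all
  also have "\<dots> \<preceq>[ty X x, fst \<sigma>] val \<sigma> x"
    using psh_hm_action[of X "yon X x" \<sigma> x] assms by simp
  finally show "?h \<preceq>[ty X x, fst \<sigma>] val \<sigma> x" .
  show "val \<sigma> x \<preceq>[ty X x, fst \<sigma>] ?h"
    using leq_psh_hm_iff[of X "yon X x" \<sigma> "val \<sigma> x"] assms by (simp add: val_action)
qed

lemma coyoneda:
  assumes X: "qcategory Q X" and x: "x \<in> carrier X" and t: "\<tau> \<in> carrier (CoPSh Q X)"
  shows "hm (CoPSh Q X) \<tau> (coyon X x) = coval \<tau> x"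
proof (rule leq_antisym)
  let ?h = "hm (CoPSh Q X) \<tau> (coyon X x)"
  have h: "?h \<in> hom (fst \<tau>) (ty X x)" using copsh_hm_closed[of X \<tau> "coyon X x"] assms by simp
  have "?h \<preceq>[fst \<tau>, ty X x] Cmp Q (fst \<tau>) (ty X x) (ty X x) (hm X x x) ?h"
    using assms h by (intro idn_cmp_mono_left hm_refl) simp_all
  also have "\<dots> \<preceq>[fst \<tau>, ty X x] coval \<tau> x"
    using copsh_hm_action[of X \<tau> "coyon X x" x] assms by simp
  finally show "?h \<preceq>[fst \<tau>, ty X x] coval \<tau> x" .
  show "coval \<tau> x \<preceq>[fst \<tau>, ty X x] ?h"
    using leq_copsh_hm_iff[of X \<tau> "coyon X x" "coval \<tau> x"] assms by (simp add: coval_action)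
qed

lemma yon_functor [simp]: "qcategory Q X \<Longrightarrow> yon X \<in> qfunctors Q X (PSh Q X)"
  by (rule qfunctorI) (auto simp: yoneda leq_refl, simp add: yon_def)

lemma yon_below: "\<lbrakk>qcategory Q X; a \<lesssim>[X] b\<rbrakk> \<Longrightarrow> yon X a \<lesssim>[PSh Q X] yon X b"
  by (rule functor_below[of _ _ X]) simp_all

lemma coyon_functor [simp]: "qcategory Q X \<Longrightarrow> coyon X \<in> qfunctors Q X (CoPSh Q X)"
  by (rule qfunctorI) (auto simp: coyoneda leq_refl, simp add: coyon_def)

lemma val_antimono:
  assumes "qcategory Q X" "\<sigma> \<in> carrier (PSh Q X)" "a \<lesssim>[X] b"
  shows "val \<sigma> b \<preceq>[ty X b, fst \<sigma>] val \<sigma> a"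
  using below_hm_left[OF functor_below[OF _ yon_functor assms(3)] assms(2)] assms belowD[OF assms(3)]
  by (simp add: yoneda)

lemma coval_mono:
  assumes "qcategory Q X" "\<tau> \<in> carrier (CoPSh Q X)" "a \<lesssim>[X] b"
  shows "coval \<tau> a \<preceq>[fst \<tau>, ty X b] coval \<tau> b"
  using below_hm_right[OF functor_below[OF _ coyon_functor assms(3)] assms(2)] assms belowD[OF assms(3)]
  by (simp add: coyoneda)


section \<open>Images and inverse images\<close>

text \<open>
  Images are suprema, described by the arrows above them.
\<close>

lemma psh_push_sel:
  assumes "qcategory Q X" "qcategory Q Y" "f \<in> qfunctors Q X Y" "\<sigma> \<in> carrier (PSh Q X)" "y \<in> carrier Y"
  shows "fst (psh_push Q X Y f \<sigma>) = fst \<sigma>"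
    and "val (psh_push Q X Y f \<sigma>) y \<in> hom (ty Y y) (fst \<sigma>)"
    and "w \<in> hom (ty Y y) (fst \<sigma>) \<Longrightarrow> val (psh_push Q X Y f \<sigma>) y \<preceq>[ty Y y, fst \<sigma>] w \<longleftrightarrow>
      (\<forall>x \<in> carrier X. Cmp Q (ty Y y) (ty X x) (fst \<sigma>) (val \<sigma> x) (hm Y y (f x)) \<preceq>[ty Y y, fst \<sigma>] w)"
proof -
  have h: "hm Y y (f x) \<in> hom (ty Y y) (ty X x)" if "x \<in> carrier X" for x
    using hm_closed[of Y y "f x"] assms that by simp
  show "fst (psh_push Q X Y f \<sigma>) = fst \<sigma>"
    using assms by (simp add: psh_push_def)
  show "val (psh_push Q X Y f \<sigma>) y \<in> hom (ty Y y) (fst \<sigma>)"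
    using assms h qrel_comp_closed[of y Y "()" "point Q (fst \<sigma>)" X "cograph X Y f" "snd \<sigma>"]
    by (simp add: psh_push_def cograph_def)
  show "val (psh_push Q X Y f \<sigma>) y \<preceq>[ty Y y, fst \<sigma>] w \<longleftrightarrow>
      (\<forall>x \<in> carrier X. Cmp Q (ty Y y) (ty X x) (fst \<sigma>) (val \<sigma> x) (hm Y y (f x)) \<preceq>[ty Y y, fst \<sigma>] w)"
    if "w \<in> hom (ty Y y) (fst \<sigma>)"
    using that assms h qrel_comp_leq_iff[of y Y "()" "point Q (fst \<sigma>)" X "cograph X Y f" "snd \<sigma>" w]
    by (simp add: psh_push_def cograph_def)
qed

lemma copsh_push_sel:
  assumes "qcategory Q X" "qcategory Q Y" "f \<in> qfunctors Q X Y" "\<tau> \<in> carrier (CoPSh Q X)" "y \<in> carrier Y"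
  shows "fst (copsh_push Q X Y f \<tau>) = fst \<tau>"
    and "coval (copsh_push Q X Y f \<tau>) y \<in> hom (fst \<tau>) (ty Y y)"
    and "w \<in> hom (fst \<tau>) (ty Y y) \<Longrightarrow> coval (copsh_push Q X Y f \<tau>) y \<preceq>[fst \<tau>, ty Y y] w \<longleftrightarrow>
      (\<forall>x \<in> carrier X. Cmp Q (fst \<tau>) (ty X x) (ty Y y) (hm Y (f x) y) (coval \<tau> x) \<preceq>[fst \<tau>, ty Y y] w)"
proof -
  have h: "hm Y (f x) y \<in> hom (ty X x) (ty Y y)" if "x \<in> carrier X" for x
    using hm_closed[of Y "f x" y] assms that by simp
  show "fst (copsh_push Q X Y f \<tau>) = fst \<tau>"
    using assms by (simp add: copsh_push_def)
  show "coval (copsh_push Q X Y f \<tau>) y \<in> hom (fst \<tau>) (ty Y y)"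
    using assms h qrel_comp_closed[of "()" "point Q (fst \<tau>)" y Y X "snd \<tau>" "graph X Y f"]
    by (simp add: copsh_push_def graph_def)
  show "coval (copsh_push Q X Y f \<tau>) y \<preceq>[fst \<tau>, ty Y y] w \<longleftrightarrow>
      (\<forall>x \<in> carrier X. Cmp Q (fst \<tau>) (ty X x) (ty Y y) (hm Y (f x) y) (coval \<tau> x) \<preceq>[fst \<tau>, ty Y y] w)"
    if "w \<in> hom (fst \<tau>) (ty Y y)"
    using that assms h qrel_comp_leq_iff[of "()" "point Q (fst \<tau>)" y Y X "snd \<tau>" "graph X Y f" w]
    by (simp add: copsh_push_def graph_def)
qed

lemma leq_val_push:
  assumes "qcategory Q X" "qcategory Q Y" "f \<in> qfunctors Q X Y" "\<sigma> \<in> carrier (PSh Q X)"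
    and "x \<in> carrier X" "y \<in> carrier Y"
  shows "Cmp Q (ty Y y) (ty X x) (fst \<sigma>) (val \<sigma> x) (hm Y y (f x))
    \<preceq>[ty Y y, fst \<sigma>] val (psh_push Q X Y f \<sigma>) y"
  using psh_push_sel(3)[OF assms(1-4,6) psh_push_sel(2)[OF assms(1-4,6)]] assms
    leq_refl[OF _ _ psh_push_sel(2)[OF assms(1-4,6)]] by simp

lemma leq_coval_push:
  assumes "qcategory Q X" "qcategory Q Y" "f \<in> qfunctors Q X Y" "\<tau> \<in> carrier (CoPSh Q X)"
    and "x \<in> carrier X" "y \<in> carrier Y"
  shows "Cmp Q (fst \<tau>) (ty X x) (ty Y y) (hm Y (f x) y) (coval \<tau> x)
    \<preceq>[fst \<tau>, ty Y y] coval (copsh_push Q X Y f \<tau>) y"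
  using copsh_push_sel(3)[OF assms(1-4,6) copsh_push_sel(2)[OF assms(1-4,6)]] assms
    leq_refl[OF _ _ copsh_push_sel(2)[OF assms(1-4,6)]] by simp

lemma psh_push_fst [simp]:
  "\<sigma> \<in> carrier (PSh Q X) \<Longrightarrow> fst (psh_push Q X Y f \<sigma>) = fst \<sigma>"
  by (simp add: psh_push_def)

lemma copsh_push_fst [simp]:
  "\<tau> \<in> carrier (CoPSh Q X) \<Longrightarrow> fst (copsh_push Q X Y f \<tau>) = fst \<tau>"
  by (simp add: copsh_push_def)

text \<open>
  Moving the composition with the hom to the other side by a residual turns the claim into an
  upper bound of the supremum that defines the image.
\<close>

lemma psh_push_closed [simp]:
  assumes "qcategory Q X" "qcategory Q Y" "f \<in> qfunctors Q X Y" "\<sigma> \<in> carrier (PSh Q X)"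
  shows "psh_push Q X Y f \<sigma> \<in> carrier (PSh Q Y)"
proof -
  let ?p = "psh_push Q X Y f \<sigma>"
  have "Cmp Q (ty Y y') (ty Y y) (fst \<sigma>) (val ?p y) (hm Y y' y) \<preceq>[ty Y y', fst \<sigma>] val ?p y'"
    if y: "y \<in> carrier Y" "y' \<in> carrier Y" for y y'
  proof -
    let ?r = "res_left Q (ty Y y') (ty Y y) (fst \<sigma>) (val ?p y') (hm Y y' y)"
    have p: "val ?p z \<in> hom (ty Y z) (fst \<sigma>)" if "z \<in> carrier Y" for z
      using psh_push_sel(2)[OF assms that] .
    have r: "?r \<in> hom (ty Y y) (fst \<sigma>)" using y assms p by (intro res_left_closed) simp_all
    have "val ?p y \<preceq>[ty Y y, fst \<sigma>] ?r"
    proof (subst psh_push_sel(3)[OF assms y(1) r], intro ballI)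
      fix x assume x: "x \<in> carrier X"
      have h: "hm Y z (f x) \<in> hom (ty Y z) (ty X x)" if "z \<in> carrier Y" for z
        using hm_closed[of Y z "f x"] assms that x by simp
      have "Cmp Q (ty Y y') (ty Y y) (fst \<sigma>)
          (Cmp Q (ty Y y) (ty X x) (fst \<sigma>) (val \<sigma> x) (hm Y y (f x))) (hm Y y' y)
        = Cmp Q (ty Y y') (ty X x) (fst \<sigma>) (val \<sigma> x)
          (Cmp Q (ty Y y') (ty Y y) (ty X x) (hm Y y (f x)) (hm Y y' y))"
        using x y assms h by (intro cmp_assoc[symmetric]) simp_all
      also have "\<dots> \<preceq>[ty Y y', fst \<sigma>] Cmp Q (ty Y y') (ty X x) (fst \<sigma>) (val \<sigma> x) (hm Y y' (f x))"
        using hm_trans[of Y y' y "f x"] x y assms by (intro cmp_mono leq_refl) simp_all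
      also have "\<dots> \<preceq>[ty Y y', fst \<sigma>] val ?p y'" using x y assms by (intro leq_val_push)
      finally show "Cmp Q (ty Y y) (ty X x) (fst \<sigma>) (val \<sigma> x) (hm Y y (f x)) \<preceq>[ty Y y, fst \<sigma>] ?r"
        using x y assms h p by (subst leq_res_left_iff) (simp_all add: cmp_closed)
    qed
    then show ?thesis using y assms p by (subst (asm) leq_res_left_iff) simp_all
  qed
  moreover have "snd ?p \<in> extensional (carrier Y)"
    using assms by (simp add: psh_push_def qrel_comp_def)
  moreover have "\<forall>y \<in> carrier Y. val ?p y \<in> hom (ty Y y) (fst \<sigma>)"
    using psh_push_sel(2)[OF assms] by blast
  ultimately show ?thesis using assms by (simp add: psh_carrier_iff[OF assms(2)])
qed

lemma copsh_push_closed [simp]: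
  assumes "qcategory Q X" "qcategory Q Y" "f \<in> qfunctors Q X Y" "\<tau> \<in> carrier (CoPSh Q X)"
  shows "copsh_push Q X Y f \<tau> \<in> carrier (CoPSh Q Y)"
proof -
  let ?p = "copsh_push Q X Y f \<tau>"
  have "Cmp Q (fst \<tau>) (ty Y y) (ty Y y') (hm Y y y') (coval ?p y) \<preceq>[fst \<tau>, ty Y y'] coval ?p y'"
    if y: "y \<in> carrier Y" "y' \<in> carrier Y" for y y'
  proof -
    let ?r = "res_right Q (fst \<tau>) (ty Y y) (ty Y y') (hm Y y y') (coval ?p y')"
    have p: "coval ?p z \<in> hom (fst \<tau>) (ty Y z)" if "z \<in> carrier Y" for z
      using copsh_push_sel(2)[OF assms that] .
    have r: "?r \<in> hom (fst \<tau>) (ty Y y)" using y assms p by (intro res_right_closed) simp_all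
    have "coval ?p y \<preceq>[fst \<tau>, ty Y y] ?r"
    proof (subst copsh_push_sel(3)[OF assms y(1) r], intro ballI)
      fix x assume x: "x \<in> carrier X"
      have h: "hm Y (f x) z \<in> hom (ty X x) (ty Y z)" if "z \<in> carrier Y" for z
        using hm_closed[of Y "f x" z] assms that x by simp
      have "Cmp Q (fst \<tau>) (ty Y y) (ty Y y') (hm Y y y')
          (Cmp Q (fst \<tau>) (ty X x) (ty Y y) (hm Y (f x) y) (coval \<tau> x))
        = Cmp Q (fst \<tau>) (ty X x) (ty Y y')
          (Cmp Q (ty X x) (ty Y y) (ty Y y') (hm Y y y') (hm Y (f x) y)) (coval \<tau> x)"
        using x y assms h by (intro cmp_assoc) simp_all
      also have "\<dots> \<preceq>[fst \<tau>, ty Y y'] Cmp Q (fst \<tau>) (ty X x) (ty Y y') (hm Y (f x) y') (coval \<tau> x)"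
        using hm_trans[of Y "f x" y y'] x y assms by (intro cmp_mono leq_refl) simp_all
      also have "\<dots> \<preceq>[fst \<tau>, ty Y y'] coval ?p y'" using x y assms by (intro leq_coval_push)
      finally show "Cmp Q (fst \<tau>) (ty X x) (ty Y y) (hm Y (f x) y) (coval \<tau> x) \<preceq>[fst \<tau>, ty Y y] ?r"
        using x y assms h p by (subst leq_res_right_iff) (simp_all add: cmp_closed)
    qed
    then show ?thesis using y assms p by (subst (asm) leq_res_right_iff) simp_all
  qed
  moreover have "snd ?p () \<in> extensional (carrier Y)"
    using assms by (simp add: copsh_push_def qrel_comp_def)
  moreover have "\<forall>y \<in> carrier Y. coval ?p y \<in> hom (fst \<tau>) (ty Y y)"
    using copsh_push_sel(2)[OF assms] by blast
  ultimately show ?thesis using assms by (simp add: copsh_carrier_iff[OF assms(2)])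
qed

lemma psh_pull_fst [simp]:
  "\<sigma> \<in> carrier (PSh Q Y) \<Longrightarrow> fst (psh_pull Q X Y f \<sigma>) = fst \<sigma>"
  by (simp add: psh_pull_def)

lemma copsh_pull_fst [simp]:
  "\<tau> \<in> carrier (CoPSh Q Y) \<Longrightarrow> fst (copsh_pull Q X Y f \<tau>) = fst \<tau>"
  by (simp add: copsh_pull_def)

text \<open>
  The supremum that defines \<open>\<sigma> \<circ> f\<^sub>*\<close> at \<open>x\<close> is attained at \<open>f x\<close>, so inverse images are evaluations.
\<close>

lemma psh_pull_val [simp]:
  assumes "qcategory Q X" "qcategory Q Y" "f \<in> qfunctors Q X Y" "\<sigma> \<in> carrier (PSh Q Y)" "x \<in> carrier X"
  shows "val (psh_pull Q X Y f \<sigma>) x = val \<sigma> (f x)"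
proof -
  let ?v = "val (psh_pull Q X Y f \<sigma>) x"
  have h: "hm Y (f x) y \<in> hom (ty X x) (ty Y y)" if "y \<in> carrier Y" for y
    using hm_closed[of Y "f x" y] assms that by simp
  have s: "val \<sigma> (f x) \<in> hom (ty X x) (fst \<sigma>)" using val_closed[of Y \<sigma> "f x"] assms by simp
  have v: "?v \<in> hom (ty X x) (fst \<sigma>)"
    using assms h qrel_comp_closed[of x X "()" "point Q (fst \<sigma>)" Y "graph X Y f" "snd \<sigma>"]
    by (simp add: psh_pull_def graph_def)
  have iff: "?v \<preceq>[ty X x, fst \<sigma>] w \<longleftrightarrow>
      (\<forall>y \<in> carrier Y. Cmp Q (ty X x) (ty Y y) (fst \<sigma>) (val \<sigma> y) (hm Y (f x) y) \<preceq>[ty X x, fst \<sigma>] w)"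
    if "w \<in> hom (ty X x) (fst \<sigma>)" for w
    using that assms h qrel_comp_leq_iff[of x X "()" "point Q (fst \<sigma>)" Y "graph X Y f" "snd \<sigma>" w]
    by (simp add: psh_pull_def graph_def)
  show ?thesis
  proof (rule leq_antisym)
    show "?v \<preceq>[ty X x, fst \<sigma>] val \<sigma> (f x)"
      unfolding iff[OF s] using val_action[of Y \<sigma> _ "f x"] assms by simp
    have "val \<sigma> (f x) \<preceq>[ty X x, fst \<sigma>] Cmp Q (ty X x) (ty X x) (fst \<sigma>) (val \<sigma> (f x)) (hm Y (f x) (f x))"
      using hm_refl[of Y "f x"] s assms by (intro idn_cmp_mono_right) simp_all
    also have "\<dots> \<preceq>[ty X x, fst \<sigma>] ?v"
      using bspec[OF iffD1[OF iff[OF v] leq_refl[OF _ _ v]] functor_closed[OF assms(3,5)]] assms by simp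
    finally show "val \<sigma> (f x) \<preceq>[ty X x, fst \<sigma>] ?v" .
  qed
qed

lemma copsh_pull_val [simp]:
  assumes "qcategory Q X" "qcategory Q Y" "f \<in> qfunctors Q X Y" "\<tau> \<in> carrier (CoPSh Q Y)" "x \<in> carrier X"
  shows "coval (copsh_pull Q X Y f \<tau>) x = coval \<tau> (f x)"
proof -
  let ?v = "coval (copsh_pull Q X Y f \<tau>) x"
  have h: "hm Y y (f x) \<in> hom (ty Y y) (ty X x)" if "y \<in> carrier Y" for y
    using hm_closed[of Y y "f x"] assms that by simp
  have s: "coval \<tau> (f x) \<in> hom (fst \<tau>) (ty X x)" using coval_closed[of Y \<tau> "f x"] assms by simp
  have v: "?v \<in> hom (fst \<tau>) (ty X x)"
    using assms h qrel_comp_closed[of "()" "point Q (fst \<tau>)" x X Y "snd \<tau>" "cograph X Y f"]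
    by (simp add: copsh_pull_def cograph_def)
  have iff: "?v \<preceq>[fst \<tau>, ty X x] w \<longleftrightarrow>
      (\<forall>y \<in> carrier Y. Cmp Q (fst \<tau>) (ty Y y) (ty X x) (hm Y y (f x)) (coval \<tau> y) \<preceq>[fst \<tau>, ty X x] w)"
    if "w \<in> hom (fst \<tau>) (ty X x)" for w
    using that assms h qrel_comp_leq_iff[of "()" "point Q (fst \<tau>)" x X Y "snd \<tau>" "cograph X Y f" w]
    by (simp add: copsh_pull_def cograph_def)
  show ?thesis
  proof (rule leq_antisym)
    show "?v \<preceq>[fst \<tau>, ty X x] coval \<tau> (f x)"
      unfolding iff[OF s] using coval_action[of Y \<tau> _ "f x"] assms by simp
    have "coval \<tau> (f x) \<preceq>[fst \<tau>, ty X x] Cmp Q (fst \<tau>) (ty X x) (ty X x) (hm Y (f x) (f x)) (coval \<tau> (f x))"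
      using hm_refl[of Y "f x"] s assms by (intro idn_cmp_mono_left) simp_all
    also have "\<dots> \<preceq>[fst \<tau>, ty X x] ?v"
      using bspec[OF iffD1[OF iff[OF v] leq_refl[OF _ _ v]] functor_closed[OF assms(3,5)]] assms by simp
    finally show "coval \<tau> (f x) \<preceq>[fst \<tau>, ty X x] ?v" .
  qed
qed

lemma psh_pull_closed [simp]:
  assumes "qcategory Q X" "qcategory Q Y" "f \<in> qfunctors Q X Y" "\<sigma> \<in> carrier (PSh Q Y)"
  shows "psh_pull Q X Y f \<sigma> \<in> carrier (PSh Q X)"
proof -
  let ?p = "psh_pull Q X Y f \<sigma>"
  have s: "val \<sigma> (f x) \<in> hom (ty X x) (fst \<sigma>)" if "x \<in> carrier X" for x
    using val_closed[of Y \<sigma> "f x"] assms that by simp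
  have "Cmp Q (ty X x') (ty X x) (fst \<sigma>) (val \<sigma> (f x)) (hm X x' x) \<preceq>[ty X x', fst \<sigma>] val \<sigma> (f x')"
    if x: "x \<in> carrier X" "x' \<in> carrier X" for x x'
  proof -
    have "Cmp Q (ty X x') (ty X x) (fst \<sigma>) (val \<sigma> (f x)) (hm X x' x)
      \<preceq>[ty X x', fst \<sigma>] Cmp Q (ty X x') (ty X x) (fst \<sigma>) (val \<sigma> (f x)) (hm Y (f x') (f x))"
      using x s assms by (intro cmp_mono leq_refl functor_hm) simp_all
    also have "\<dots> \<preceq>[ty X x', fst \<sigma>] val \<sigma> (f x')"
      using val_action[of Y \<sigma> "f x" "f x'"] x assms by simp
    finally show ?thesis .
  qed
  moreover have "snd ?p \<in> extensional (carrier X)"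
    using assms by (simp add: psh_pull_def qrel_comp_def)
  ultimately show ?thesis using s assms by (simp add: psh_carrier_iff[of X])
qed

lemma copsh_pull_closed [simp]:
  assumes "qcategory Q X" "qcategory Q Y" "f \<in> qfunctors Q X Y" "\<tau> \<in> carrier (CoPSh Q Y)"
  shows "copsh_pull Q X Y f \<tau> \<in> carrier (CoPSh Q X)"
proof -
  let ?p = "copsh_pull Q X Y f \<tau>"
  have s: "coval \<tau> (f x) \<in> hom (fst \<tau>) (ty X x)" if "x \<in> carrier X" for x
    using coval_closed[of Y \<tau> "f x"] assms that by simp
  have "Cmp Q (fst \<tau>) (ty X x) (ty X x') (hm X x x') (coval \<tau> (f x)) \<preceq>[fst \<tau>, ty X x'] coval \<tau> (f x')"
    if x: "x \<in> carrier X" "x' \<in> carrier X" for x x'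
  proof -
    have "Cmp Q (fst \<tau>) (ty X x) (ty X x') (hm X x x') (coval \<tau> (f x))
      \<preceq>[fst \<tau>, ty X x'] Cmp Q (fst \<tau>) (ty X x) (ty X x') (hm Y (f x) (f x')) (coval \<tau> (f x))"
      using x s assms by (intro cmp_mono leq_refl functor_hm) simp_all
    also have "\<dots> \<preceq>[fst \<tau>, ty X x'] coval \<tau> (f x')"
      using coval_action[of Y \<tau> "f x" "f x'"] x assms by simp
    finally show ?thesis .
  qed
  moreover have "snd ?p () \<in> extensional (carrier X)"
    using assms by (simp add: copsh_pull_def qrel_comp_def)
  ultimately show ?thesis using s assms by (simp add: copsh_carrier_iff[of X])
qed

text \<open>
  An arrow lies below either hom iff its composites with all \<open>\<sigma>(x) \<circ> 1(y, f x)\<close> lie below \<open>\<rho>(y)\<close>; the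
  cases \<open>y = f x\<close> imply the others, since \<open>\<rho>\<close> absorbs the hom of \<open>Y\<close>.
\<close>

lemma psh_push_pull_adj:
  assumes X: "qcategory Q X" and Y: "qcategory Q Y" and f: "f \<in> qfunctors Q X Y"
  shows "qadj (PSh Q X) (PSh Q Y) (psh_push Q X Y f) (psh_pull Q X Y f)"
proof (rule qadjI)
  show "psh_push Q X Y f \<in> carrier (PSh Q X) \<rightarrow>\<^sub>E carrier (PSh Q Y)"
    using assms by (auto simp: psh_push_closed) (simp add: psh_push_def)
  show "psh_pull Q X Y f \<in> carrier (PSh Q Y) \<rightarrow>\<^sub>E carrier (PSh Q X)"
    using assms by (auto simp: psh_pull_closed) (simp add: psh_pull_def)
  fix \<sigma> \<rho> assume s: "\<sigma> \<in> carrier (PSh Q X)" and r: "\<rho> \<in> carrier (PSh Q Y)"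
  note pc = psh_push_closed[OF X Y f s] psh_pull_closed[OF X Y f r]
  let ?l = "hm (PSh Q Y) (psh_push Q X Y f \<sigma>) \<rho>" and ?r = "hm (PSh Q X) \<sigma> (psh_pull Q X Y f \<rho>)"
  have lc: "?l \<in> hom (fst \<sigma>) (fst \<rho>)" and rc: "?r \<in> hom (fst \<sigma>) (fst \<rho>)"
    using psh_hm_closed[OF Y pc(1) r] psh_hm_closed[OF X s pc(2)] s r by simp_all
  show "?l = ?r"
  proof (rule eq_by_lower[OF _ _ lc rc])
    fix w assume w: "w \<in> hom (fst \<sigma>) (fst \<rho>)"
    have "w \<preceq>[fst \<sigma>, fst \<rho>] ?l \<longleftrightarrow> (\<forall>y \<in> carrier Y.
        Cmp Q (ty Y y) (fst \<sigma>) (fst \<rho>) w (val (psh_push Q X Y f \<sigma>) y) \<preceq>[ty Y y, fst \<rho>] val \<rho> y)"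
      using leq_psh_hm_iff[OF Y pc(1) r, of w] s w by simp
    also have "\<dots> \<longleftrightarrow> (\<forall>y \<in> carrier Y.
        val (psh_push Q X Y f \<sigma>) y \<preceq>[ty Y y, fst \<sigma>] res_right Q (ty Y y) (fst \<sigma>) (fst \<rho>) w (val \<rho> y))"
      using s r w Y psh_push_sel(2)[OF X Y f s] by (simp add: leq_res_right_iff)
    also have "\<dots> \<longleftrightarrow> (\<forall>y \<in> carrier Y. \<forall>x \<in> carrier X.
        Cmp Q (ty Y y) (ty X x) (fst \<sigma>) (val \<sigma> x) (hm Y y (f x))
          \<preceq>[ty Y y, fst \<sigma>] res_right Q (ty Y y) (fst \<sigma>) (fst \<rho>) w (val \<rho> y))"
      using s r w Y psh_push_sel(3)[OF X Y f s] by (simp add: res_right_closed)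
    also have "\<dots> \<longleftrightarrow> (\<forall>y \<in> carrier Y. \<forall>x \<in> carrier X.
        Cmp Q (ty Y y) (ty X x) (fst \<rho>) (Cmp Q (ty X x) (fst \<sigma>) (fst \<rho>) w (val \<sigma> x)) (hm Y y (f x))
          \<preceq>[ty Y y, fst \<rho>] val \<rho> y)"
    proof (intro ball_cong refl)
      fix x y assume x: "x \<in> carrier X" and y: "y \<in> carrier Y"
      have h: "hm Y y (f x) \<in> hom (ty Y y) (ty X x)" using hm_closed[of Y y "f x"] x y f Y by simp
      show "Cmp Q (ty Y y) (ty X x) (fst \<sigma>) (val \<sigma> x) (hm Y y (f x))
          \<preceq>[ty Y y, fst \<sigma>] res_right Q (ty Y y) (fst \<sigma>) (fst \<rho>) w (val \<rho> y) \<longleftrightarrow>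
        Cmp Q (ty Y y) (ty X x) (fst \<rho>) (Cmp Q (ty X x) (fst \<sigma>) (fst \<rho>) w (val \<sigma> x)) (hm Y y (f x))
          \<preceq>[ty Y y, fst \<rho>] val \<rho> y"
        using s r w x y h X Y cmp_assoc[of "ty Y y" "ty X x" "fst \<sigma>" "fst \<rho>" "hm Y y (f x)" "val \<sigma> x" w]
        by (simp add: leq_res_right_iff cmp_closed)
    qed
    also have "\<dots> \<longleftrightarrow> (\<forall>x \<in> carrier X.
        Cmp Q (ty X x) (fst \<sigma>) (fst \<rho>) w (val \<sigma> x) \<preceq>[ty X x, fst \<rho>] val \<rho> (f x))" (is "?A \<longleftrightarrow> ?B")
    proof
      assume A: ?A
      show ?B
      proof
        fix x assume x: "x \<in> carrier X"
        let ?c = "Cmp Q (ty X x) (fst \<sigma>) (fst \<rho>) w (val \<sigma> x)"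
        have "?c \<preceq>[ty X x, fst \<rho>] Cmp Q (ty X x) (ty X x) (fst \<rho>) ?c (hm Y (f x) (f x))"
          using hm_refl[of Y "f x"] x s r w X Y f by (intro idn_cmp_mono_right) (simp_all add: cmp_closed)
        also have "\<dots> \<preceq>[ty X x, fst \<rho>] val \<rho> (f x)" using bspec[OF bspec[OF A functor_closed[OF f x]] x] f x by simp
        finally show "?c \<preceq>[ty X x, fst \<rho>] val \<rho> (f x)" .
      qed
    next
      assume B: ?B
      show ?A
      proof (intro ballI)
        fix x y assume x: "x \<in> carrier X" and y: "y \<in> carrier Y"
        have h: "hm Y y (f x) \<in> hom (ty Y y) (ty X x)" using hm_closed[of Y y "f x"] x y f Y by simp
        have "Cmp Q (ty Y y) (ty X x) (fst \<rho>) (Cmp Q (ty X x) (fst \<sigma>) (fst \<rho>) w (val \<sigma> x)) (hm Y y (f x))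
          \<preceq>[ty Y y, fst \<rho>] Cmp Q (ty Y y) (ty X x) (fst \<rho>) (val \<rho> (f x)) (hm Y y (f x))"
          using B x y h X Y by (intro cmp_mono leq_refl) simp_all
        also have "\<dots> \<preceq>[ty Y y, fst \<rho>] val \<rho> y"
          using val_action[of Y \<rho> "f x" y] x y r f Y by simp
        finally show "Cmp Q (ty Y y) (ty X x) (fst \<rho>) (Cmp Q (ty X x) (fst \<sigma>) (fst \<rho>) w (val \<sigma> x)) (hm Y y (f x))
          \<preceq>[ty Y y, fst \<rho>] val \<rho> y" .
      qed
    qed
    also have "\<dots> \<longleftrightarrow> w \<preceq>[fst \<sigma>, fst \<rho>] ?r"
      using leq_psh_hm_iff[OF X s pc(2), of w] r w X Y f by simp
    finally show "w \<preceq>[fst \<sigma>, fst \<rho>] ?l \<longleftrightarrow> w \<preceq>[fst \<sigma>, fst \<rho>] ?r" .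
  qed (use s r in simp_all)
qed (use assms in \<open>simp_all add: psh_push_closed psh_pull_closed\<close>)

text \<open>
  The order of copresheaves is opposite to the pointwise order of their values, hence here the
  inverse image is the left adjoint.
\<close>

lemma copsh_pull_push_adj:
  assumes X: "qcategory Q X" and Y: "qcategory Q Y" and f: "f \<in> qfunctors Q X Y"
  shows "qadj (CoPSh Q Y) (CoPSh Q X) (copsh_pull Q X Y f) (copsh_push Q X Y f)"
proof (rule qadjI)
  show "copsh_push Q X Y f \<in> carrier (CoPSh Q X) \<rightarrow>\<^sub>E carrier (CoPSh Q Y)"
    using assms by (auto simp: copsh_push_closed) (simp add: copsh_push_def)
  show "copsh_pull Q X Y f \<in> carrier (CoPSh Q Y) \<rightarrow>\<^sub>E carrier (CoPSh Q X)"
    using assms by (auto simp: copsh_pull_closed) (simp add: copsh_pull_def)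
  fix \<rho> \<tau> assume r: "\<rho> \<in> carrier (CoPSh Q Y)" and s: "\<tau> \<in> carrier (CoPSh Q X)"
  note pc = copsh_push_closed[OF X Y f s] copsh_pull_closed[OF X Y f r]
  let ?l = "hm (CoPSh Q Y) \<rho> (copsh_push Q X Y f \<tau>)" and ?r = "hm (CoPSh Q X) (copsh_pull Q X Y f \<rho>) \<tau>"
  have lc: "?l \<in> hom (fst \<rho>) (fst \<tau>)" and rc: "?r \<in> hom (fst \<rho>) (fst \<tau>)"
    using copsh_hm_closed[OF Y r pc(1)] copsh_hm_closed[OF X pc(2) s] s r by simp_all
  show "?r = ?l"
  proof (rule eq_by_lower[OF _ _ rc lc])
    fix w assume w: "w \<in> hom (fst \<rho>) (fst \<tau>)"
    have "w \<preceq>[fst \<rho>, fst \<tau>] ?l \<longleftrightarrow> (\<forall>y \<in> carrier Y.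
        Cmp Q (fst \<rho>) (fst \<tau>) (ty Y y) (coval (copsh_push Q X Y f \<tau>) y) w \<preceq>[fst \<rho>, ty Y y] coval \<rho> y)"
      using leq_copsh_hm_iff[OF Y r pc(1), of w] s w by simp
    also have "\<dots> \<longleftrightarrow> (\<forall>y \<in> carrier Y.
        coval (copsh_push Q X Y f \<tau>) y \<preceq>[fst \<tau>, ty Y y] res_left Q (fst \<rho>) (fst \<tau>) (ty Y y) (coval \<rho> y) w)"
      using s r w Y copsh_push_sel(2)[OF X Y f s] by (simp add: leq_res_left_iff)
    also have "\<dots> \<longleftrightarrow> (\<forall>y \<in> carrier Y. \<forall>x \<in> carrier X.
        Cmp Q (fst \<tau>) (ty X x) (ty Y y) (hm Y (f x) y) (coval \<tau> x)
          \<preceq>[fst \<tau>, ty Y y] res_left Q (fst \<rho>) (fst \<tau>) (ty Y y) (coval \<rho> y) w)"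
      using s r w Y copsh_push_sel(3)[OF X Y f s] by (simp add: res_left_closed)
    also have "\<dots> \<longleftrightarrow> (\<forall>y \<in> carrier Y. \<forall>x \<in> carrier X.
        Cmp Q (fst \<rho>) (ty X x) (ty Y y) (hm Y (f x) y) (Cmp Q (fst \<rho>) (fst \<tau>) (ty X x) (coval \<tau> x) w)
          \<preceq>[fst \<rho>, ty Y y] coval \<rho> y)"
    proof (intro ball_cong refl)
      fix x y assume x: "x \<in> carrier X" and y: "y \<in> carrier Y"
      have h: "hm Y (f x) y \<in> hom (ty X x) (ty Y y)" using hm_closed[of Y "f x" y] x y f Y by simp
      show "Cmp Q (fst \<tau>) (ty X x) (ty Y y) (hm Y (f x) y) (coval \<tau> x)
          \<preceq>[fst \<tau>, ty Y y] res_left Q (fst \<rho>) (fst \<tau>) (ty Y y) (coval \<rho> y) w \<longleftrightarrow>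
        Cmp Q (fst \<rho>) (ty X x) (ty Y y) (hm Y (f x) y) (Cmp Q (fst \<rho>) (fst \<tau>) (ty X x) (coval \<tau> x) w)
          \<preceq>[fst \<rho>, ty Y y] coval \<rho> y"
        using s r w x y h X Y cmp_assoc[of "fst \<rho>" "fst \<tau>" "ty X x" "ty Y y" w "coval \<tau> x" "hm Y (f x) y"]
        by (simp add: leq_res_left_iff cmp_closed)
    qed
    also have "\<dots> \<longleftrightarrow> (\<forall>x \<in> carrier X.
        Cmp Q (fst \<rho>) (fst \<tau>) (ty X x) (coval \<tau> x) w \<preceq>[fst \<rho>, ty X x] coval \<rho> (f x))" (is "?A \<longleftrightarrow> ?B")
    proof
      assume A: ?A
      show ?B
      proof
        fix x assume x: "x \<in> carrier X"
        let ?c = "Cmp Q (fst \<rho>) (fst \<tau>) (ty X x) (coval \<tau> x) w"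
        have "?c \<preceq>[fst \<rho>, ty X x] Cmp Q (fst \<rho>) (ty X x) (ty X x) (hm Y (f x) (f x)) ?c"
          using hm_refl[of Y "f x"] x s r w X Y f by (intro idn_cmp_mono_left) (simp_all add: cmp_closed)
        also have "\<dots> \<preceq>[fst \<rho>, ty X x] coval \<rho> (f x)" using bspec[OF bspec[OF A functor_closed[OF f x]] x] f x by simp
        finally show "?c \<preceq>[fst \<rho>, ty X x] coval \<rho> (f x)" .
      qed
    next
      assume B: ?B
      show ?A
      proof (intro ballI)
        fix x y assume x: "x \<in> carrier X" and y: "y \<in> carrier Y"
        have h: "hm Y (f x) y \<in> hom (ty X x) (ty Y y)" using hm_closed[of Y "f x" y] x y f Y by simp
        have "Cmp Q (fst \<rho>) (ty X x) (ty Y y) (hm Y (f x) y) (Cmp Q (fst \<rho>) (fst \<tau>) (ty X x) (coval \<tau> x) w)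
          \<preceq>[fst \<rho>, ty Y y] Cmp Q (fst \<rho>) (ty X x) (ty Y y) (hm Y (f x) y) (coval \<rho> (f x))"
          using B x y h X Y by (intro cmp_mono leq_refl) simp_all
        also have "\<dots> \<preceq>[fst \<rho>, ty Y y] coval \<rho> y"
          using coval_action[of Y \<rho> "f x" y] x y r f Y by simp
        finally show "Cmp Q (fst \<rho>) (ty X x) (ty Y y) (hm Y (f x) y) (Cmp Q (fst \<rho>) (fst \<tau>) (ty X x) (coval \<tau> x) w)
          \<preceq>[fst \<rho>, ty Y y] coval \<rho> y" .
      qed
    qed
    also have "\<dots> \<longleftrightarrow> w \<preceq>[fst \<rho>, fst \<tau>] ?r"
      using leq_copsh_hm_iff[OF X pc(2) s, of w] r w X Y f by simp
    finally show "w \<preceq>[fst \<rho>, fst \<tau>] ?r \<longleftrightarrow> w \<preceq>[fst \<rho>, fst \<tau>] ?l" by simp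
  qed (use s r in simp_all)
qed (use assms in \<open>simp_all add: copsh_push_closed copsh_pull_closed\<close>)


lemma psh_push_functor [simp]:
  "\<lbrakk>qcategory Q X; qcategory Q Y; f \<in> qfunctors Q X Y\<rbrakk> \<Longrightarrow>
    psh_push Q X Y f \<in> qfunctors Q (PSh Q X) (PSh Q Y)"
  using psh_push_pull_adj qadjD(1) by blast

lemma psh_pull_functor [simp]:
  "\<lbrakk>qcategory Q X; qcategory Q Y; f \<in> qfunctors Q X Y\<rbrakk> \<Longrightarrow>
    psh_pull Q X Y f \<in> qfunctors Q (PSh Q Y) (PSh Q X)"
  using psh_push_pull_adj qadjD(2) by blast

lemma copsh_push_functor [simp]:
  "\<lbrakk>qcategory Q X; qcategory Q Y; f \<in> qfunctors Q X Y\<rbrakk> \<Longrightarrow>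
    copsh_push Q X Y f \<in> qfunctors Q (CoPSh Q X) (CoPSh Q Y)"
  using copsh_pull_push_adj qadjD(2) by blast

lemma copsh_pull_functor [simp]:
  "\<lbrakk>qcategory Q X; qcategory Q Y; f \<in> qfunctors Q X Y\<rbrakk> \<Longrightarrow>
    copsh_pull Q X Y f \<in> qfunctors Q (CoPSh Q Y) (CoPSh Q X)"
  using copsh_pull_push_adj qadjD(1) by blast

lemmas psh_push_hm = psh_push_pull_adj[THEN qadjD(3)]
lemmas copsh_pull_hm = copsh_pull_push_adj[THEN qadjD(3)]

text \<open>
  Both sides have the same homs into every presheaf, namely its value at \<open>f x\<close>. The functoriality
  of images below is obtained in the same way from that of inverse images.
\<close>

lemma psh_push_yon:
  assumes "qcategory Q X" "qcategory Q Y" "f \<in> qfunctors Q X Y" "x \<in> carrier X"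
  shows "psh_push Q X Y f (yon X x) = yon Y (f x)"
  using assms psh_push_closed[of X Y f] psh_pull_closed[of X Y f]
  by (intro psh_eq_by_hm[of Y]) (simp_all add: psh_push_hm[of X Y f] yoneda)

lemma copsh_push_coyon:
  assumes "qcategory Q X" "qcategory Q Y" "f \<in> qfunctors Q X Y" "x \<in> carrier X"
  shows "copsh_push Q X Y f (coyon X x) = coyon Y (f x)"
  using assms copsh_push_closed[of X Y f] copsh_pull_closed[of X Y f]
  by (intro copsh_eq_by_hm[of Y]) (simp_all add: copsh_pull_hm[of X Y f, symmetric] coyoneda)

lemma copsh_pull_compose:
  assumes "qcategory Q X" "qcategory Q Y" "qcategory Q Z" "f \<in> qfunctors Q X Y" "g \<in> qfunctors Q Y Z"
    and "\<tau> \<in> carrier (CoPSh Q Z)"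
  shows "copsh_pull Q X Z (compose (carrier X) g f) \<tau> = copsh_pull Q X Y f (copsh_pull Q Y Z g \<tau>)"
  using assms functor_compose[OF assms(1-5)]
  by (intro copsh_eqI[of X]) (simp_all add: copsh_pull_closed compose_def[of _ g f])

lemma psh_pull_compose:
  assumes "qcategory Q X" "qcategory Q Y" "qcategory Q Z" "f \<in> qfunctors Q X Y" "g \<in> qfunctors Q Y Z"
    and "\<sigma> \<in> carrier (PSh Q Z)"
  shows "psh_pull Q X Z (compose (carrier X) g f) \<sigma> = psh_pull Q X Y f (psh_pull Q Y Z g \<sigma>)"
  using assms functor_compose[OF assms(1-5)]
  by (intro psh_eqI[of X]) (simp_all add: psh_pull_closed compose_def[of _ g f])

lemma psh_push_compose:
  assumes "qcategory Q X" "qcategory Q Y" "qcategory Q Z" "f \<in> qfunctors Q X Y" "g \<in> qfunctors Q Y Z"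
    and "\<sigma> \<in> carrier (PSh Q X)"
  shows "psh_push Q X Z (compose (carrier X) g f) \<sigma> = psh_push Q Y Z g (psh_push Q X Y f \<sigma>)"
  using assms functor_compose[OF assms(1-5)]
  by (intro psh_eq_by_hm[of Z])
    (simp_all add: psh_push_closed psh_pull_closed psh_push_hm psh_pull_compose)

lemma copsh_push_compose:
  assumes "qcategory Q X" "qcategory Q Y" "qcategory Q Z" "f \<in> qfunctors Q X Y" "g \<in> qfunctors Q Y Z"
    and "\<tau> \<in> carrier (CoPSh Q X)"
  shows "copsh_push Q X Z (compose (carrier X) g f) \<tau> = copsh_push Q Y Z g (copsh_push Q X Y f \<tau>)"
  using assms functor_compose[OF assms(1-5)]
  by (intro copsh_eq_by_hm[of Z])
    (simp_all add: copsh_push_closed copsh_pull_closed copsh_pull_hm[symmetric] copsh_pull_compose)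

lemma psh_push_id:
  assumes "qcategory Q X" "\<sigma> \<in> carrier (PSh Q X)"
  shows "psh_push Q X X (\<lambda>x \<in> carrier X. x) \<sigma> = \<sigma>"
proof (rule psh_eq_by_hm[OF assms(1)])
  fix \<rho> assume r: "\<rho> \<in> carrier (PSh Q X)"
  have "psh_pull Q X X (\<lambda>x \<in> carrier X. x) \<rho> = \<rho>"
    using assms r functor_id[of X] by (intro psh_eqI[of X]) (simp_all add: psh_pull_closed)
  then show "hm (PSh Q X) (psh_push Q X X (\<lambda>x \<in> carrier X. x) \<sigma>) \<rho> = hm (PSh Q X) \<sigma> \<rho>"
    using assms r functor_id[of X] by (simp add: psh_push_hm)
qed (use assms functor_id[of X] in \<open>simp_all add: psh_push_closed\<close>)

lemma copsh_push_id:
  assumes "qcategory Q X" "\<tau> \<in> carrier (CoPSh Q X)"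
  shows "copsh_push Q X X (\<lambda>x \<in> carrier X. x) \<tau> = \<tau>"
proof (rule copsh_eq_by_hm[OF assms(1)])
  fix \<rho> assume r: "\<rho> \<in> carrier (CoPSh Q X)"
  have "copsh_pull Q X X (\<lambda>x \<in> carrier X. x) \<rho> = \<rho>"
    using assms r functor_id[of X] by (intro copsh_eqI[of X]) (simp_all add: copsh_pull_closed)
  then show "hm (CoPSh Q X) \<rho> (copsh_push Q X X (\<lambda>x \<in> carrier X. x) \<tau>) = hm (CoPSh Q X) \<rho> \<tau>"
    using assms r functor_id[of X] by (simp add: copsh_pull_hm[symmetric])
qed (use assms functor_id[of X] in \<open>simp_all add: copsh_push_closed\<close>)

lemma psh_push_mono:
  assumes X: "qcategory Q X" and Y: "qcategory Q Y"
    and f: "f \<in> qfunctors Q X Y" and g: "g \<in> qfunctors Q X Y"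
    and le: "\<And>x. x \<in> carrier X \<Longrightarrow> f x \<lesssim>[Y] g x" and s: "\<sigma> \<in> carrier (PSh Q X)"
  shows "psh_push Q X Y f \<sigma> \<lesssim>[PSh Q Y] psh_push Q X Y g \<sigma>"
proof -
  note p = psh_push_closed[OF X Y g s]
  have "\<sigma> \<lesssim>[PSh Q X] psh_pull Q X Y g (psh_push Q X Y g \<sigma>)"
    using assms by (intro qadj_unit[OF _ _ psh_push_pull_adj]) simp_all
  also have "\<dots> \<lesssim>[PSh Q X] psh_pull Q X Y f (psh_push Q X Y g \<sigma>)"
    using assms p val_antimono[OF Y p le]
    by (subst psh_below_iff) (simp_all add: psh_pull_closed)
  finally show ?thesis using assms p by (subst qadj_below_iff[OF _ _ psh_push_pull_adj]) simp_all
qed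

lemma copsh_push_mono:
  assumes X: "qcategory Q X" and Y: "qcategory Q Y"
    and f: "f \<in> qfunctors Q X Y" and g: "g \<in> qfunctors Q X Y"
    and le: "\<And>x. x \<in> carrier X \<Longrightarrow> f x \<lesssim>[Y] g x" and s: "\<tau> \<in> carrier (CoPSh Q X)"
  shows "copsh_push Q X Y f \<tau> \<lesssim>[CoPSh Q Y] copsh_push Q X Y g \<tau>"
proof -
  note p = copsh_push_closed[OF X Y f s]
  have "copsh_pull Q X Y g (copsh_push Q X Y f \<tau>) \<lesssim>[CoPSh Q X] copsh_pull Q X Y f (copsh_push Q X Y f \<tau>)"
    using assms p coval_mono[OF Y p le]
    by (subst copsh_below_iff) (simp_all add: copsh_pull_closed)
  also have "\<dots> \<lesssim>[CoPSh Q X] \<tau>"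
    using assms by (intro qadj_counit[OF _ _ copsh_pull_push_adj]) simp_all
  finally show ?thesis using assms p by (subst qadj_below_iff[OF _ _ copsh_pull_push_adj, symmetric]) simp_all
qed

definition fully_faithful :: "('o, 'a, 'x) qcat \<Rightarrow> ('o, 'a, 'y) qcat \<Rightarrow> ('x \<Rightarrow> 'y) \<Rightarrow> bool" where
  "fully_faithful X Y f \<longleftrightarrow> f \<in> qfunctors Q X Y \<and>
    (\<forall>x \<in> carrier X. \<forall>x' \<in> carrier X. hm Y (f x) (f x') = hm X x x')"

lemma yon_fully_faithful: "qcategory Q X \<Longrightarrow> fully_faithful X (PSh Q X) (yon X)"
  by (simp add: fully_faithful_def yoneda)

text \<open>
  For a fully faithful \<open>f\<close> the image of \<open>\<sigma>\<close> at \<open>f x\<close> is the supremum of all \<open>\<sigma>(x') \<circ> 1(x, x')\<close>, which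
  \<open>\<sigma>\<close> absorbs: images extend presheaves.
\<close>

lemma psh_pull_push_fully_faithful:
  assumes X: "qcategory Q X" and Y: "qcategory Q Y" and ff: "fully_faithful X Y f"
    and s: "\<sigma> \<in> carrier (PSh Q X)"
  shows "psh_pull Q X Y f (psh_push Q X Y f \<sigma>) = \<sigma>"
proof (rule psh_antisym[OF X])
  have f: "f \<in> qfunctors Q X Y" using ff by (simp add: fully_faithful_def)
  note p = psh_push_closed[OF X Y f s]
  have "val (psh_push Q X Y f \<sigma>) (f x) \<preceq>[ty X x, fst \<sigma>] val \<sigma> x" if x: "x \<in> carrier X" for x
    using psh_push_sel(3)[OF X Y f s functor_closed[OF f x], of "val \<sigma> x"] ff X s x f
    by (simp add: fully_faithful_def val_action)
  then show "psh_pull Q X Y f (psh_push Q X Y f \<sigma>) \<lesssim>[PSh Q X] \<sigma>"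
    using X Y f s p by (subst psh_below_iff) (simp_all add: psh_pull_closed)
  show "\<sigma> \<lesssim>[PSh Q X] psh_pull Q X Y f (psh_push Q X Y f \<sigma>)"
    using X Y f s by (intro qadj_unit[OF _ _ psh_push_pull_adj]) simp_all
qed

lemma copsh_pull_push_fully_faithful:
  assumes X: "qcategory Q X" and Y: "qcategory Q Y" and ff: "fully_faithful X Y f"
    and s: "\<tau> \<in> carrier (CoPSh Q X)"
  shows "copsh_pull Q X Y f (copsh_push Q X Y f \<tau>) = \<tau>"
proof (rule copsh_antisym[OF X])
  have f: "f \<in> qfunctors Q X Y" using ff by (simp add: fully_faithful_def)
  note p = copsh_push_closed[OF X Y f s]
  have "coval (copsh_push Q X Y f \<tau>) (f x) \<preceq>[fst \<tau>, ty X x] coval \<tau> x" if x: "x \<in> carrier X" for x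
    using copsh_push_sel(3)[OF X Y f s functor_closed[OF f x], of "coval \<tau> x"] ff X s x f
    by (simp add: fully_faithful_def coval_action)
  then show "\<tau> \<lesssim>[CoPSh Q X] copsh_pull Q X Y f (copsh_push Q X Y f \<tau>)"
    using X Y f s p by (subst copsh_below_iff) (simp_all add: copsh_pull_closed)
  show "copsh_pull Q X Y f (copsh_push Q X Y f \<tau>) \<lesssim>[CoPSh Q X] \<tau>"
    using X Y f s by (intro qadj_counit[OF _ _ copsh_pull_push_adj]) simp_all
qed

lemma copsh_push_fully_faithful:
  assumes X: "qcategory Q X" and Y: "qcategory Q Y" and ff: "fully_faithful X Y f"
  shows "fully_faithful (CoPSh Q X) (CoPSh Q Y) (copsh_push Q X Y f)"
proof -
  have f: "f \<in> qfunctors Q X Y" using ff by (simp add: fully_faithful_def)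
  show ?thesis
    using assms f copsh_push_closed[OF X Y f] copsh_pull_push_fully_faithful[OF X Y ff]
    by (simp add: fully_faithful_def copsh_pull_hm[symmetric])
qed

lemma psh_mult_yon:
  assumes "qcategory Q X" "\<sigma> \<in> carrier (PSh Q X)"
  shows "psh_mult Q X (yon (PSh Q X) \<sigma>) = \<sigma>"
  using assms unfolding psh_mult_def
  by (intro psh_eqI[of X]) (simp_all add: psh_pull_closed yoneda)

lemma psh_mult_functor [simp]:
  "qcategory Q X \<Longrightarrow> psh_mult Q X \<in> qfunctors Q (PSh Q (PSh Q X)) (PSh Q X)"
  by (simp add: psh_mult_def)

section \<open>The double presheaf 2-monad\<close>

text \<open>
  The object part of the double presheaf 2-monad, spelled out so that everything known about
  presheaves applies to it.
\<close>

abbreviation TT :: "('o, 'a, 'x) qcat \<Rightarrow> ('o, 'a, ('o, 'a, 'x) dpsh) qcat" where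
  "TT X \<equiv> PSh Q (CoPSh Q X)"

lemma dp_map_functor [simp]:
  "\<lbrakk>qcategory Q X; qcategory Q Y; f \<in> qfunctors Q X Y\<rbrakk> \<Longrightarrow> dp_map Q X Y f \<in> qfunctors Q (TT X) (TT Y)"
  by (simp add: dp_map_def)

text \<open>
  In the general closure rule for functors the domain occurs only in a premise, where the
  simplifier cannot guess it. Hence closure is also stated for each functor that occurs nested.
\<close>

lemma dp_map_closed [simp]:
  "\<lbrakk>qcategory Q X; qcategory Q Y; f \<in> qfunctors Q X Y; \<sigma> \<in> carrier (TT X)\<rbrakk> \<Longrightarrow>
    dp_map Q X Y f \<sigma> \<in> carrier (TT Y)"
  by (simp add: dp_map_def)

lemma dp_map_fst [simp]: "\<sigma> \<in> carrier (TT X) \<Longrightarrow> fst (dp_map Q X Y f \<sigma>) = fst \<sigma>"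
  by (simp add: dp_map_def)

lemma dp_map_compose:
  assumes "qcategory Q X" "qcategory Q Y" "qcategory Q Z" "f \<in> qfunctors Q X Y" "g \<in> qfunctors Q Y Z"
    and "\<sigma> \<in> carrier (TT X)"
  shows "dp_map Q X Z (compose (carrier X) g f) \<sigma> = dp_map Q Y Z g (dp_map Q X Y f \<sigma>)"
proof -
  have "copsh_push Q X Z (compose (carrier X) g f)
      = compose (carrier (CoPSh Q X)) (copsh_push Q Y Z g) (copsh_push Q X Y f)"
    using assms functor_compose[OF assms(1-5)]
    by (intro functor_eqI[of _ "CoPSh Q X" "CoPSh Q Z"] functor_compose[of _ "CoPSh Q Y"])
      (simp_all add: copsh_push_compose, simp add: compose_def)
  then show ?thesis
    using assms by (simp add: dp_map_def psh_push_compose)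
qed

lemma dp_map_id:
  assumes "qcategory Q X" "\<sigma> \<in> carrier (TT X)"
  shows "dp_map Q X X (\<lambda>x \<in> carrier X. x) \<sigma> = \<sigma>"
proof -
  have "copsh_push Q X X (\<lambda>x \<in> carrier X. x) = (\<lambda>x \<in> carrier (CoPSh Q X). x)"
    using assms functor_id[of X] functor_id[of "CoPSh Q X"]
    by (intro functor_eqI[of _ "CoPSh Q X" "CoPSh Q X"]) (simp_all add: copsh_push_id)
  then show ?thesis using assms by (simp add: dp_map_def psh_push_id)
qed

lemma dp_map_mono:
  assumes "qcategory Q X" "qcategory Q Y" "f \<in> qfunctors Q X Y" "g \<in> qfunctors Q X Y"
    and "\<And>x. x \<in> carrier X \<Longrightarrow> f x \<lesssim>[Y] g x" and "\<sigma> \<in> carrier (TT X)"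
  shows "dp_map Q X Y f \<sigma> \<lesssim>[TT Y] dp_map Q X Y g \<sigma>"
  unfolding dp_map_def using assms by (intro psh_push_mono) (simp_all add: copsh_push_mono)

lemma dp_unit_apply: "x \<in> carrier X \<Longrightarrow> dp_unit Q X x = yon (CoPSh Q X) (coyon X x)"
  by (simp add: dp_unit_def compose_def)

lemma dp_unit_functor [simp]: "qcategory Q X \<Longrightarrow> dp_unit Q X \<in> qfunctors Q X (TT X)"
  unfolding dp_unit_def by (rule functor_compose[of _ "CoPSh Q X"]) simp_all

lemma dp_unit_closed [simp]:
  "\<lbrakk>qcategory Q X; x \<in> carrier X\<rbrakk> \<Longrightarrow> dp_unit Q X x \<in> carrier (TT X)"
  by (simp add: dp_unit_apply)

lemma dp_unit_natural:
  assumes "qcategory Q X" "qcategory Q Y" "f \<in> qfunctors Q X Y" "x \<in> carrier X"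
  shows "dp_map Q X Y f (dp_unit Q X x) = dp_unit Q Y (f x)"
  using assms by (simp add: dp_unit_apply dp_map_def psh_push_yon copsh_push_coyon)

text \<open>
  By naturality of the co-Yoneda embedding, the functor along which the multiplication pulls back
  sends a copresheaf \<open>U\<close> to \<open>{\<sigma> | U \<in> \<sigma>}\<close>, in the language of the two-valued case.
\<close>

lemma dp_mult_leg:
  assumes "qcategory Q X" "U \<in> carrier (CoPSh Q X)"
  shows "compose (carrier (CoPSh Q X)) (copsh_push Q (CoPSh Q X) (TT X) (yon (CoPSh Q X)))
      (coyon (CoPSh Q X)) U = coyon (TT X) (yon (CoPSh Q X) U)"
  using assms by (simp add: compose_def copsh_push_coyon)

lemma dp_mult_leg_functor:
  assumes "qcategory Q X"
  shows "compose (carrier (CoPSh Q X)) (copsh_push Q (CoPSh Q X) (TT X) (yon (CoPSh Q X)))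
      (coyon (CoPSh Q X)) \<in> qfunctors Q (CoPSh Q X) (CoPSh Q (TT X))"
  using assms by (intro functor_compose[of _ "CoPSh Q (CoPSh Q X)"]) simp_all

lemma dp_mult_functor [simp]:
  "qcategory Q X \<Longrightarrow> dp_mult Q X \<in> qfunctors Q (TT (TT X)) (TT X)"
  unfolding dp_mult_def DP_def by (intro psh_pull_functor dp_mult_leg_functor) simp_all

lemma dp_mult_closed [simp]:
  "\<lbrakk>qcategory Q X; \<Sigma> \<in> carrier (TT (TT X))\<rbrakk> \<Longrightarrow> dp_mult Q X \<Sigma> \<in> carrier (TT X)"
  by (rule functor_closed[OF dp_mult_functor])

lemma dp_mult_fst [simp]: "\<Sigma> \<in> carrier (TT (TT X)) \<Longrightarrow> fst (dp_mult Q X \<Sigma>) = fst \<Sigma>"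
  by (simp add: dp_mult_def DP_def)

lemma dp_mult_val:
  assumes "qcategory Q X" "\<Sigma> \<in> carrier (TT (TT X))" "U \<in> carrier (CoPSh Q X)"
  shows "val (dp_mult Q X \<Sigma>) U = val \<Sigma> (coyon (TT X) (yon (CoPSh Q X) U))"
  unfolding dp_mult_def DP_def using assms dp_mult_leg_functor[of X]
  by (simp add: dp_mult_leg)

text \<open>
  The mate of the commutative square \<open>sq\<close> between the functors along which the two multiplications pull
  back: transposing along the image adjunctions leaves only the counit of the one on the left.
\<close>

lemma dp_mult_natural:
  assumes X: "qcategory Q X" and Y: "qcategory Q Y" and f: "f \<in> qfunctors Q X Y"
    and S: "\<Sigma> \<in> carrier (TT (TT X))"
  shows "dp_map Q X Y f (dp_mult Q X \<Sigma>) \<lesssim>[TT Y] dp_mult Q Y (dp_map Q (TT X) (TT Y) (dp_map Q X Y f) \<Sigma>)"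
proof -
  let ?k = "\<lambda>X :: ('o, 'a, _) qcat. compose (carrier (CoPSh Q X))
    (copsh_push Q (CoPSh Q X) (TT X) (yon (CoPSh Q X))) (coyon (CoPSh Q X))"
  let ?kX = "?k X" and ?kY = "?k Y"
  let ?g = "copsh_push Q X Y f" and ?h = "copsh_push Q (TT X) (TT Y) (dp_map Q X Y f)"
  note kX = dp_mult_leg_functor[OF X] and kY = dp_mult_leg_functor[OF Y]
  have g: "?g \<in> qfunctors Q (CoPSh Q X) (CoPSh Q Y)"
    and h: "?h \<in> qfunctors Q (CoPSh Q (TT X)) (CoPSh Q (TT Y))" using X Y f by simp_all
  have sq: "compose (carrier (CoPSh Q X)) ?kY ?g = compose (carrier (CoPSh Q X)) ?h ?kX"
  proof (rule functor_eqI)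
    show "compose (carrier (CoPSh Q X)) ?kY ?g \<in> qfunctors Q (CoPSh Q X) (CoPSh Q (TT Y))"
      using X Y f kY g by (intro functor_compose[of _ "CoPSh Q Y"]) simp_all
    show "compose (carrier (CoPSh Q X)) ?h ?kX \<in> qfunctors Q (CoPSh Q X) (CoPSh Q (TT Y))"
      using X Y f kX h by (intro functor_compose[of _ "CoPSh Q (TT X)"]) simp_all
    fix U assume U: "U \<in> carrier (CoPSh Q X)"
    have gU: "?g U \<in> carrier (CoPSh Q Y)" using g U by simp
    have "compose (carrier (CoPSh Q X)) ?kY ?g U = coyon (TT Y) (yon (CoPSh Q Y) (?g U))"
      using U dp_mult_leg[OF Y gU] by (simp add: compose_def[of _ ?kY])
    also have "\<dots> = ?h (coyon (TT X) (yon (CoPSh Q X) U))"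
      using X Y f U by (simp add: copsh_push_coyon dp_map_def psh_push_yon)
    also have "\<dots> = compose (carrier (CoPSh Q X)) ?h ?kX U"
      using U dp_mult_leg[OF X U] by (simp add: compose_def[of _ ?h])
    finally show "compose (carrier (CoPSh Q X)) ?kY ?g U = compose (carrier (CoPSh Q X)) ?h ?kX U" .
  qed
  let ?a = "psh_pull Q (CoPSh Q X) (CoPSh Q (TT X)) ?kX \<Sigma>"
  have a: "?a \<in> carrier (TT X)" using X S kX by (intro psh_pull_closed) simp_all
  have c: "psh_push Q (CoPSh Q X) (CoPSh Q (TT X)) ?kX ?a \<lesssim>[TT (TT X)] \<Sigma>"
    using X S kX by (intro qadj_counit[OF _ _ psh_push_pull_adj]) simp_all
  have "psh_push Q (CoPSh Q Y) (CoPSh Q (TT Y)) ?kY (psh_push Q (CoPSh Q X) (CoPSh Q Y) ?g ?a)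
    = psh_push Q (CoPSh Q X) (CoPSh Q (TT Y)) (compose (carrier (CoPSh Q X)) ?kY ?g) ?a"
    using X Y g kY a by (intro psh_push_compose[symmetric]) simp_all
  also have "\<dots> = psh_push Q (CoPSh Q (TT X)) (CoPSh Q (TT Y)) ?h (psh_push Q (CoPSh Q X) (CoPSh Q (TT X)) ?kX ?a)"
    unfolding sq using X Y h kX a by (intro psh_push_compose) simp_all
  finally have "psh_push Q (CoPSh Q Y) (CoPSh Q (TT Y)) ?kY (psh_push Q (CoPSh Q X) (CoPSh Q Y) ?g ?a)
    \<lesssim>[TT (TT Y)] psh_push Q (CoPSh Q (TT X)) (CoPSh Q (TT Y)) ?h \<Sigma>"
    using functor_below[OF _ _ c, of "TT (TT Y)" "psh_push Q (CoPSh Q (TT X)) (CoPSh Q (TT Y)) ?h"] X Y h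
    by simp
  then have "psh_push Q (CoPSh Q X) (CoPSh Q Y) ?g ?a \<lesssim>[TT Y]
    psh_pull Q (CoPSh Q Y) (CoPSh Q (TT Y)) ?kY (psh_push Q (CoPSh Q (TT X)) (CoPSh Q (TT Y)) ?h \<Sigma>)"
    by (subst (asm) qadj_below_iff[OF _ _ psh_push_pull_adj])
      (use X Y g h kY a S in \<open>simp_all add: psh_push_closed\<close>)
  then show ?thesis by (simp add: dp_mult_def dp_map_def DP_def)
qed


section \<open>The right adjoint of the image of the Yoneda embedding\<close>

text \<open>
  The functor \<open>((y\<^sub>X)\<^sub>\<exclamdown>)\<^sup>!\<close>. It is right adjoint to the image of \<open>y\<^sub>X\<close> under the double presheaf 2-functor
  \<open>T\<close>, and the inequalities of the distributive law are proved by transposing along this adjunction.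
\<close>

definition yon_radj ::
    "('o, 'a, 'x) qcat \<Rightarrow> ('o, 'a, ('o, 'a, 'x) psh) dpsh \<Rightarrow> ('o, 'a, 'x) dpsh" where
  "yon_radj X = psh_pull Q (CoPSh Q X) (CoPSh Q (PSh Q X)) (copsh_push Q X (PSh Q X) (yon X))"

lemma dp_yon_adj:
  "qcategory Q X \<Longrightarrow> qadj (TT X) (TT (PSh Q X)) (dp_map Q X (PSh Q X) (yon X)) (yon_radj X)"
  unfolding dp_map_def yon_radj_def by (intro psh_push_pull_adj) simp_all

lemma yon_radj_functor [simp]:
  "qcategory Q X \<Longrightarrow> yon_radj X \<in> qfunctors Q (TT (PSh Q X)) (TT X)"
  using dp_yon_adj qadjD(2) by blast

lemma yon_radj_closed [simp]:
  "\<lbrakk>qcategory Q X; \<Sigma> \<in> carrier (TT (PSh Q X))\<rbrakk> \<Longrightarrow> yon_radj X \<Sigma> \<in> carrier (TT X)"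
  by (rule functor_closed[OF yon_radj_functor])

lemma yon_radj_fst [simp]:
  "\<Sigma> \<in> carrier (TT (PSh Q X)) \<Longrightarrow> fst (yon_radj X \<Sigma>) = fst \<Sigma>"
  by (simp add: yon_radj_def)

lemma yon_radj_dp_yon:
  "\<lbrakk>qcategory Q X; \<sigma> \<in> carrier (TT X)\<rbrakk> \<Longrightarrow> yon_radj X (dp_map Q X (PSh Q X) (yon X) \<sigma>) = \<sigma>"
  unfolding dp_map_def yon_radj_def
  by (intro psh_pull_push_fully_faithful copsh_push_fully_faithful yon_fully_faithful) simp_all

lemma dp_yon_radj_below:
  "\<lbrakk>qcategory Q X; \<Sigma> \<in> carrier (TT (PSh Q X))\<rbrakk> \<Longrightarrow>
    dp_map Q X (PSh Q X) (yon X) (yon_radj X \<Sigma>) \<lesssim>[TT (PSh Q X)] \<Sigma>"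
  by (intro qadj_counit[OF _ _ dp_yon_adj]) simp_all

lemma dp_yon_natural:
  assumes X: "qcategory Q X" and Y: "qcategory Q Y" and f: "f \<in> qfunctors Q X Y"
    and s: "\<sigma> \<in> carrier (TT X)"
  shows "dp_map Q Y (PSh Q Y) (yon Y) (dp_map Q X Y f \<sigma>)
    = dp_map Q (PSh Q X) (PSh Q Y) (psh_push Q X Y f) (dp_map Q X (PSh Q X) (yon X) \<sigma>)"
proof -
  have "compose (carrier X) (yon Y) f = compose (carrier X) (psh_push Q X Y f) (yon X)"
    unfolding compose_def using X Y f by (intro restrict_ext) (simp add: psh_push_yon)
  then show ?thesis
    using X Y f s dp_map_compose[of X Y "PSh Q Y" f "yon Y" \<sigma>]
      dp_map_compose[of X "PSh Q X" "PSh Q Y" "yon X" "psh_push Q X Y f" \<sigma>] by simp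
qed

text \<open>
  The value of \<open>\<Lambda>\<^sub>X\<close> at \<open>\<Sigma>\<close> is \<open>t \<mapsto> 1(T y\<^sub>X (t), \<Sigma>)\<close>, which the adjunction turns into the presheaf
  represented by \<open>yon_radj X \<Sigma>\<close>.
\<close>

lemma Lambda_apply:
  assumes X: "qcategory Q X" and S: "\<Sigma> \<in> carrier (TT (PSh Q X))"
  shows "Lambda Q X \<Sigma> = yon (TT X) (yon_radj X \<Sigma>)"
proof -
  have "graph (TT X) (TT (PSh Q X)) (dp_map Q X (PSh Q X) (yon X)) t \<Sigma> = hm (TT X) t (yon_radj X \<Sigma>)"
    if "t \<in> carrier (TT X)" for t
    using that S qadjD(3)[OF dp_yon_adj[OF X]] by (simp add: graph_def)
  then show ?thesis
    using X S by (simp add: Lambda_def curry_dist_def yon_def DP_def cong: restrict_cong)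
qed

lemma Lambda_eq:
  assumes X: "qcategory Q X"
  shows "Lambda Q X = compose (carrier (TT (PSh Q X))) (yon (TT X)) (yon_radj X)"
proof
  fix \<Sigma> show "Lambda Q X \<Sigma> = compose (carrier (TT (PSh Q X))) (yon (TT X)) (yon_radj X) \<Sigma>"
    using Lambda_apply[OF X, of \<Sigma>]
    by (cases "\<Sigma> \<in> carrier (TT (PSh Q X))")
      (simp_all add: compose_def Lambda_def curry_dist_def DP_def)
qed

lemma Lambda_functor [simp]:
  "qcategory Q X \<Longrightarrow> Lambda Q X \<in> qfunctors Q (TT (PSh Q X)) (PSh Q (TT X))"
  unfolding Lambda_eq by (intro functor_compose[of _ "TT X"]) simp_all

section \<open>The distributive law\<close>

text \<open>
  The mate of the naturality square of the Yoneda embedding under \<open>T\<close>.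
\<close>

lemma yon_radj_natural:
  assumes X: "qcategory Q X" and Y: "qcategory Q Y" and f: "f \<in> qfunctors Q X Y"
    and S: "\<Sigma> \<in> carrier (TT (PSh Q X))"
  shows "dp_map Q X Y f (yon_radj X \<Sigma>) \<lesssim>[TT Y]
    yon_radj Y (dp_map Q (PSh Q X) (PSh Q Y) (psh_push Q X Y f) \<Sigma>)"
proof -
  have "dp_map Q Y (PSh Q Y) (yon Y) (dp_map Q X Y f (yon_radj X \<Sigma>))
    = dp_map Q (PSh Q X) (PSh Q Y) (psh_push Q X Y f) (dp_map Q X (PSh Q X) (yon X) (yon_radj X \<Sigma>))"
    using X Y f S by (intro dp_yon_natural) simp_all
  also have "\<dots> \<lesssim>[TT (PSh Q Y)] dp_map Q (PSh Q X) (PSh Q Y) (psh_push Q X Y f) \<Sigma>"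
    using X Y f S by (intro functor_below[OF _ _ dp_yon_radj_below]) simp_all
  finally show ?thesis
    by (subst qadj_below_iff[OF _ _ dp_yon_adj, symmetric])
      (use X Y f S in simp_all)
qed

text \<open>
  Let \<open>M\<close> be the right adjoint of \<open>T y\<^bsub>PX\<^esub>\<close>. As \<open>s\<^sub>X \<cdot> y\<^bsub>PX\<^esub> = 1\<close>, one has
  \<open>M = T s\<^sub>X \<cdot> T y\<^bsub>PX\<^esub> \<cdot> M \<le> T s\<^sub>X\<close>.
\<close>

lemma yon_radj_psh_mult:
  assumes X: "qcategory Q X" and S: "\<Sigma> \<in> carrier (TT (PSh Q (PSh Q X)))"
  shows "yon_radj (PSh Q X) \<Sigma> \<lesssim>[TT (PSh Q X)] dp_map Q (PSh Q (PSh Q X)) (PSh Q X) (psh_mult Q X) \<Sigma>"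
proof -
  let ?M = "yon_radj (PSh Q X) \<Sigma>" and ?s = "dp_map Q (PSh Q (PSh Q X)) (PSh Q X) (psh_mult Q X)"
  have M: "?M \<in> carrier (TT (PSh Q X))"
    using S X by simp
  have "compose (carrier (PSh Q X)) (psh_mult Q X) (yon (PSh Q X)) = (\<lambda>x \<in> carrier (PSh Q X). x)"
    unfolding compose_def using X by (intro restrict_ext) (simp add: psh_mult_yon)
  then have "?M = ?s (dp_map Q (PSh Q X) (PSh Q (PSh Q X)) (yon (PSh Q X)) ?M)"
    using X M dp_map_compose[of "PSh Q X" "PSh Q (PSh Q X)" "PSh Q X" "yon (PSh Q X)" "psh_mult Q X" ?M]
    by (simp add: dp_map_id)
  also have "\<dots> \<lesssim>[TT (PSh Q X)] ?s \<Sigma>"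
    using X S by (intro functor_below[OF _ _ dp_yon_radj_below]) simp_all
  finally show ?thesis .
qed

text \<open>
  Transposed along the image adjunction, the claim says that \<open>\<sigma>(x) \<preceq> 1(h x, g \<sigma>)\<close>; by the Yoneda
  lemma \<open>\<sigma>(x)\<close> is the hom from \<open>y(x)\<close> to \<open>\<sigma>\<close>, which \<open>g\<close> maps into the hom from \<open>g (y(x))\<close> to \<open>g \<sigma>\<close>.
\<close>

lemma psh_push_below_yon:
  assumes X: "qcategory Q X" and Z: "qcategory Q Z"
    and h: "h \<in> qfunctors Q X Z" and g: "g \<in> qfunctors Q (PSh Q X) Z"
    and le: "\<And>x. x \<in> carrier X \<Longrightarrow> h x \<lesssim>[Z] g (yon X x)" and s: "\<sigma> \<in> carrier (PSh Q X)"
  shows "psh_push Q X Z h \<sigma> \<lesssim>[PSh Q Z] yon Z (g \<sigma>)"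
proof -
  have gs: "g \<sigma> \<in> carrier Z" "ty Z (g \<sigma>) = fst \<sigma>" using g s by simp_all
  have y: "yon Z (g \<sigma>) \<in> carrier (PSh Q Z)" using Z gs by simp
  have "val \<sigma> x \<preceq>[ty X x, fst \<sigma>] hm Z (h x) (g \<sigma>)" if x: "x \<in> carrier X" for x
  proof -
    have "val \<sigma> x \<preceq>[ty X x, fst \<sigma>] hm Z (g (yon X x)) (g \<sigma>)"
      using functor_hm[of "PSh Q X" Z g "yon X x" \<sigma>] X Z g s x by (simp add: yoneda)
    also have "\<dots> \<preceq>[ty X x, fst \<sigma>] hm Z (h x) (g \<sigma>)"
      using below_hm_left[OF le[OF x] gs(1)] gs X g x by simp
    finally show ?thesis .
  qed
  then have "\<sigma> \<lesssim>[PSh Q X] psh_pull Q X Z h (yon Z (g \<sigma>))"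
    using X Z h gs y s by (subst psh_below_iff) (simp_all add: psh_pull_closed)
  then show ?thesis using X Z h y s by (subst qadj_below_iff[OF _ _ psh_push_pull_adj]) simp_all
qed

text \<open>
  With \<open>M\<close> the right adjoint of \<open>T y\<^sub>X\<close>, naturality of the multiplication and the counit give
  \<open>T y\<^sub>X \<cdot> m\<^sub>X \<cdot> T M \<le> m\<^bsub>PX\<^esub> \<cdot> T (T y\<^sub>X \<cdot> M) \<le> m\<^bsub>PX\<^esub>\<close>, and this transposes to the claim.
\<close>

lemma yon_radj_dp_mult:
  assumes X: "qcategory Q X" and S: "\<Sigma> \<in> carrier (TT (TT (PSh Q X)))"
  shows "dp_mult Q X (dp_map Q (TT (PSh Q X)) (TT X) (yon_radj X) \<Sigma>) \<lesssim>[TT X]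
    yon_radj X (dp_mult Q (PSh Q X) \<Sigma>)"
proof -
  let ?y = "dp_map Q X (PSh Q X) (yon X)"
  let ?M = "dp_map Q (TT (PSh Q X)) (TT X) (yon_radj X) \<Sigma>"
  have M: "?M \<in> carrier (TT (TT X))"
    using X S by simp
  have mM: "dp_mult Q X ?M \<in> carrier (TT X)" using X M by simp
  have mS: "dp_mult Q (PSh Q X) \<Sigma> \<in> carrier (TT (PSh Q X))"
    using X S by simp
  have "?y (dp_mult Q X ?M) \<lesssim>[TT (PSh Q X)]
      dp_mult Q (PSh Q X) (dp_map Q (TT X) (TT (PSh Q X)) ?y ?M)"
    using X M by (intro dp_mult_natural) simp_all
  also have "\<dots> \<lesssim>[TT (PSh Q X)] dp_mult Q (PSh Q X) \<Sigma>"
  proof (rule functor_below[of _ _ "TT (TT (PSh Q X))"])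
    have "dp_map Q (TT X) (TT (PSh Q X)) ?y ?M
      = dp_map Q (TT (PSh Q X)) (TT (PSh Q X)) (compose (carrier (TT (PSh Q X))) ?y (yon_radj X)) \<Sigma>"
      using X S by (intro dp_map_compose[symmetric]) simp_all
    also have "\<dots> \<lesssim>[TT (TT (PSh Q X))]
        dp_map Q (TT (PSh Q X)) (TT (PSh Q X)) (\<lambda>x \<in> carrier (TT (PSh Q X)). x) \<Sigma>"
    proof (rule dp_map_mono)
      show "compose (carrier (TT (PSh Q X))) ?y (yon_radj X) \<in> qfunctors Q (TT (PSh Q X)) (TT (PSh Q X))"
        using X by (intro functor_compose[of _ "TT X"]) simp_all
      show "compose (carrier (TT (PSh Q X))) ?y (yon_radj X) x
          \<lesssim>[TT (PSh Q X)] (\<lambda>x \<in> carrier (TT (PSh Q X)). x) x" if "x \<in> carrier (TT (PSh Q X))" for x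
        using dp_yon_radj_below[OF X that] that by (simp add: compose_def)
    qed (use X S functor_id[of "TT (PSh Q X)"] in simp_all)
    also have "\<dots> = \<Sigma>" using X S by (intro dp_map_id) simp_all
    finally show "dp_map Q (TT X) (TT (PSh Q X)) ?y ?M \<lesssim>[TT (TT (PSh Q X))] \<Sigma>" .
  qed (use X in simp_all)
  finally show ?thesis
    by (subst qadj_below_iff[OF _ _ dp_yon_adj, symmetric]) (use X mM mS in simp_all)
qed

lemma Lambda_flat:
  assumes X: "qcategory Q X"
  shows "yon (DP Q X) = compose (carrier (DP Q X)) (Lambda Q X) (dp_map Q X (PSh Q X) (yon X))"
proof -
  have "yon (TT X) \<sigma> = Lambda Q X (dp_map Q X (PSh Q X) (yon X) \<sigma>)" if s: "\<sigma> \<in> carrier (TT X)" for \<sigma>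
    using X s
    by (simp add: Lambda_apply yon_radj_dp_yon)
  then show ?thesis
    unfolding compose_def DP_def by (subst yon_def) (intro restrict_ext, simp add: yon_def)
qed

text \<open>
  The components of \<open>\<Lambda>\<close> have representable values, on which images and \<open>s\<close> act by evaluation. So
  each axiom is reduced to an inequality between functors into \<open>T X\<close>.
\<close>

theorem Lambda_distributive_law:
  "distributive_law Q (Lambda Q :: ('o, 'a, 'x) law) (Lambda Q) (Lambda Q)"
  unfolding distributive_law_def DP_def
proof (intro conjI allI impI fun_leI)
  fix X Y :: "('o, 'a, 'x) qcat" and f \<Sigma>
  assume X: "qcategory Q X" and Y: "qcategory Q Y" and f: "f \<in> qfunctors Q X Y"
    and S: "\<Sigma> \<in> carrier (TT (PSh Q X))"
  let ?T = "dp_map Q (PSh Q X) (PSh Q Y) (psh_push Q X Y f)"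
  have M: "yon_radj X \<Sigma> \<in> carrier (TT X)" and T: "?T \<Sigma> \<in> carrier (TT (PSh Q Y))"
    using X Y f S by simp_all
  show "compose (carrier (TT (PSh Q X))) (psh_push Q (TT X) (TT Y) (dp_map Q X Y f)) (Lambda Q X) \<Sigma>
    \<lesssim>[PSh Q (TT Y)] compose (carrier (TT (PSh Q X))) (Lambda Q Y) ?T \<Sigma>"
    using X Y f S M T yon_below[OF _ yon_radj_natural[OF X Y f S]]
    by (simp add: compose_def Lambda_apply psh_push_yon)
next
  fix X :: "('o, 'a, 'x) qcat" and \<sigma> assume X: "qcategory Q X" and s: "\<sigma> \<in> carrier (TT X)"
  show "yon (TT X) \<sigma> \<lesssim>[PSh Q (TT X)]
      compose (carrier (TT X)) (Lambda Q X) (dp_map Q X (PSh Q X) (yon X)) \<sigma>"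
    using X s by (subst Lambda_flat[OF X, unfolded DP_def, symmetric]) (simp add: below_refl)
next
  fix X :: "('o, 'a, 'x) qcat" and \<Sigma>
  assume X: "qcategory Q X" and S: "\<Sigma> \<in> carrier (TT (PSh Q (PSh Q X)))"
  let ?s = "dp_map Q (PSh Q (PSh Q X)) (PSh Q X) (psh_mult Q X)"
  have M: "yon_radj (PSh Q X) \<Sigma> \<in> carrier (TT (PSh Q X))" and T: "?s \<Sigma> \<in> carrier (TT (PSh Q X))"
    using X S by simp_all
  have MM: "yon_radj X (yon_radj (PSh Q X) \<Sigma>) \<in> carrier (TT X)"
    using X M by simp
  have "yon_radj X (yon_radj (PSh Q X) \<Sigma>) \<lesssim>[TT X] yon_radj X (?s \<Sigma>)"
    using X by (intro functor_below[OF _ _ yon_radj_psh_mult[OF X S]]) simp_all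
  then show "compose (carrier (TT (PSh Q (PSh Q X)))) (psh_mult Q (TT X))
      (compose (carrier (TT (PSh Q (PSh Q X))))
        (psh_push Q (TT (PSh Q X)) (PSh Q (TT X)) (Lambda Q X)) (Lambda Q (PSh Q X))) \<Sigma>
    \<lesssim>[PSh Q (TT X)] compose (carrier (TT (PSh Q (PSh Q X)))) (Lambda Q X) ?s \<Sigma>"
    using X S M T MM yon_below[of "TT X"]
    by (simp add: compose_def Lambda_apply psh_push_yon psh_mult_yon)
next
  fix X :: "('o, 'a, 'x) qcat" and \<sigma> assume X: "qcategory Q X" and s: "\<sigma> \<in> carrier (PSh Q X)"
  let ?g = "compose (carrier (PSh Q X)) (yon_radj X) (dp_unit Q (PSh Q X))"
  have g: "?g \<in> qfunctors Q (PSh Q X) (TT X)"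
    using X by (intro functor_compose[of _ "TT (PSh Q X)"]) simp_all
  have "dp_unit Q X x \<lesssim>[TT X] ?g (yon X x)" if x: "x \<in> carrier X" for x
  proof -
    have u: "dp_unit Q X x \<in> carrier (TT X)" using X x by simp
    have "?g (yon X x) = yon_radj X (dp_map Q X (PSh Q X) (yon X) (dp_unit Q X x))"
      using X x by (simp add: compose_def dp_unit_natural)
    also have "\<dots> = dp_unit Q X x" using X u by (simp add: yon_radj_dp_yon)
    finally show ?thesis using X u by (simp add: below_refl)
  qed
  then have "psh_push Q X (TT X) (dp_unit Q X) \<sigma> \<lesssim>[PSh Q (TT X)] yon (TT X) (?g \<sigma>)"
    using X s g by (intro psh_push_below_yon) simp_all
  then show "psh_push Q X (TT X) (dp_unit Q X) \<sigma>
    \<lesssim>[PSh Q (TT X)] compose (carrier (PSh Q X)) (Lambda Q X) (dp_unit Q (PSh Q X)) \<sigma>"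
    using X s by (simp add: compose_def Lambda_apply)
next
  fix X :: "('o, 'a, 'x) qcat" and \<Sigma>
  assume X: "qcategory Q X" and S: "\<Sigma> \<in> carrier (TT (TT (PSh Q X)))"
  let ?L = "dp_map Q (TT (PSh Q X)) (PSh Q (TT X)) (Lambda Q X) \<Sigma>"
  let ?M = "dp_map Q (TT (PSh Q X)) (TT X) (yon_radj X) \<Sigma>"
  have M: "?M \<in> carrier (TT (TT X))" and L: "?L \<in> carrier (TT (PSh Q (TT X)))"
    using X S by simp_all
  have mS: "dp_mult Q (PSh Q X) \<Sigma> \<in> carrier (TT (PSh Q X))"
    using X S by simp
  have "?L = dp_map Q (TT X) (PSh Q (TT X)) (yon (TT X)) ?M"
    unfolding Lambda_eq[OF X] using X S by (intro dp_map_compose) simp_all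
  then have "yon_radj (TT X) ?L = ?M" using X M by (simp add: yon_radj_dp_yon)
  then show "compose (carrier (TT (TT (PSh Q X)))) (psh_push Q (TT (TT X)) (TT X) (dp_mult Q X))
      (compose (carrier (TT (TT (PSh Q X)))) (Lambda Q (TT X))
        (dp_map Q (TT (PSh Q X)) (PSh Q (TT X)) (Lambda Q X))) \<Sigma>
    \<lesssim>[PSh Q (TT X)] compose (carrier (TT (TT (PSh Q X)))) (Lambda Q X) (dp_mult Q (PSh Q X)) \<Sigma>"
    using X S M L mS yon_below[OF _ yon_radj_dp_mult[OF X S]]
    by (simp add: compose_def Lambda_apply psh_push_yon)
qed simp

section \<open>Transposition of distributors\<close>

text \<open>
  A distributor from \<open>A\<close> to \<open>X\<close> can be read as a functor from \<open>A\<close> to copresheaves on \<open>X\<close> or as a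
  functor from \<open>X\<close> to presheaves on \<open>A\<close>; these are the passages between the two readings.
\<close>

definition dist_psh ::
    "('o, 'a, 'y) qcat \<Rightarrow> ('o, 'a, 'x) qcat \<Rightarrow> ('y \<Rightarrow> ('o, 'a, 'x) copsh) \<Rightarrow> 'x \<Rightarrow> ('o, 'a, 'y) psh" where
  "dist_psh A X c = (\<lambda>x \<in> carrier X. (ty X x, \<lambda>a \<in> carrier A. \<lambda>_. coval (c a) x))"

definition dist_copsh ::
    "('o, 'a, 'y) qcat \<Rightarrow> ('o, 'a, 'x) qcat \<Rightarrow> ('x \<Rightarrow> ('o, 'a, 'y) psh) \<Rightarrow> 'y \<Rightarrow> ('o, 'a, 'x) copsh" where
  "dist_copsh A X \<nu> = (\<lambda>a \<in> carrier A. (ty A a, \<lambda>_. \<lambda>x \<in> carrier X. val (\<nu> x) a))"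

lemma dist_psh_sel [simp]:
  assumes "x \<in> carrier X"
  shows "fst (dist_psh A X c x) = ty X x" "a \<in> carrier A \<Longrightarrow> val (dist_psh A X c x) a = coval (c a) x"
  using assms by (simp_all add: dist_psh_def)

lemma dist_copsh_sel [simp]:
  assumes "a \<in> carrier A"
  shows "fst (dist_copsh A X \<nu> a) = ty A a" "x \<in> carrier X \<Longrightarrow> coval (dist_copsh A X \<nu> a) x = val (\<nu> x) a"
  using assms by (simp_all add: dist_copsh_def)

lemma functor_fst [simp]:
  "\<lbrakk>c \<in> qfunctors Q A (CoPSh Q X); a \<in> carrier A\<rbrakk> \<Longrightarrow> fst (c a) = ty A a"
  "\<lbrakk>\<nu> \<in> qfunctors Q A (PSh Q X); a \<in> carrier A\<rbrakk> \<Longrightarrow> fst (\<nu> a) = ty A a"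
  using functor_ty functor_closed copsh_ty psh_ty by metis+

lemma dist_psh_functor [simp]:
  assumes A: "qcategory Q A" and X: "qcategory Q X" and c: "c \<in> qfunctors Q A (CoPSh Q X)"
  shows "dist_psh A X c \<in> qfunctors Q X (PSh Q A)"
proof -
  have v: "coval (c a) x \<in> hom (ty A a) (ty X x)" if "a \<in> carrier A" "x \<in> carrier X" for a x
    using coval_closed[OF X functor_closed[OF c that(1)] that(2)] c that by simp
  have closed: "dist_psh A X c x \<in> carrier (PSh Q A)" if x: "x \<in> carrier X" for x
  proof -
    have "Cmp Q (ty A a') (ty A a) (ty X x) (coval (c a) x) (hm A a' a) \<preceq>[ty A a', ty X x] coval (c a') x"
      if a: "a \<in> carrier A" "a' \<in> carrier A" for a a'
    proof -
      have "Cmp Q (ty A a') (ty A a) (ty X x) (coval (c a) x) (hm A a' a)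
        \<preceq>[ty A a', ty X x] Cmp Q (ty A a') (ty A a) (ty X x) (coval (c a) x) (hm (CoPSh Q X) (c a') (c a))"
        using A X c a x v by (intro cmp_mono leq_refl functor_hm) simp_all
      also have "\<dots> \<preceq>[ty A a', ty X x] coval (c a') x"
        using copsh_hm_action[OF X functor_closed[OF c a(2)] functor_closed[OF c a(1)] x] c a by simp
      finally show ?thesis .
    qed
    then show ?thesis unfolding dist_psh_def using A X x v by (simp add: pshI)
  qed
  show ?thesis
  proof (rule qfunctorI)
    show "dist_psh A X c \<in> carrier X \<rightarrow>\<^sub>E carrier (PSh Q A)"
      using closed by (auto simp: dist_psh_def)
    fix x x' assume x: "x \<in> carrier X" "x' \<in> carrier X"
    show "hm X x x' \<preceq>[ty X x, ty X x'] hm (PSh Q A) (dist_psh A X c x) (dist_psh A X c x')"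
      using leq_psh_hm_iff[OF A closed[OF x(1)] closed[OF x(2)], of "hm X x x'"] X x c
        coval_action[OF X functor_closed[OF c] x] by simp
  qed (use closed in simp)
qed

lemma dist_copsh_functor [simp]:
  assumes A: "qcategory Q A" and X: "qcategory Q X" and n: "\<nu> \<in> qfunctors Q X (PSh Q A)"
  shows "dist_copsh A X \<nu> \<in> qfunctors Q A (CoPSh Q X)"
proof -
  have v: "val (\<nu> x) a \<in> hom (ty A a) (ty X x)" if "a \<in> carrier A" "x \<in> carrier X" for a x
    using val_closed[OF A functor_closed[OF n that(2)] that(1)] n that by simp
  have closed: "dist_copsh A X \<nu> a \<in> carrier (CoPSh Q X)" if a: "a \<in> carrier A" for a
  proof -
    have "Cmp Q (ty A a) (ty X x) (ty X x') (hm X x x') (val (\<nu> x) a) \<preceq>[ty A a, ty X x'] val (\<nu> x') a"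
      if x: "x \<in> carrier X" "x' \<in> carrier X" for x x'
    proof -
      have "Cmp Q (ty A a) (ty X x) (ty X x') (hm X x x') (val (\<nu> x) a)
        \<preceq>[ty A a, ty X x'] Cmp Q (ty A a) (ty X x) (ty X x') (hm (PSh Q A) (\<nu> x) (\<nu> x')) (val (\<nu> x) a)"
        using A X n a x v by (intro cmp_mono leq_refl functor_hm) simp_all
      also have "\<dots> \<preceq>[ty A a, ty X x'] val (\<nu> x') a"
        using psh_hm_action[OF A functor_closed[OF n x(1)] functor_closed[OF n x(2)] a] n x by simp
      finally show ?thesis .
    qed
    then show ?thesis unfolding dist_copsh_def using A X a v by (simp add: copshI)
  qed
  show ?thesis
  proof (rule qfunctorI)
    show "dist_copsh A X \<nu> \<in> carrier A \<rightarrow>\<^sub>E carrier (CoPSh Q X)"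
      using closed by (auto simp: dist_copsh_def)
    fix a a' assume a: "a \<in> carrier A" "a' \<in> carrier A"
    show "hm A a a' \<preceq>[ty A a, ty A a'] hm (CoPSh Q X) (dist_copsh A X \<nu> a) (dist_copsh A X \<nu> a')"
      using leq_copsh_hm_iff[OF X closed[OF a(1)] closed[OF a(2)], of "hm A a a'"] A a n
        val_action[OF A functor_closed[OF n] a(2,1)] by simp
  qed (use closed in simp)
qed

lemma dist_copsh_psh:
  assumes A: "qcategory Q A" and X: "qcategory Q X" and c: "c \<in> qfunctors Q A (CoPSh Q X)"
  shows "dist_copsh A X (dist_psh A X c) = c"
proof (rule functor_eqI[OF _ c])
  fix a assume a: "a \<in> carrier A"
  show "dist_copsh A X (dist_psh A X c) a = c a"
    using A X c a functor_closed[OF c a]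
      functor_closed[OF dist_copsh_functor[OF A X dist_psh_functor[OF A X c]] a]
    by (intro copsh_eqI[OF X]) simp_all
qed (use assms in simp)

lemma dist_psh_copsh:
  assumes A: "qcategory Q A" and X: "qcategory Q X" and n: "\<nu> \<in> qfunctors Q X (PSh Q A)"
  shows "dist_psh A X (dist_copsh A X \<nu>) = \<nu>"
proof (rule functor_eqI[OF _ n])
  fix x assume x: "x \<in> carrier X"
  show "dist_psh A X (dist_copsh A X \<nu>) x = \<nu> x"
    using A X n x functor_closed[OF n x]
      functor_closed[OF dist_psh_functor[OF A X dist_copsh_functor[OF A X n]] x]
    by (intro psh_eqI[OF A]) simp_all
qed (use assms in simp)

section \<open>Nerves\<close>

text \<open>
  The functor \<open>z \<mapsto> 1(\<nu> -, z)\<close>.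
\<close>

definition nerve ::
    "('o, 'a, 'x) qcat \<Rightarrow> ('o, 'a, 'z) qcat \<Rightarrow> ('x \<Rightarrow> 'z) \<Rightarrow> 'z \<Rightarrow> ('o, 'a, 'x) psh" where
  "nerve X Z \<nu> = compose (carrier Z) (psh_pull Q X Z \<nu>) (yon Z)"

lemma nerve_functor [simp]:
  "\<lbrakk>qcategory Q X; qcategory Q Z; \<nu> \<in> qfunctors Q X Z\<rbrakk> \<Longrightarrow> nerve X Z \<nu> \<in> qfunctors Q Z (PSh Q X)"
  unfolding nerve_def by (rule functor_compose[of _ "PSh Q Z"]) simp_all

lemma nerve_closed [simp]:
  "\<lbrakk>qcategory Q X; qcategory Q Z; \<nu> \<in> qfunctors Q X Z; z \<in> carrier Z\<rbrakk> \<Longrightarrow> nerve X Z \<nu> z \<in> carrier (PSh Q X)"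
  by (rule functor_closed[OF nerve_functor])

lemma nerve_fst [simp]:
  "\<lbrakk>qcategory Q Z; z \<in> carrier Z\<rbrakk> \<Longrightarrow> fst (nerve X Z \<nu> z) = ty Z z"
  by (simp add: nerve_def compose_def)

lemma nerve_val [simp]:
  "\<lbrakk>qcategory Q X; qcategory Q Z; \<nu> \<in> qfunctors Q X Z; z \<in> carrier Z; x \<in> carrier X\<rbrakk> \<Longrightarrow>
    val (nerve X Z \<nu> z) x = hm Z (\<nu> x) z"
  by (simp add: nerve_def compose_def)

text \<open>
  Thus \<open>\<nu>\<close> is a left adjoint of its nerve relative to the Yoneda embedding.
\<close>

lemma yon_below_nerve_iff:
  assumes "qcategory Q X" "qcategory Q Z" "\<nu> \<in> qfunctors Q X Z" "x \<in> carrier X" "z \<in> carrier Z"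
  shows "yon X x \<lesssim>[PSh Q X] nerve X Z \<nu> z \<longleftrightarrow> \<nu> x \<lesssim>[Z] z"
  using assms by (simp add: below_def qle_def yoneda)

text \<open>
  The cocontinuous extension of \<open>\<nu>\<close> along the Yoneda embedding. It supplies a genuine functor on
  presheaves to which \<open>T\<close> can be applied, with a counit towards the nerve of \<open>\<nu>\<close>.
\<close>

definition kan :: "('o, 'a, 'x) qcat \<Rightarrow> ('o, 'a, 'y) qcat \<Rightarrow> ('x \<Rightarrow> ('o, 'a, 'y) psh) \<Rightarrow>
    ('o, 'a, 'x) psh \<Rightarrow> ('o, 'a, 'y) psh" where
  "kan X A \<nu> = compose (carrier (PSh Q X)) (psh_mult Q A) (psh_push Q X (PSh Q A) \<nu>)"

lemma kan_functor [simp]: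
  "\<lbrakk>qcategory Q X; qcategory Q A; \<nu> \<in> qfunctors Q X (PSh Q A)\<rbrakk> \<Longrightarrow>
    kan X A \<nu> \<in> qfunctors Q (PSh Q X) (PSh Q A)"
  unfolding kan_def by (rule functor_compose[of _ "PSh Q (PSh Q A)"]) simp_all

lemma kan_yon:
  assumes X: "qcategory Q X" and A: "qcategory Q A" and n: "\<nu> \<in> qfunctors Q X (PSh Q A)"
  shows "compose (carrier X) (kan X A \<nu>) (yon X) = \<nu>"
proof (rule extensionalityI[of _ "carrier X"])
  fix x assume x: "x \<in> carrier X"
  show "compose (carrier X) (kan X A \<nu>) (yon X) x = \<nu> x"
    using X A n x functor_closed[OF n x] by (simp add: compose_def kan_def psh_push_yon psh_mult_yon)
qed (use functor_ext[OF n] in simp_all)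

lemma kan_nerve_below:
  assumes X: "qcategory Q X" and A: "qcategory Q A" and n: "\<nu> \<in> qfunctors Q X (PSh Q A)"
    and s: "\<sigma> \<in> carrier (PSh Q A)"
  shows "kan X A \<nu> (nerve X (PSh Q A) \<nu> \<sigma>) \<lesssim>[PSh Q A] \<sigma>"
proof -
  have "psh_mult Q A (psh_push Q X (PSh Q A) \<nu> (psh_pull Q X (PSh Q A) \<nu> (yon (PSh Q A) \<sigma>)))
      \<lesssim>[PSh Q A] psh_mult Q A (yon (PSh Q A) \<sigma>)"
    using assms by (intro functor_below[OF _ psh_mult_functor] qadj_counit[OF _ _ psh_push_pull_adj]) simp_all
  then show ?thesis
    using assms by (simp add: kan_def nerve_def compose_def psh_mult_yon)
qed


section \<open>Lax algebras are nerves\<close>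

text \<open>
  The composite in the associativity axiom collapses, because \<open>\<Lambda>\<close> takes representable values and
  \<open>s \<cdot> p\<^sub>!\<close> evaluates \<open>p\<close> on these.
\<close>

lemma lax_algebra_iff:
  "lax_algebra Q (Lambda Q) (X, p) \<longleftrightarrow> qcategory Q X \<and> p \<in> qfunctors Q (TT X) (PSh Q X) \<and>
    (\<forall>x \<in> carrier X. yon X x \<lesssim>[PSh Q X] p (dp_unit Q X x)) \<and>
    (\<forall>\<Sigma> \<in> carrier (TT (TT X)).
      p (yon_radj X (dp_map Q (TT X) (PSh Q X) p \<Sigma>)) \<lesssim>[PSh Q X] p (dp_mult Q X \<Sigma>))"
proof (cases "qcategory Q X \<and> p \<in> qfunctors Q (TT X) (PSh Q X)")
  case True
  then have X: "qcategory Q X" and p: "p \<in> qfunctors Q (TT X) (PSh Q X)" by auto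
  let ?L = "compose (carrier (TT (TT X))) (psh_mult Q X)
        (compose (carrier (TT (TT X))) (psh_push Q (TT X) (PSh Q X) p)
          (compose (carrier (TT (TT X))) (Lambda Q X) (dp_map Q (TT X) (PSh Q X) p)))"
  have pc: "p s \<in> carrier (PSh Q X)" if "s \<in> carrier (TT X)" for s using functor_closed[OF p that] .
  have L: "?L \<Sigma> = p (yon_radj X (dp_map Q (TT X) (PSh Q X) p \<Sigma>))" if "\<Sigma> \<in> carrier (TT (TT X))" for \<Sigma>
    using X p that pc by (simp add: compose_def Lambda_apply psh_push_yon psh_mult_yon)
  have "fun_le Q X (PSh Q X) (yon X) (compose (carrier X) p (dp_unit Q X)) \<longleftrightarrow>
      (\<forall>x \<in> carrier X. yon X x \<lesssim>[PSh Q X] p (dp_unit Q X x))"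
    using X pc by (subst fun_le_iff) (simp_all add: compose_def)
  moreover have "fun_le Q (TT (TT X)) (PSh Q X) ?L (compose (carrier (TT (TT X))) p (dp_mult Q X)) \<longleftrightarrow>
      (\<forall>\<Sigma> \<in> carrier (TT (TT X)).
        p (yon_radj X (dp_map Q (TT X) (PSh Q X) p \<Sigma>)) \<lesssim>[PSh Q X] p (dp_mult Q X \<Sigma>))"
    using X p pc L by (subst fun_le_iff) (simp_all add: compose_def[of _ p])
  ultimately show ?thesis using X p by (simp add: lax_algebra_def DP_def)
qed (auto simp: lax_algebra_def DP_def)

text \<open>
  For \<open>p\<close> the nerve of \<open>\<nu>\<close> the two axioms say that \<open>\<nu>\<close> is deflationary and coassociative in the
  Kleisli sense. From the axioms to \<open>\<nu>\<close>: \<open>y \<le> p \<cdot> \<nu>\<close> gives \<open>1 = M \<cdot> T y \<le> M \<cdot> T p \<cdot> T \<nu>\<close>, so that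
  \<open>y \<le> p \<cdot> \<nu> \<le> p \<cdot> M \<cdot> T p \<cdot> T \<nu> \<cdot> \<nu> \<le> p \<cdot> m \<cdot> T \<nu> \<cdot> \<nu>\<close>, which transposes. From \<open>\<nu>\<close> to the axioms: the
  value at \<open>x\<close> of \<open>p (M (T p \<Sigma>))\<close> is the hom from \<open>T y (\<nu> x)\<close> to \<open>T p \<Sigma>\<close>, and applying \<open>T\<close> of the
  cocontinuous extension of \<open>\<nu>\<close>, then \<open>m\<close>, maps it into the hom from \<open>\<nu> x\<close> to \<open>m \<Sigma>\<close>.
\<close>

theorem lax_algebra_nerve_iff:
  assumes X: "qcategory Q X" and n: "\<nu> \<in> qfunctors Q X (TT X)"
  shows "lax_algebra Q (Lambda Q) (X, nerve X (TT X) \<nu>) \<longleftrightarrow>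
    (\<forall>x \<in> carrier X. \<nu> x \<lesssim>[TT X] dp_unit Q X x) \<and>
    (\<forall>x \<in> carrier X. \<nu> x \<lesssim>[TT X] dp_mult Q X (dp_map Q X (TT X) \<nu> (\<nu> x)))"
proof -
  let ?p = "nerve X (TT X) \<nu>" and ?N = "dp_map Q X (TT X) \<nu>"
  let ?P = "dp_map Q (TT X) (PSh Q X) (nerve X (TT X) \<nu>)" and ?Y = "dp_map Q X (PSh Q X) (yon X)"
  have nc: "\<nu> x \<in> carrier (TT X)" if "x \<in> carrier X" for x using functor_closed[OF n that] .
  have yp: "yon X x \<lesssim>[PSh Q X] ?p (\<nu> x)" if "x \<in> carrier X" for x
    using X n nc that below_refl[of "TT X" "\<nu> x"] by (simp add: yon_below_nerve_iff)
  have "\<nu> x \<lesssim>[TT X] dp_mult Q X (?N (\<nu> x))"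
    if ax: "\<forall>\<Sigma> \<in> carrier (TT (TT X)). ?p (yon_radj X (?P \<Sigma>)) \<lesssim>[PSh Q X] ?p (dp_mult Q X \<Sigma>)"
      and x: "x \<in> carrier X" for x
  proof -
    have "\<nu> x = yon_radj X (?Y (\<nu> x))" using X nc x by (simp add: yon_radj_dp_yon)
    also have "\<dots> \<lesssim>[TT X] yon_radj X (?P (?N (\<nu> x)))"
    proof (rule functor_below[OF _ yon_radj_functor])
      have "?Y (\<nu> x) \<lesssim>[TT (PSh Q X)] dp_map Q X (PSh Q X) (compose (carrier X) ?p \<nu>) (\<nu> x)"
        using X n nc x yp by (intro dp_map_mono functor_compose[of _ "TT X"]) (simp_all add: compose_def)
      also have "\<dots> = ?P (?N (\<nu> x))"
        using X n nc x by (intro dp_map_compose) simp_all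
      finally show "?Y (\<nu> x) \<lesssim>[TT (PSh Q X)] ?P (?N (\<nu> x))" .
    qed (use X in simp_all)
    finally have le: "\<nu> x \<lesssim>[TT X] yon_radj X (?P (?N (\<nu> x)))" .
    have "?p (\<nu> x) \<lesssim>[PSh Q X] ?p (yon_radj X (?P (?N (\<nu> x))))"
      using X n by (intro functor_below[OF _ _ le]) simp_all
    also have "\<dots> \<lesssim>[PSh Q X] ?p (dp_mult Q X (?N (\<nu> x)))" using ax X n nc x by simp
    finally have "yon X x \<lesssim>[PSh Q X] ?p (dp_mult Q X (?N (\<nu> x)))"
      by (rule below_trans[OF yp[OF x]])
    then show ?thesis using X n nc x by (simp add: yon_below_nerve_iff)
  qed
  moreover have "?p (yon_radj X (?P \<Sigma>)) \<lesssim>[PSh Q X] ?p (dp_mult Q X \<Sigma>)"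
    if le: "\<forall>x \<in> carrier X. \<nu> x \<lesssim>[TT X] dp_mult Q X (?N (\<nu> x))" and S: "\<Sigma> \<in> carrier (TT (TT X))" for \<Sigma>
  proof -
    let ?k = "kan X (CoPSh Q X) \<nu>"
    let ?K = "dp_map Q (PSh Q X) (TT X) ?k"
    have kS: "?K (?P \<Sigma>) \<lesssim>[TT (TT X)] \<Sigma>"
    proof -
      have "?K (?P \<Sigma>) = dp_map Q (TT X) (TT X) (compose (carrier (TT X)) ?k ?p) \<Sigma>"
        using X n S by (intro dp_map_compose[symmetric]) simp_all
      also have "\<dots> \<lesssim>[TT (TT X)] dp_map Q (TT X) (TT X) (\<lambda>t \<in> carrier (TT X). t) \<Sigma>"
      proof (rule dp_map_mono)
        show "compose (carrier (TT X)) ?k ?p \<in> qfunctors Q (TT X) (TT X)"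
          using X n by (intro functor_compose[of _ "PSh Q X"]) simp_all
        show "compose (carrier (TT X)) ?k ?p t \<lesssim>[TT X] (\<lambda>t \<in> carrier (TT X). t) t"
          if "t \<in> carrier (TT X)" for t
          using kan_nerve_below[of X "CoPSh Q X" \<nu> t] X n that by (simp add: compose_def)
      qed (use X S functor_id[of "TT X"] in simp_all)
      also have "\<dots> = \<Sigma>" using X S by (intro dp_map_id) simp_all
      finally show ?thesis .
    qed
    have kY: "?K (?Y (\<nu> x)) = ?N (\<nu> x)" if "x \<in> carrier X" for x
      using dp_map_compose[of X "PSh Q X" "TT X" "yon X" ?k "\<nu> x"] kan_yon[of X "CoPSh Q X" \<nu>] X n nc that
      by simp
    have "hm (TT X) (\<nu> x) (yon_radj X (?P \<Sigma>)) \<preceq>[ty X x, fst \<Sigma>] hm (TT X) (\<nu> x) (dp_mult Q X \<Sigma>)"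
      if x: "x \<in> carrier X" for x
    proof -
      have "hm (TT X) (\<nu> x) (yon_radj X (?P \<Sigma>)) = hm (TT (PSh Q X)) (?Y (\<nu> x)) (?P \<Sigma>)"
        using X n nc x S by (intro qadjD(3)[OF dp_yon_adj, symmetric]) simp_all
      also have "\<dots> \<preceq>[ty X x, fst \<Sigma>] hm (TT (TT X)) (?K (?Y (\<nu> x))) (?K (?P \<Sigma>))"
        using functor_hm[of "TT (PSh Q X)" "TT (TT X)" ?K "?Y (\<nu> x)" "?P \<Sigma>"] X n nc x S by simp
      also have "\<dots> \<preceq>[ty X x, fst \<Sigma>] hm (TT (TT X)) (?N (\<nu> x)) \<Sigma>"
        using below_hm_right[OF kS, of "?N (\<nu> x)"] X n nc x S kY by simp
      also have "\<dots> \<preceq>[ty X x, fst \<Sigma>] hm (TT X) (dp_mult Q X (?N (\<nu> x))) (dp_mult Q X \<Sigma>)"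
        using functor_hm[of "TT (TT X)" "TT X" "dp_mult Q X" "?N (\<nu> x)" \<Sigma>] X n nc x S by simp
      also have "\<dots> \<preceq>[ty X x, fst \<Sigma>] hm (TT X) (\<nu> x) (dp_mult Q X \<Sigma>)"
        using below_hm_left[OF bspec[OF le x], of "dp_mult Q X \<Sigma>"] X n nc x S by simp
      finally show ?thesis .
    qed
    then show ?thesis using X n nc S by (subst psh_below_iff) simp_all
  qed
  ultimately show ?thesis
    using X n nc by (auto simp: lax_algebra_iff yon_below_nerve_iff)
qed


text \<open>
  Here \<open>p \<sigma>\<close> is thought of as the presheaf of limits of \<open>\<sigma>\<close>. In the two-valued case the value of
  \<open>nbhd X p\<close> at \<open>x\<close> is the intersection of all \<open>\<sigma>\<close> that converge to \<open>x\<close>: the copresheaf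
  \<open>limits X p x\<close> collects these \<open>\<sigma>\<close>, and the multiplication of the representable presheaf on a
  copresheaf is an infimum. Written as a composite of functors, functoriality is automatic.
\<close>

definition nbhd ::
    "('o, 'a, 'x) qcat \<Rightarrow> (('o, 'a, 'x) dpsh \<Rightarrow> ('o, 'a, 'x) psh) \<Rightarrow> 'x \<Rightarrow> ('o, 'a, 'x) dpsh" where
  "nbhd X p = compose (carrier X) (dp_mult Q X) (compose (carrier X) (yon (CoPSh Q (TT X)))
    (compose (carrier X) (copsh_pull Q (TT X) (PSh Q X) p) (compose (carrier X) (coyon (PSh Q X)) (yon X))))"

abbreviation limits ::
    "('o, 'a, 'x) qcat \<Rightarrow> (('o, 'a, 'x) dpsh \<Rightarrow> ('o, 'a, 'x) psh) \<Rightarrow> 'x \<Rightarrow> ('o, 'a, ('o, 'a, 'x) dpsh) copsh"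
  where "limits X p x \<equiv> copsh_pull Q (TT X) (PSh Q X) p (coyon (PSh Q X) (yon X x))"

lemma limits_val:
  assumes X: "qcategory Q X" and p: "p \<in> qfunctors Q (TT X) (PSh Q X)"
    and x: "x \<in> carrier X" and s: "\<sigma> \<in> carrier (TT X)"
  shows "coval (limits X p x) \<sigma> = val (p \<sigma>) x"
  using assms functor_closed[OF p s] by (simp add: yoneda)

lemma nbhd_functor [simp]:
  assumes "qcategory Q X" "p \<in> qfunctors Q (TT X) (PSh Q X)"
  shows "nbhd X p \<in> qfunctors Q X (TT X)"
  unfolding nbhd_def using assms
  by (intro functor_compose[of _ "TT (TT X)" "TT X"] functor_compose[of _ "CoPSh Q (TT X)"]
      functor_compose[of _ "CoPSh Q (PSh Q X)"] functor_compose[of _ "PSh Q X"]) simp_all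

lemma nbhd_apply:
  assumes "x \<in> carrier X"
  shows "nbhd X p x = dp_mult Q X (yon (CoPSh Q (TT X)) (limits X p x))"
  using assms by (simp add: nbhd_def compose_def)

lemma nbhd_closed [simp]:
  "\<lbrakk>qcategory Q X; p \<in> qfunctors Q (TT X) (PSh Q X); x \<in> carrier X\<rbrakk> \<Longrightarrow> nbhd X p x \<in> carrier (TT X)"
  by (rule functor_closed[OF nbhd_functor])

lemma nbhd_fst [simp]:
  "\<lbrakk>qcategory Q X; p \<in> qfunctors Q (TT X) (PSh Q X); x \<in> carrier X\<rbrakk> \<Longrightarrow> fst (nbhd X p x) = ty X x"
  by (simp add: nbhd_apply)

lemma nbhd_val:
  assumes "qcategory Q X" "p \<in> qfunctors Q (TT X) (PSh Q X)" "x \<in> carrier X" "U \<in> carrier (CoPSh Q X)"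
  shows "val (nbhd X p x) U = hm (CoPSh Q (TT X)) (coyon (TT X) (yon (CoPSh Q X) U)) (limits X p x)"
  using assms by (simp add: nbhd_apply dp_mult_val)

text \<open>
  One half of the Galois connection between convergence and neighbourhoods, valid for every functor
  \<open>p\<close>: whatever converges to \<open>x\<close> contains the neighbourhoods of \<open>x\<close>.
\<close>

lemma below_nerve_nbhd:
  assumes X: "qcategory Q X" and p: "p \<in> qfunctors Q (TT X) (PSh Q X)" and s: "\<sigma> \<in> carrier (TT X)"
  shows "p \<sigma> \<lesssim>[PSh Q X] nerve X (TT X) (nbhd X p) \<sigma>"
proof -
  note ps = functor_closed[OF p s]
  have "val (p \<sigma>) x \<preceq>[ty X x, fst \<sigma>] hm (TT X) (nbhd X p x) \<sigma>" if x: "x \<in> carrier X" for x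
  proof -
    have nx: "nbhd X p x \<in> carrier (TT X)" "fst (nbhd X p x) = ty X x"
      using X p x by simp_all
    have "Cmp Q (fst U) (ty X x) (fst \<sigma>) (val (p \<sigma>) x) (val (nbhd X p x) U) \<preceq>[fst U, fst \<sigma>] val \<sigma> U"
      if U: "U \<in> carrier (CoPSh Q X)" for U
      using copsh_hm_action[of "TT X" "coyon (TT X) (yon (CoPSh Q X) U)" "limits X p x" \<sigma>] X p x s U
      by (simp add: nbhd_val limits_val[OF X p x s] yoneda del: copsh_pull_val)
    then show ?thesis
      using leq_psh_hm_iff[OF _ nx(1) s, of "val (p \<sigma>) x"] nx X p s x val_closed[OF X ps x] by simp
  qed
  then show ?thesis using X p s ps by (subst psh_below_iff) simp_all
qed

text \<open>
  For lax algebras the neighbourhoods of \<open>x\<close> converge to \<open>x\<close>. With \<open>W\<close> the copresheaf of all that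
  converges to \<open>x\<close>, apply the associativity axiom to the presheaf represented by \<open>W\<close>. Its
  multiplication is the neighbourhood presheaf. The unit of the adjunction between \<open>p\<^sup>\<exclamdown>\<close> and
  \<open>p\<^sub>\<exclamdown>\<close> shows that the other side is at least the value of \<open>p\<close> at the unit of \<open>x\<close>, which has \<open>x\<close> as
  a limit by the first axiom.
\<close>

lemma yon_below_nbhd:
  assumes alg: "lax_algebra Q (Lambda Q) (X, p)" and x: "x \<in> carrier X"
  shows "yon X x \<lesssim>[PSh Q X] p (nbhd X p x)"
proof -
  have X: "qcategory Q X" and p: "p \<in> qfunctors Q (TT X) (PSh Q X)"
    and a1: "yon X x \<lesssim>[PSh Q X] p (dp_unit Q X x)"
    and a2: "\<And>\<Sigma>. \<Sigma> \<in> carrier (TT (TT X)) \<Longrightarrow>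
      p (yon_radj X (dp_map Q (TT X) (PSh Q X) p \<Sigma>)) \<lesssim>[PSh Q X] p (dp_mult Q X \<Sigma>)"
    using alg x by (auto simp: lax_algebra_iff)
  let ?W = "limits X p x"
  let ?S = "yon (CoPSh Q (TT X)) ?W" and ?P = "dp_map Q (TT X) (PSh Q X) p"
  have W: "?W \<in> carrier (CoPSh Q (TT X))" using X p x by simp
  have "dp_map Q X (PSh Q X) (yon X) (dp_unit Q X x) = yon (CoPSh Q (PSh Q X)) (coyon (PSh Q X) (yon X x))"
    using X x by (simp add: dp_unit_natural) (simp add: dp_unit_apply)
  also have "\<dots> \<lesssim>[TT (PSh Q X)] yon (CoPSh Q (PSh Q X)) (copsh_push Q (TT X) (PSh Q X) p ?W)"
    using X p x by (intro yon_below qadj_unit[OF _ _ copsh_pull_push_adj]) simp_all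
  also have "\<dots> = ?P ?S"
    using X p W by (simp add: dp_map_def psh_push_yon)
  finally have le: "dp_unit Q X x \<lesssim>[TT X] yon_radj X (?P ?S)"
    by (subst (asm) qadj_below_iff[OF _ _ dp_yon_adj]) (use X p x W in simp_all)
  have "p (dp_unit Q X x) \<lesssim>[PSh Q X] p (yon_radj X (?P ?S))"
    using X p by (intro functor_below[OF _ _ le]) simp_all
  also have "\<dots> \<lesssim>[PSh Q X] p (dp_mult Q X ?S)" using X W by (intro a2) simp
  finally have "p (dp_unit Q X x) \<lesssim>[PSh Q X] p (nbhd X p x)" using x by (simp add: nbhd_apply)
  then show ?thesis by (rule below_trans[OF a1])
qed

text \<open>
  If \<open>\<sigma>\<close> is above the neighbourhoods of \<open>x\<close>, then \<open>\<sigma>\<close> converges to \<open>x\<close> because \<open>p\<close> is a functor and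
  the neighbourhoods themselves do.
\<close>

theorem lax_algebra_is_nerve:
  assumes alg: "lax_algebra Q (Lambda Q) (X, p)"
  shows "nerve X (TT X) (nbhd X p) = p"
proof -
  have X: "qcategory Q X" and p: "p \<in> qfunctors Q (TT X) (PSh Q X)"
    using alg by (auto simp: lax_algebra_iff)
  note n = nbhd_functor[OF X p]
  show ?thesis
  proof (rule functor_eqI[OF _ p])
    show "nerve X (TT X) (nbhd X p) \<in> qfunctors Q (TT X) (PSh Q X)" using X n by simp
    fix \<sigma> assume s: "\<sigma> \<in> carrier (TT X)"
    note ps = functor_closed[OF p s]
    have "hm (TT X) (nbhd X p x) \<sigma> \<preceq>[ty X x, fst \<sigma>] val (p \<sigma>) x" if x: "x \<in> carrier X" for x
    proof -
      have nx: "nbhd X p x \<in> carrier (TT X)" "fst (nbhd X p x) = ty X x"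
        using X p x by simp_all
      have "hm (TT X) (nbhd X p x) \<sigma> \<preceq>[ty X x, fst \<sigma>] hm (PSh Q X) (p (nbhd X p x)) (p \<sigma>)"
        using functor_hm[OF _ _ p nx(1) s] nx s X by simp
      also have "\<dots> \<preceq>[ty X x, fst \<sigma>] hm (PSh Q X) (yon X x) (p \<sigma>)"
        using below_hm_left[OF yon_below_nbhd[OF alg x] ps] belowD(4)[OF yon_below_nbhd[OF alg x]] X x s p
        by simp
      also have "\<dots> = val (p \<sigma>) x" using X x ps by (simp add: yoneda)
      finally show ?thesis .
    qed
    then have "nerve X (TT X) (nbhd X p) \<sigma> \<lesssim>[PSh Q X] p \<sigma>"
      using X p n s ps by (subst psh_below_iff) simp_all
    then show "nerve X (TT X) (nbhd X p) \<sigma> = p \<sigma>"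
      using below_nerve_nbhd[OF X p s] by (intro psh_antisym[OF X])
  qed
qed

text \<open>
  The limit copresheaf of a nerve is represented by \<open>\<nu> x\<close>, so the Yoneda lemmas recover \<open>\<nu>\<close>.
\<close>

lemma nbhd_nerve:
  assumes X: "qcategory Q X" and n: "\<nu> \<in> qfunctors Q X (TT X)"
  shows "nbhd X (nerve X (TT X) \<nu>) = \<nu>"
proof (rule functor_eqI[OF _ n])
  let ?p = "nerve X (TT X) \<nu>"
  have p: "?p \<in> qfunctors Q (TT X) (PSh Q X)" using X n by simp
  show np: "nbhd X ?p \<in> qfunctors Q X (TT X)" using X p by (rule nbhd_functor)
  fix x assume x: "x \<in> carrier X"
  note nx = functor_closed[OF n x]
  have W: "limits X ?p x = coyon (TT X) (\<nu> x)"
    using X n p x nx limits_val[OF X p x]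
    by (intro copsh_eqI[of "TT X"]) (simp_all del: copsh_pull_val)
  show "nbhd X ?p x = \<nu> x"
    using X n p x nx nbhd_closed[OF X p x] nbhd_fst[OF X p x]
    by (intro psh_eqI[of "CoPSh Q X"]) (simp_all add: nbhd_val W coyoneda yoneda)
qed

section \<open>Closure operations and homomorphisms\<close>

text \<open>
  The image along a right adjoint is the inverse image along the left adjoint. This computes the
  values of \<open>T f\<close>, since the image of copresheaves is a right adjoint.
\<close>

lemma psh_push_right_adjoint_val:
  assumes A: "qcategory Q A" and Z: "qcategory Q Z" and adj: "qadj Z A l g"
    and s: "\<sigma> \<in> carrier (PSh Q A)" and z: "z \<in> carrier Z"
  shows "val (psh_push Q A Z g \<sigma>) z = val \<sigma> (l z)"
proof (rule leq_antisym)
  have g: "g \<in> qfunctors Q A Z" and l: "l \<in> qfunctors Q Z A"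
    and h: "\<And>a. a \<in> carrier A \<Longrightarrow> hm Z z (g a) = hm A (l z) a"
    using qadjD[OF adj] z by auto
  note lz = functor_closed[OF l z]
  have v: "val \<sigma> (l z) \<in> hom (ty Z z) (fst \<sigma>)" using val_closed[OF A s lz] l z by simp
  show "val (psh_push Q A Z g \<sigma>) z \<preceq>[ty Z z, fst \<sigma>] val \<sigma> (l z)"
    using psh_push_sel(3)[OF A Z g s z v] val_action[OF A s _ lz] h l z by simp
  have "val \<sigma> (l z) \<preceq>[ty Z z, fst \<sigma>] Cmp Q (ty Z z) (ty Z z) (fst \<sigma>) (val \<sigma> (l z)) (hm A (l z) (l z))"
    using hm_refl[OF A lz] l z v s by (intro idn_cmp_mono_right) simp_all
  also have "\<dots> \<preceq>[ty Z z, fst \<sigma>] val (psh_push Q A Z g \<sigma>) z"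
    using leq_val_push[OF A Z g s lz z] h[OF lz] l z by simp
  finally show "val \<sigma> (l z) \<preceq>[ty Z z, fst \<sigma>] val (psh_push Q A Z g \<sigma>) z" .
qed

lemma dp_map_val:
  assumes X: "qcategory Q X" and Y: "qcategory Q Y" and f: "f \<in> qfunctors Q X Y"
    and s: "\<sigma> \<in> carrier (TT X)" and V: "V \<in> carrier (CoPSh Q Y)"
  shows "val (dp_map Q X Y f \<sigma>) V = val \<sigma> (copsh_pull Q X Y f V)"
  unfolding dp_map_def using assms
  by (intro psh_push_right_adjoint_val copsh_pull_push_adj) simp_all

text \<open>
  Kleisli composition of \<open>\<nu>\<close> with itself corresponds to composition of \<open>c\<close> with itself.
\<close>

lemma dp_mult_dist_psh_val:
  assumes X: "qcategory Q X" and c: "c \<in> qfunctors Q (CoPSh Q X) (CoPSh Q X)"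
    and x: "x \<in> carrier X" and U: "U \<in> carrier (CoPSh Q X)"
  defines "\<nu> \<equiv> dist_psh (CoPSh Q X) X c"
  shows "val (dp_mult Q X (dp_map Q X (TT X) \<nu> (\<nu> x))) U = coval (c (c U)) x"
proof -
  have n: "\<nu> \<in> qfunctors Q X (TT X)" using X c by (simp add: \<nu>_def)
  note nx = functor_closed[OF n] and cU = functor_closed[OF c U]
  have "copsh_pull Q X (TT X) \<nu> (coyon (TT X) (yon (CoPSh Q X) U)) = c U"
    using X n U nx cU c
    by (intro copsh_eqI[of X]) (simp_all add: yoneda, simp_all add: \<nu>_def)
  then have "val (dp_mult Q X (dp_map Q X (TT X) \<nu> (\<nu> x))) U = val (\<nu> x) (c U)"
    using X n U x nx by (simp add: dp_mult_val dp_map_val)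
  then show ?thesis using x cU by (simp add: \<nu>_def)
qed

text \<open>
  Inequalities of values turn around between presheaves and copresheaves, so the deflationary and
  coassociative \<open>\<nu>\<close> correspond to the \<open>c\<close> with \<open>1 \<le> c\<close> and \<open>c \<cdot> c \<le> c\<close>; by antisymmetry these are the
  closure operations.
\<close>

lemma closure_operation_iff:
  assumes X: "qcategory Q X" and c: "c \<in> qfunctors Q (CoPSh Q X) (CoPSh Q X)"
  defines "\<nu> \<equiv> dist_psh (CoPSh Q X) X c"
  shows "closure_operation Q (CoPSh Q X) c \<longleftrightarrow>
    (\<forall>x \<in> carrier X. \<nu> x \<lesssim>[TT X] dp_unit Q X x) \<and>
    (\<forall>x \<in> carrier X. \<nu> x \<lesssim>[TT X] dp_mult Q X (dp_map Q X (TT X) \<nu> (\<nu> x)))"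
proof -
  have n: "\<nu> \<in> qfunctors Q X (TT X)" using X c by (simp add: \<nu>_def)
  note nx = functor_closed[OF n] and cU = functor_closed[OF c]
  have nv: "fst (\<nu> x) = ty X x" "U \<in> carrier (CoPSh Q X) \<Longrightarrow> val (\<nu> x) U = coval (c U) x"
    if "x \<in> carrier X" for x U using that by (simp_all add: \<nu>_def)
  have "(\<forall>x \<in> carrier X. \<nu> x \<lesssim>[TT X] dp_unit Q X x) \<longleftrightarrow>
      (\<forall>x \<in> carrier X. \<forall>U \<in> carrier (CoPSh Q X). coval (c U) x \<preceq>[fst U, ty X x] coval U x)"
    using X nx nv by (intro ball_cong) (simp_all add: psh_below_iff dp_unit_apply coyoneda)
  also have "\<dots> \<longleftrightarrow> (\<forall>U \<in> carrier (CoPSh Q X). U \<lesssim>[CoPSh Q X] c U)"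
    using X c cU by (auto simp: copsh_below_iff)
  finally have 1: "(\<forall>x \<in> carrier X. \<nu> x \<lesssim>[TT X] dp_unit Q X x) \<longleftrightarrow>
    (\<forall>U \<in> carrier (CoPSh Q X). U \<lesssim>[CoPSh Q X] c U)" .
  have "(\<forall>x \<in> carrier X. \<nu> x \<lesssim>[TT X] dp_mult Q X (dp_map Q X (TT X) \<nu> (\<nu> x))) \<longleftrightarrow>
      (\<forall>x \<in> carrier X. \<forall>U \<in> carrier (CoPSh Q X). coval (c U) x \<preceq>[fst U, ty X x] coval (c (c U)) x)"
    using X n nx nv dp_mult_dist_psh_val[OF X c, folded \<nu>_def]
    by (intro ball_cong) (simp_all add: psh_below_iff)
  also have "\<dots> \<longleftrightarrow> (\<forall>U \<in> carrier (CoPSh Q X). c (c U) \<lesssim>[CoPSh Q X] c U)"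
    using X c cU by (auto simp: copsh_below_iff)
  finally have 2: "(\<forall>x \<in> carrier X. \<nu> x \<lesssim>[TT X] dp_mult Q X (dp_map Q X (TT X) \<nu> (\<nu> x))) \<longleftrightarrow>
    (\<forall>U \<in> carrier (CoPSh Q X). c (c U) \<lesssim>[CoPSh Q X] c U)" .
  have ext: "fun_le Q (CoPSh Q X) (CoPSh Q X) (\<lambda>x \<in> carrier (CoPSh Q X). x) c \<longleftrightarrow>
      (\<forall>U \<in> carrier (CoPSh Q X). U \<lesssim>[CoPSh Q X] c U)"
    using X cU by (subst fun_le_iff) simp_all
  have idem: "compose (carrier (CoPSh Q X)) c c = c \<longleftrightarrow> (\<forall>U \<in> carrier (CoPSh Q X). c (c U) = c U)"
  proof
    assume "compose (carrier (CoPSh Q X)) c c = c"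
    then show "\<forall>U \<in> carrier (CoPSh Q X). c (c U) = c U" by (metis compose_eq)
  next
    assume "\<forall>U \<in> carrier (CoPSh Q X). c (c U) = c U"
    then show "compose (carrier (CoPSh Q X)) c c = c"
      using functor_ext[OF c] by (intro extensionalityI[of _ "carrier (CoPSh Q X)"]) (simp_all add: compose_eq)
  qed
  have "c (c U) = c U \<longleftrightarrow> c (c U) \<lesssim>[CoPSh Q X] c U"
    if "\<forall>U \<in> carrier (CoPSh Q X). U \<lesssim>[CoPSh Q X] c U" and U: "U \<in> carrier (CoPSh Q X)" for U
    using that cU[OF U] copsh_antisym[OF X, of "c (c U)" "c U"] below_refl[OF copsh_qcategory[OF X] cU[OF U]]
    by auto
  then show ?thesis
    unfolding closure_operation_def 1 2 ext idem using c by auto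
qed

text \<open>
  Both conditions say that \<open>\<mu> (f x)\<close> is below \<open>T f (\<nu> x)\<close>. For homomorphisms this is the case of
  \<open>\<sigma> = \<nu> x\<close>, from which the other \<open>\<sigma>\<close> follow because \<open>T f\<close> is a functor. The values of the two sides
  are \<open>f\<^sup>\<exclamdown> (d V)\<close> and \<open>c (f\<^sup>\<exclamdown> V)\<close> at \<open>x\<close>.
\<close>

lemma lax_hom_iff_continuous:
  assumes X: "qcategory Q X" and Y: "qcategory Q Y" and f: "f \<in> qfunctors Q X Y"
    and c: "c \<in> qfunctors Q (CoPSh Q X) (CoPSh Q X)" and d: "d \<in> qfunctors Q (CoPSh Q Y) (CoPSh Q Y)"
  defines "\<nu> \<equiv> dist_psh (CoPSh Q X) X c" and "\<mu> \<equiv> dist_psh (CoPSh Q Y) Y d"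
  shows "fun_le Q (TT X) (PSh Q Y)
        (compose (carrier (TT X)) (psh_push Q X Y f) (nerve X (TT X) \<nu>))
        (compose (carrier (TT X)) (nerve Y (TT Y) \<mu>) (dp_map Q X Y f)) \<longleftrightarrow>
    fun_le Q (CoPSh Q Y) (CoPSh Q X)
        (compose (carrier (CoPSh Q Y)) c (copsh_pull Q X Y f))
        (compose (carrier (CoPSh Q Y)) (copsh_pull Q X Y f) d)"
proof -
  have n: "\<nu> \<in> qfunctors Q X (TT X)" and m: "\<mu> \<in> qfunctors Q Y (TT Y)"
    using X Y c d by (simp_all add: \<nu>_def \<mu>_def)
  let ?p = "nerve X (TT X) \<nu>" and ?q = "nerve Y (TT Y) \<mu>"
  note nx = functor_closed[OF n] and my = functor_closed[OF m] and fx = functor_closed[OF f]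
  note cU = functor_closed[OF c] and dV = functor_closed[OF d]
  have "fun_le Q (TT X) (PSh Q Y) (compose (carrier (TT X)) (psh_push Q X Y f) ?p)
        (compose (carrier (TT X)) ?q (dp_map Q X Y f)) \<longleftrightarrow>
      (\<forall>\<sigma> \<in> carrier (TT X). psh_push Q X Y f (?p \<sigma>) \<lesssim>[PSh Q Y] ?q (dp_map Q X Y f \<sigma>))"
    using X Y f n m by (subst fun_le_iff) (simp_all add: compose_def[of _ ?q] compose_def[of _ "psh_push Q X Y f"])
  also have "\<dots> \<longleftrightarrow> (\<forall>x \<in> carrier X. \<mu> (f x) \<lesssim>[TT Y] dp_map Q X Y f (\<nu> x))"
  proof (intro iffI ballI)
    fix x assume le: "\<forall>\<sigma> \<in> carrier (TT X). psh_push Q X Y f (?p \<sigma>) \<lesssim>[PSh Q Y] ?q (dp_map Q X Y f \<sigma>)"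
      and x: "x \<in> carrier X"
    have "yon X x \<lesssim>[PSh Q X] ?p (\<nu> x)"
      using X n nx x below_refl[of "TT X" "\<nu> x"] by (simp add: yon_below_nerve_iff)
    then have "psh_push Q X Y f (yon X x) \<lesssim>[PSh Q Y] psh_push Q X Y f (?p (\<nu> x))"
      using X Y f by (intro functor_below[OF _ psh_push_functor]) simp_all
    also have "\<dots> \<lesssim>[PSh Q Y] ?q (dp_map Q X Y f (\<nu> x))" using le nx x by blast
    finally show "\<mu> (f x) \<lesssim>[TT Y] dp_map Q X Y f (\<nu> x)"
      using X Y f m x nx fx by (simp add: psh_push_yon yon_below_nerve_iff)
  next
    fix \<sigma> assume le: "\<forall>x \<in> carrier X. \<mu> (f x) \<lesssim>[TT Y] dp_map Q X Y f (\<nu> x)" and s: "\<sigma> \<in> carrier (TT X)"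
    have "hm (TT X) (\<nu> x) \<sigma> \<preceq>[ty X x, fst \<sigma>] hm (TT Y) (\<mu> (f x)) (dp_map Q X Y f \<sigma>)"
      if x: "x \<in> carrier X" for x
    proof -
      have "hm (TT X) (\<nu> x) \<sigma> \<preceq>[ty X x, fst \<sigma>] hm (TT Y) (dp_map Q X Y f (\<nu> x)) (dp_map Q X Y f \<sigma>)"
        using functor_hm[of "TT X" "TT Y" "dp_map Q X Y f" "\<nu> x" \<sigma>] X Y f n nx x s by simp
      also have "\<dots> \<preceq>[ty X x, fst \<sigma>] hm (TT Y) (\<mu> (f x)) (dp_map Q X Y f \<sigma>)"
        using below_hm_left[OF bspec[OF le x], of "dp_map Q X Y f \<sigma>"] X Y f n nx x s by simp
      finally show ?thesis .
    qed
    then have "?p \<sigma> \<lesssim>[PSh Q X] psh_pull Q X Y f (?q (dp_map Q X Y f \<sigma>))"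
      using X Y f n m s fx by (subst psh_below_iff) simp_all
    then show "psh_push Q X Y f (?p \<sigma>) \<lesssim>[PSh Q Y] ?q (dp_map Q X Y f \<sigma>)"
      using X Y f n m s by (subst qadj_below_iff[OF _ _ psh_push_pull_adj]) simp_all
  qed
  also have "\<dots> \<longleftrightarrow> (\<forall>x \<in> carrier X. \<forall>V \<in> carrier (CoPSh Q Y).
      coval (d V) (f x) \<preceq>[fst V, ty X x] coval (c (copsh_pull Q X Y f V)) x)"
  proof (rule ball_cong[OF refl])
    fix x assume x: "x \<in> carrier X"
    have "val (dp_map Q X Y f (\<nu> x)) V = coval (c (copsh_pull Q X Y f V)) x"
      if V: "V \<in> carrier (CoPSh Q Y)" for V
      using dp_map_val[OF X Y f nx[OF x] V] X Y f x V by (simp add: \<nu>_def)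
    moreover have "fst (\<mu> (f x)) = ty X x" "fst (\<nu> x) = ty X x"
      "\<And>V. V \<in> carrier (CoPSh Q Y) \<Longrightarrow> val (\<mu> (f x)) V = coval (d V) (f x)"
      using x f fx[OF x] by (simp_all add: \<mu>_def \<nu>_def)
    ultimately show "\<mu> (f x) \<lesssim>[TT Y] dp_map Q X Y f (\<nu> x) \<longleftrightarrow> (\<forall>V \<in> carrier (CoPSh Q Y).
      coval (d V) (f x) \<preceq>[fst V, ty X x] coval (c (copsh_pull Q X Y f V)) x)"
      using X Y f x nx[OF x] my[OF fx[OF x]] by (simp add: psh_below_iff)
  qed
  also have "\<dots> \<longleftrightarrow> (\<forall>V \<in> carrier (CoPSh Q Y).
      c (copsh_pull Q X Y f V) \<lesssim>[CoPSh Q X] copsh_pull Q X Y f (d V))"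
    using X Y f c d cU dV by (auto simp: copsh_below_iff)
  also have "\<dots> \<longleftrightarrow> fun_le Q (CoPSh Q Y) (CoPSh Q X)
        (compose (carrier (CoPSh Q Y)) c (copsh_pull Q X Y f))
        (compose (carrier (CoPSh Q Y)) (copsh_pull Q X Y f) d)"
    using X Y f cU dV
    by (subst fun_le_iff) (simp_all add: compose_def[of _ c] compose_def[of _ "copsh_pull Q X Y f"])
  finally show ?thesis .
qed

section \<open>The isomorphism of 2-categories\<close>

text \<open>
  Lax algebras and interior spaces differ in their objects and in which functors they admit, but
  composition, identities and local order are those of the underlying categories.
\<close>

lemma concrete_twocategory:
  fixes C :: "(('o, 'a, 'x) qcat \<times> 'b, 'x \<Rightarrow> 'x) twocat"
  assumes cat: "\<And>A. A \<in> Obj C \<Longrightarrow> qcategory Q (fst A)"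
    and mor: "\<And>A B f. \<lbrakk>A \<in> Obj C; B \<in> Obj C; f \<in> Mor C A B\<rbrakk> \<Longrightarrow> f \<in> qfunctors Q (fst A) (fst B)"
    and mle: "mle C = (\<lambda>A B. fun_le Q (fst A) (fst B))"
    and mcmp: "mcmp C = (\<lambda>A B D g f. compose (carrier (fst A)) g f)"
    and mid: "mid C = (\<lambda>A. \<lambda>x \<in> carrier (fst A). x)"
    and id: "\<And>A. A \<in> Obj C \<Longrightarrow> mid C A \<in> Mor C A A"
    and comp: "\<And>A B D f g. \<lbrakk>A \<in> Obj C; B \<in> Obj C; D \<in> Obj C; f \<in> Mor C A B; g \<in> Mor C B D\<rbrakk> \<Longrightarrow>
      mcmp C A B D g f \<in> Mor C A D"
  shows "twocategory C"
  unfolding twocategory_def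
proof (intro conjI ballI impI)
  fix A B f assume A: "A \<in> Obj C" and B: "B \<in> Obj C" and f: "f \<in> Mor C A B"
  note ff = mor[OF A B f]
  show "mcmp C A A B f (mid C A) = f" "mcmp C A B B (mid C B) f = f"
    using functor_ext[OF ff] functor_closed[OF ff]
    by (auto simp: mcmp mid compose_eq intro!: extensionalityI[of _ "carrier (fst A)"])
  show "mle C A B f f"
    using functor_closed[OF ff] cat[OF B] by (simp add: mle fun_leI below_refl)
next
  fix A B D E f g h
  assume "A \<in> Obj C" "B \<in> Obj C" "D \<in> Obj C" "E \<in> Obj C"
    and fgh: "f \<in> Mor C A B" "g \<in> Mor C B D" "h \<in> Mor C D E"
  then have "f \<in> carrier (fst A) \<rightarrow> carrier (fst B)" using functor_closed[OF mor] by blast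
  then show "mcmp C A D E h (mcmp C A B D g f) = mcmp C A B E (mcmp C B D E h g) f"
    by (simp add: mcmp compose_assoc)
next
  fix A B f g h
  assume AB: "A \<in> Obj C" "B \<in> Obj C" and fgh: "f \<in> Mor C A B" "g \<in> Mor C A B" "h \<in> Mor C A B"
    and le: "mle C A B f g" "mle C A B g h"
  have "f x \<lesssim>[fst B] g x" "g x \<lesssim>[fst B] h x" if "x \<in> carrier (fst A)" for x
    using fun_leD[OF le(1)[unfolded mle] cat[OF AB(2)] that] fun_leD[OF le(2)[unfolded mle] cat[OF AB(2)] that]
      functor_closed[OF mor[OF AB fgh(1)] that] functor_closed[OF mor[OF AB fgh(2)] that]
      functor_closed[OF mor[OF AB fgh(3)] that] by blast+
  then show "mle C A B f h" unfolding mle by (blast intro: fun_leI below_trans)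
next
  fix A B D f f' g g'
  assume ABD: "A \<in> Obj C" "B \<in> Obj C" "D \<in> Obj C"
    and fg: "f \<in> Mor C A B" "f' \<in> Mor C A B" "g \<in> Mor C B D" "g' \<in> Mor C B D"
    and le: "mle C A B f f'" "mle C B D g g'"
  note f = mor[OF ABD(1,2) fg(1)] mor[OF ABD(1,2) fg(2)]
    and g = mor[OF ABD(2,3) fg(3)] mor[OF ABD(2,3) fg(4)]
  show "mle C A D (mcmp C A B D g f) (mcmp C A B D g' f')"
    unfolding mle
  proof (rule fun_leI)
    fix x assume x: "x \<in> carrier (fst A)"
    note fx = functor_closed[OF f(1) x] functor_closed[OF f(2) x]
    have "f x \<lesssim>[fst B] f' x"
      using le(1) x fx cat[OF ABD(2)] unfolding mle by (intro fun_leD)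
    then have "g (f x) \<lesssim>[fst D] g (f' x)"
      using functor_below[OF cat[OF ABD(3)] g(1)] by blast
    also have "\<dots> \<lesssim>[fst D] g' (f' x)"
      using le(2) fx functor_closed[OF g(1)] functor_closed[OF g(2)] cat[OF ABD(3)]
      unfolding mle by (intro fun_leD)
    finally show "mcmp C A B D g f x \<lesssim>[fst D] mcmp C A B D g' f' x"
      using x by (simp add: mcmp compose_eq)
  qed
qed (use id comp in auto)

lemma continuous_iff:
  assumes X: "qcategory Q X" and Y: "qcategory Q Y"
    and c: "c \<in> qfunctors Q (CoPSh Q X) (CoPSh Q X)" and d: "d \<in> qfunctors Q (CoPSh Q Y) (CoPSh Q Y)"
  shows "f \<in> continuous_qfunctors Q (X, c) (Y, d) \<longleftrightarrow> f \<in> qfunctors Q X Y \<and>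
    (\<forall>V \<in> carrier (CoPSh Q Y). c (copsh_pull Q X Y f V) \<lesssim>[CoPSh Q X] copsh_pull Q X Y f (d V))"
proof (cases "f \<in> qfunctors Q X Y")
  case True
  have "fun_le Q (CoPSh Q Y) (CoPSh Q X)
        (compose (carrier (CoPSh Q Y)) c (copsh_pull Q X Y f))
        (compose (carrier (CoPSh Q Y)) (copsh_pull Q X Y f) d) \<longleftrightarrow>
    (\<forall>V \<in> carrier (CoPSh Q Y). c (copsh_pull Q X Y f V) \<lesssim>[CoPSh Q X] copsh_pull Q X Y f (d V))"
    using X Y True functor_closed[OF c] functor_closed[OF d]
    by (subst fun_le_iff) (simp_all add: compose_eq)
  then show ?thesis using True by (simp add: continuous_qfunctors_def)
qed (simp add: continuous_qfunctors_def)

lemma interior_spaceD: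
  assumes "interior_space Q (X, c)"
  shows "qcategory Q X" "c \<in> qfunctors Q (CoPSh Q X) (CoPSh Q X)" "closure_operation Q (CoPSh Q X) c"
  using assms by (auto simp: interior_space_def closure_operation_def)

lemma continuous_id:
  assumes "interior_space Q A"
  shows "(\<lambda>x \<in> carrier (fst A). x) \<in> continuous_qfunctors Q A A"
proof -
  obtain X c where [simp]: "A = (X, c)" by (cases A)
  have X: "qcategory Q X" and c: "c \<in> qfunctors Q (CoPSh Q X) (CoPSh Q X)"
    using assms interior_spaceD[of X c] by simp_all
  have "copsh_pull Q X X (\<lambda>x \<in> carrier X. x) V = V" if "V \<in> carrier (CoPSh Q X)" for V
    using X that functor_id[OF X] by (intro copsh_eqI[OF X]) simp_all
  then show ?thesis
    using X c functor_id[OF X] functor_closed[OF c] by (simp add: continuous_iff below_refl)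
qed

lemma continuous_compose:
  assumes A: "interior_space Q A" and B: "interior_space Q B" and D: "interior_space Q D"
    and f: "f \<in> continuous_qfunctors Q A B" and g: "g \<in> continuous_qfunctors Q B D"
  shows "compose (carrier (fst A)) g f \<in> continuous_qfunctors Q A D"
proof -
  obtain X c Y d Z e where eq [simp]: "A = (X, c)" "B = (Y, d)" "D = (Z, e)"
    by (cases A, cases B, cases D)
  have X: "qcategory Q X" and c: "c \<in> qfunctors Q (CoPSh Q X) (CoPSh Q X)"
    and Y: "qcategory Q Y" and d: "d \<in> qfunctors Q (CoPSh Q Y) (CoPSh Q Y)"
    and Z: "qcategory Q Z" and e: "e \<in> qfunctors Q (CoPSh Q Z) (CoPSh Q Z)"
    using A B D interior_spaceD[of X c] interior_spaceD[of Y d] interior_spaceD[of Z e] by simp_all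
  have f': "f \<in> qfunctors Q X Y"
      "\<And>V. V \<in> carrier (CoPSh Q Y) \<Longrightarrow> c (copsh_pull Q X Y f V) \<lesssim>[CoPSh Q X] copsh_pull Q X Y f (d V)"
    and g': "g \<in> qfunctors Q Y Z"
      "\<And>V. V \<in> carrier (CoPSh Q Z) \<Longrightarrow> d (copsh_pull Q Y Z g V) \<lesssim>[CoPSh Q Y] copsh_pull Q Y Z g (e V)"
    using f g X Y Z c d e by (auto simp: continuous_iff)
  note gf = functor_compose[OF X Y Z f'(1) g'(1)]
  have "c (copsh_pull Q X Z (compose (carrier X) g f) V)
      \<lesssim>[CoPSh Q X] copsh_pull Q X Z (compose (carrier X) g f) (e V)"
    if V: "V \<in> carrier (CoPSh Q Z)" for V
  proof -
    have "c (copsh_pull Q X Z (compose (carrier X) g f) V) = c (copsh_pull Q X Y f (copsh_pull Q Y Z g V))"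
      using X Y Z f' g' V by (simp add: copsh_pull_compose)
    also have "\<dots> \<lesssim>[CoPSh Q X] copsh_pull Q X Y f (d (copsh_pull Q Y Z g V))"
      using Y Z g' V by (intro f'(2)) simp
    also have "\<dots> \<lesssim>[CoPSh Q X] copsh_pull Q X Y f (copsh_pull Q Y Z g (e V))"
      using X Y f' by (intro functor_below[OF _ _ g'(2)[OF V]]) simp_all
    also have "\<dots> = copsh_pull Q X Z (compose (carrier X) g f) (e V)"
      using X Y Z f' g' functor_closed[OF e V] by (simp add: copsh_pull_compose)
    finally show ?thesis .
  qed
  then show ?thesis
    using X Z c e gf by (simp add: continuous_iff)
qed

lemma continuous_functor:
  "f \<in> continuous_qfunctors Q A B \<Longrightarrow> f \<in> qfunctors Q (fst A) (fst B)"
  by (cases A; cases B) (simp add: continuous_qfunctors_def)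

lemma QInt_twocategory: "twocategory (QInt Q)"
proof (rule concrete_twocategory)
  show "qcategory Q (fst A)" if "A \<in> Obj (QInt Q)" for A :: "('o, 'a, 'x) intsp"
    using that by (cases A) (simp add: QInt_def interior_spaceD(1))
qed (auto simp: QInt_def continuous_id continuous_compose continuous_functor)


definition alg_to_int :: "('o, 'a, 'x) alg \<Rightarrow> ('o, 'a, 'x) intsp" where
  "alg_to_int = (\<lambda>(X, p). (X, dist_copsh (CoPSh Q X) X (nbhd X p)))"

definition int_to_alg :: "('o, 'a, 'x) intsp \<Rightarrow> ('o, 'a, 'x) alg" where
  "int_to_alg = (\<lambda>(X, c). (X, nerve X (TT X) (dist_psh (CoPSh Q X) X c)))"

lemma int_to_alg_inverse:
  assumes "interior_space Q B"
  shows "lax_algebra Q (Lambda Q) (int_to_alg B)" "alg_to_int (int_to_alg B) = B"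
proof -
  obtain X c where [simp]: "B = (X, c)" by (cases B)
  have X: "qcategory Q X" and c: "c \<in> qfunctors Q (CoPSh Q X) (CoPSh Q X)"
    and cl: "closure_operation Q (CoPSh Q X) c"
    using assms interior_spaceD by auto
  have n: "dist_psh (CoPSh Q X) X c \<in> qfunctors Q X (TT X)" using X c by simp
  show "lax_algebra Q (Lambda Q) (int_to_alg B)"
    using cl by (simp add: int_to_alg_def lax_algebra_nerve_iff[OF X n] closure_operation_iff[OF X c])
  show "alg_to_int (int_to_alg B) = B"
    using X c by (simp add: int_to_alg_def alg_to_int_def nbhd_nerve[OF X n] dist_copsh_psh)
qed

lemma alg_to_int_inverse:
  assumes "lax_algebra Q (Lambda Q) A"
  shows "interior_space Q (alg_to_int A)" "int_to_alg (alg_to_int A) = A"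
proof -
  obtain X p where [simp]: "A = (X, p)" by (cases A)
  have X: "qcategory Q X" and p: "p \<in> qfunctors Q (TT X) (PSh Q X)"
    using assms by (auto simp: lax_algebra_iff)
  let ?c = "dist_copsh (CoPSh Q X) X (nbhd X p)"
  have n: "nbhd X p \<in> qfunctors Q X (TT X)" using X p by simp
  have c: "?c \<in> qfunctors Q (CoPSh Q X) (CoPSh Q X)" using X n by simp
  have eq: "dist_psh (CoPSh Q X) X ?c = nbhd X p" "nerve X (TT X) (nbhd X p) = p"
    using X n assms by (simp_all add: dist_psh_copsh lax_algebra_is_nerve)
  show "interior_space Q (alg_to_int A)"
    using assms lax_algebra_nerve_iff[OF X n] X
    by (simp add: alg_to_int_def interior_space_def closure_operation_iff[OF X c] eq)
  show "int_to_alg (alg_to_int A) = A"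
    by (simp add: int_to_alg_def alg_to_int_def eq)
qed

lemma fst_int_to_alg [simp]: "fst (int_to_alg B) = fst B"
  by (cases B) (simp add: int_to_alg_def)

lemma fst_alg_to_int [simp]: "fst (alg_to_int A) = fst A"
  by (cases A) (simp add: alg_to_int_def)

text \<open>
  Corresponding objects have literally the same morphisms, so both 2-functors act as the identity on
  morphisms, and only closure under identities and composition has to be shown, on the side of
  interior spaces.
\<close>

lemma lax_homs_int_to_alg:
  assumes "interior_space Q B" "interior_space Q B'"
  shows "lax_homs Q (int_to_alg B) (int_to_alg B') = continuous_qfunctors Q B B'"
proof -
  obtain X c Y d where [simp]: "B = (X, c)" "B' = (Y, d)" by (cases B, cases B')
  note D = interior_spaceD(1,2)[OF assms(1)[simplified]] interior_spaceD(1,2)[OF assms(2)[simplified]]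
  show ?thesis
    using lax_hom_iff_continuous[OF D(1,3) _ D(2,4)]
    by (auto simp: lax_homs_def int_to_alg_def continuous_qfunctors_def DP_def)
qed

lemma QInt_sel:
  "Obj (QInt Q) = {A. interior_space Q A}" "Mor (QInt Q) = continuous_qfunctors Q"
  "mle (QInt Q) = (\<lambda>A B. fun_le Q (fst A) (fst B))"
  "mcmp (QInt Q) = (\<lambda>A B D g f. compose (carrier (fst A)) g f)"
  "mid (QInt Q) = (\<lambda>A. \<lambda>x \<in> carrier (fst A). x)"
  by (simp_all add: QInt_def)

lemma QAlg_sel:
  "Obj (QAlg Q \<Lambda>) = {A. lax_algebra Q \<Lambda> A}" "Mor (QAlg Q \<Lambda>) = lax_homs Q"
  "mle (QAlg Q \<Lambda>) = (\<lambda>A B. fun_le Q (fst A) (fst B))"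
  "mcmp (QAlg Q \<Lambda>) = (\<lambda>A B D g f. compose (carrier (fst A)) g f)"
  "mid (QAlg Q \<Lambda>) = (\<lambda>A. \<lambda>x \<in> carrier (fst A). x)"
  by (simp_all add: QAlg_def)

lemma lax_homs_alg_to_int:
  assumes "lax_algebra Q (Lambda Q) A" "lax_algebra Q (Lambda Q) A'"
  shows "lax_homs Q A A' = continuous_qfunctors Q (alg_to_int A) (alg_to_int A')"
  using lax_homs_int_to_alg[OF alg_to_int_inverse(1)[OF assms(1)] alg_to_int_inverse(1)[OF assms(2)]]
  by (simp add: alg_to_int_inverse(2) assms)

lemma QAlg_twocategory: "twocategory (QAlg Q (Lambda Q))"
proof (rule concrete_twocategory)
  fix A :: "('o, 'a, 'x) alg" assume "A \<in> Obj (QAlg Q (Lambda Q))"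
  then have A: "lax_algebra Q (Lambda Q) A" by (simp add: QAlg_sel)
  then show "qcategory Q (fst A)" by (cases A) (simp add: lax_algebra_iff)
  show "mid (QAlg Q (Lambda Q)) A \<in> Mor (QAlg Q (Lambda Q)) A A"
    using A continuous_id[OF alg_to_int_inverse(1)[OF A]] by (simp add: QAlg_sel lax_homs_alg_to_int)
next
  fix A B D :: "('o, 'a, 'x) alg" and f g
  assume "A \<in> Obj (QAlg Q (Lambda Q))" "B \<in> Obj (QAlg Q (Lambda Q))" "D \<in> Obj (QAlg Q (Lambda Q))"
    and "f \<in> Mor (QAlg Q (Lambda Q)) A B" "g \<in> Mor (QAlg Q (Lambda Q)) B D"
  then show "mcmp (QAlg Q (Lambda Q)) A B D g f \<in> Mor (QAlg Q (Lambda Q)) A D"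
    using continuous_compose[of "alg_to_int A" "alg_to_int B" "alg_to_int D" f g]
    by (simp add: QAlg_sel lax_homs_alg_to_int alg_to_int_inverse(1))
next
  fix A B :: "('o, 'a, 'x) alg" and f
  show "f \<in> Mor (QAlg Q (Lambda Q)) A B \<Longrightarrow> f \<in> qfunctors Q (fst A) (fst B)"
    by (cases A; cases B) (simp add: QAlg_sel lax_homs_def)
qed (simp_all add: QAlg_sel)

theorem QAlg_QInt_isomorphic:
  "isomorphic_twocats (QAlg Q (Lambda Q :: ('o, 'a, 'x) law))
    (QInt Q :: (('o, 'a, 'x) intsp, 'x \<Rightarrow> 'x) twocat)"
  unfolding isomorphic_twocats_def
proof (intro conjI exI)
  let ?I = "\<lambda>(_ :: ('o, 'a, 'x) alg) (_ :: ('o, 'a, 'x) alg) (f :: 'x \<Rightarrow> 'x). f"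
  let ?J = "\<lambda>(_ :: ('o, 'a, 'x) intsp) (_ :: ('o, 'a, 'x) intsp) (f :: 'x \<Rightarrow> 'x). f"
  show "twofunctor (QAlg Q (Lambda Q)) (QInt Q) alg_to_int ?I"
    unfolding twofunctor_def QAlg_sel QInt_sel
    by (auto simp: alg_to_int_inverse lax_homs_alg_to_int)
  show "twofunctor (QInt Q) (QAlg Q (Lambda Q)) int_to_alg ?J"
    unfolding twofunctor_def QAlg_sel QInt_sel
    by (auto simp: int_to_alg_inverse lax_homs_int_to_alg)
qed (auto simp: QAlg_twocategory QInt_twocategory QAlg_sel QInt_sel alg_to_int_inverse int_to_alg_inverse)

end

theorem theorem6p3:
  fixes Q :: "('o, 'a) quantaloid"
  assumes "quantaloid Q"
  shows "flat_distributive_law Q (Lambda Q :: ('o, 'a, 'x) law) (Lambda Q) (Lambda Q)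
    \<and> (\<forall>X :: ('o, 'a, 'x) qcat. qcategory Q X \<longrightarrow>
        Lambda Q X = compose (carrier (DP Q (PSh Q X)))
          (yon (DP Q X))
          (psh_pull Q (CoPSh Q X) (CoPSh Q (PSh Q X)) (copsh_push Q X (PSh Q X) (yon X))))
    \<and> isomorphic_twocats
        (QAlg Q (Lambda Q :: ('o, 'a, 'x) law))
        (QInt Q :: (('o, 'a, 'x) intsp, 'x \<Rightarrow> 'x) twocat)"
proof -
  interpret quantaloid Q by fact
  have "flat_distributive_law Q (Lambda Q :: ('o, 'a, 'x) law) (Lambda Q) (Lambda Q)"
    by (simp add: flat_distributive_law_def Lambda_distributive_law Lambda_flat)
  then show ?thesis
    using QAlg_QInt_isomorphic by (simp add: Lambda_eq yon_radj_def DP_def)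
qed

end
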